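(* Let $r\in\mathbb{N}\cup\{\infty\}$. Every $r$-locally 2-connected graph $G$ can be obtained by (repeated) $r$-local 2-sums from $r$-locally 3-connected graphs and cycles of length at most $r$.
   Context: Some edges may carry positive integer lengths (treated as paths of that length). For a vertex $v$ and integer $s$, $B_s(v)$ is the subgraph induced by vertices at distance at most $s$ from $v$ with edges joining two vertices at distance exactly $s$ removed; for a half-integer $s+\tfrac12$, $B_{s+1/2}(v)$ is induced by vertices at distance at most $s$. A vertex $v$ is an $r$-local cutvertex if $B_{r/2}(v)-v$ is disconnected. The core of $v,w$ is the set of vertices on shortest $v$–$w$ paths; $\mathrm{expl}(v,w)$ is the union of a copy of $B_{r/2}(v)$ and a copy of $B_{r/2}(w)$, each vertex $u$ labelled by the set of shortest core–$u$ paths inside the respective ball, where two vertices are identified only if they are copies of the same vertex with the same label. $\{v,w\}$ is an $r$-local 2-separator if $d(v,w)\le r/2$ and $\mathrm{expl}(v,w)-v-w$ is disconnected. A connected graph is $r$-locally 2-connected if it has no $r$-local cutvertex and contains a cycle of length at most $r$; a graph is $r$-locally 2-connected if all its components are. A connected $r$-locally 2-connected graph is $r$-locally 3-connected if it has no $r$-local 2-separator and has at least four vertices; a graph is $r$-locally 3-connected if it is $r$-locally 2-connected and all components are $r$-locally 3-connected. Local 2-sum: given a family $(G_i\mid i\in[n])$ of graphs (repetitions allowed) and a set of distinct directed edges $e_i\in E(G_i)$, form the disjoint union of the set $\{G_i\}$ (one copy per distinct graph), identify all start vertices of the $e_i$ to one vertex and all terminal vertices to one vertex, and delete all $e_i$.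 It is required that the length of each $e_i$ equals $\min_{j\ne i}\gamma_j$, where $\gamma_j$ is the length of a shortest path between the endvertices of $e_j$ in $G_j-e_j$. It is $r$-local if any two start vertices, or any two terminal vertices, of distinct edges $e_i,e_j$ with the same host graph $G_i=G_j$ have distance at least $r+1$.
   Formalization: A disconnected graph counts as obtained if each component is (two disjoint triangles are not a 2-sum); deleting v,w from expl(v,w) also deletes v–w edges with their inner points; inner points of long edges are not tested as cutvertices or separators, nor counted as vertices. *)

theory Defs
  imports "Graph_Theory.Digraph_Component" "Graph_Theory.Shortest_Path"
begin

section \<open>Undirected multigraphs\<close>

text \<open>
  An undirected multigraph is a \<^typ>\<open>('a, 'b) pre_digraph\<close> in which the direction of an arc
  is only a reference orientation. An undirected walk is a directed walk of \<open>bidirect G\<close>, which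
  has both directions \<open>(e, True)\<close> and \<open>(e, False)\<close> of every edge \<open>e\<close>; its arcs are the directed
  edges of the graph. The library's \<^const>\<open>connected\<close> already ignores directions.
\<close>

definition bidirect :: "('a, 'b, 'z) pre_digraph_scheme \<Rightarrow> ('a, 'b \<times> bool) pre_digraph" where
  "bidirect G =
    \<lparr> verts = verts G,
      arcs = arcs G \<times> UNIV,
      tail = (\<lambda>(e, fwd). if fwd then tail G e else head G e),
      head = (\<lambda>(e, fwd). if fwd then head G e else tail G e) \<rparr>"

definition gdist :: "('a, 'b) pre_digraph \<Rightarrow> 'a \<Rightarrow> 'a \<Rightarrow> ereal" where
  "gdist G u v = wf_digraph.\<mu> (bidirect G) (\<lambda>_. 1) u v"

text \<open>Traversing one edge back and forth is a cycle of \<open>bidirect G\<close>, but not of \<open>G\<close>.\<close>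

definition undirected_cycle :: "('a, 'b) pre_digraph \<Rightarrow> ('b \<times> bool) list \<Rightarrow> bool" where
  "undirected_cycle G p \<longleftrightarrow> pre_digraph.cycle (bidirect G) p \<and> distinct (map fst p)"

text \<open>The graph without vertices counts neither as connected nor as disconnected.\<close>

definition disconnected :: "('a, 'b) pre_digraph \<Rightarrow> bool" where
  "disconnected G \<longleftrightarrow> verts G \<noteq> {} \<and> \<not> connected G"

text \<open>
  The ball of radius \<open>\<rho>\<close>, used for integers, half-integers and \<open>\<infinity>\<close>. All distances are integers
  or \<open>\<infinity>\<close>, so the clause about edges between vertices at distance exactly \<open>\<rho>\<close> removes something
  only if \<open>\<rho>\<close> is an integer. The ball of radius \<open>\<infinity>\<close> is the component of the centre.
\<close>

definition ball_graph :: "ereal \<Rightarrow> ('a, 'b) pre_digraph \<Rightarrow> 'a \<Rightarrow> ('a, 'b) pre_digraph" where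
  "ball_graph \<rho> G v =
    (let B = G \<restriction> {u \<in> verts G. gdist G v u \<le> \<rho> \<and> gdist G v u < \<infinity>}
     in B \<lparr> arcs := {e \<in> arcs B. \<not> (gdist G v (tail G e) = \<rho> \<and> gdist G v (head G e) = \<rho>)} \<rparr>)"

abbreviation half :: "enat \<Rightarrow> ereal" where
  "half r \<equiv> ereal_of_enat r / 2"

definition core :: "('a, 'b) pre_digraph \<Rightarrow> 'a \<Rightarrow> 'a \<Rightarrow> 'a set" where
  "core G v w =
    {x. \<exists>p. pre_digraph.apath (bidirect G) v p w \<and> ereal (length p) = gdist G v w
          \<and> x \<in> set (pre_digraph.awalk_verts (bidirect G) v p)}"

text \<open>
  The set of shortest paths in \<open>B\<close> from \<open>C\<close> to \<open>u\<close>; a path is given by its first vertex and its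
  sequence of directed edges.
\<close>

definition core_label ::
    "('a, 'b) pre_digraph \<Rightarrow> 'a set \<Rightarrow> 'a \<Rightarrow> ('a \<times> ('b \<times> bool) list) set" where
  "core_label B C u =
    {(c, p). c \<in> C \<and> pre_digraph.apath (bidirect B) c p u
       \<and> (\<forall>c' \<in> C. \<forall>p'. pre_digraph.apath (bidirect B) c' p' u \<longrightarrow> length p \<le> length p')}"

text \<open>
  The copy of a graph \<open>B\<close> with vertices tagged by a labelling \<open>l\<close>. In the union of two such copies
  two vertices coincide iff they are copies of the same vertex with the same label.
\<close>

definition labelled_copy ::
    "('a, 'b) pre_digraph \<Rightarrow> ('a \<Rightarrow> 'l) \<Rightarrow> ('a \<times> 'l, 'b \<times> 'l \<times> 'l) pre_digraph" where
  "labelled_copy B l =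
    \<lparr> verts = (\<lambda>u. (u, l u)) ` verts B,
      arcs = (\<lambda>e. (e, l (tail B e), l (head B e))) ` arcs B,
      tail = (\<lambda>(e, l1, l2). (tail B e, l1)),
      head = (\<lambda>(e, l1, l2). (head B e, l2)) \<rparr>"

definition expl ::
    "enat \<Rightarrow> ('a, 'b) pre_digraph \<Rightarrow> 'a \<Rightarrow> 'a \<Rightarrow>
      ('a \<times> ('a \<times> ('b \<times> bool) list) set,
       'b \<times> ('a \<times> ('b \<times> bool) list) set \<times> ('a \<times> ('b \<times> bool) list) set) pre_digraph" where
  "expl r G v w =
    (let C = core G v w;
         Bv = ball_graph (half r) G v;
         Bw = ball_graph (half r) G w
     in Digraph_Component.union
          (labelled_copy Bv (core_label Bv C)) (labelled_copy Bw (core_label Bw C)))"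


section \<open>Graphs with edge lengths\<close>

record ('a, 'b) lgraph = "('a, 'b) pre_digraph" +
  len :: "'b \<Rightarrow> nat"

abbreviation underlying :: "('a, 'b) lgraph \<Rightarrow> ('a, 'b) pre_digraph" where
  "underlying G \<equiv> pre_digraph.truncate G"

definition is_lgraph :: "('a, 'b) lgraph \<Rightarrow> bool" where
  "is_lgraph G \<longleftrightarrow>
    fin_digraph (underlying G) \<and> loopfree_digraph (underlying G) \<and> (\<forall>e \<in> arcs G. 0 < len G e)"

definition component :: "('a, 'b) lgraph \<Rightarrow> ('a, 'b) lgraph \<Rightarrow> bool" where
  "component G C \<longleftrightarrow>
    pre_digraph.max_subgraph (underlying G) connected (underlying C) \<and> len C = len G"

definition lgraph_iso :: "('a, 'b) lgraph \<Rightarrow> ('c, 'd) lgraph \<Rightarrow> bool" where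
  "lgraph_iso G H \<longleftrightarrow>
    (\<exists>f g. bij_betw f (verts G) (verts H) \<and> bij_betw g (arcs G) (arcs H)
       \<and> (\<forall>e \<in> arcs G. {f (tail G e), f (head G e)} = {tail H (g e), head H (g e)}
                     \<and> len G e = len H (g e)))"

text \<open>
  Edges of length \<open>n\<close> stand for paths of length \<open>n\<close>: \<open>subdivide G\<close> has unit length edges, the
  point \<open>Inner e k\<close> lies on the edge \<open>e\<close> at distance \<open>k\<close> from \<open>tail G e\<close>, and \<open>(e, k)\<close> is the
  \<open>k\<close>-th of the \<open>len G e\<close> pieces of \<open>e\<close>. Distances, balls, cores, explorer neighbourhoods and
  lengths of cycles in \<open>G\<close> are those of \<open>subdivide G\<close>.
\<close>

datatype ('a, 'b) point = Node 'a | Inner 'b nat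

definition subdivide :: "('a, 'b) lgraph \<Rightarrow> (('a, 'b) point, 'b \<times> nat) pre_digraph" where
  "subdivide G =
    \<lparr> verts = Node ` verts G \<union> {Inner e k | e k. e \<in> arcs G \<and> 0 < k \<and> k < len G e},
      arcs = {(e, k). e \<in> arcs G \<and> k < len G e},
      tail = (\<lambda>(e, k). if k = 0 then Node (tail G e) else Inner e k),
      head = (\<lambda>(e, k). if Suc k = len G e then Node (head G e) else Inner e (Suc k)) \<rparr>"

definition ldist :: "('a, 'b) lgraph \<Rightarrow> 'a \<Rightarrow> 'a \<Rightarrow> ereal" where
  "ldist G u v = gdist (subdivide G) (Node u) (Node v)"


section \<open>Local connectivity\<close>

definition local_cutvertex :: "enat \<Rightarrow> ('a, 'b) lgraph \<Rightarrow> 'a \<Rightarrow> bool" where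
  "local_cutvertex r G v \<longleftrightarrow>
    v \<in> verts G \<and>
    disconnected (pre_digraph.del_vert (ball_graph (half r) (subdivide G) (Node v)) (Node v))"

text \<open>
  Deleting \<open>v\<close> and \<open>w\<close> deletes the edges between them; so the inner points of such an edge (of
  length at least two) are deleted as well and do not form a component of their own.
\<close>

definition edge_points :: "('a, 'b) lgraph \<Rightarrow> 'a \<Rightarrow> 'a \<Rightarrow> ('a, 'b) point set" where
  "edge_points G v w = {Inner e k | e k. e \<in> arcs G \<and> {tail G e, head G e} = {v, w}}"

definition local_2_separator :: "enat \<Rightarrow> ('a, 'b) lgraph \<Rightarrow> 'a \<Rightarrow> 'a \<Rightarrow> bool" where
  "local_2_separator r G v w \<longleftrightarrow>
    v \<in> verts G \<and> w \<in> verts G \<and> v \<noteq> w \<and> ldist G v w \<le> half r \<and>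
    (let E = expl r (subdivide G) (Node v) (Node w)
     in disconnected (E \<restriction> {x \<in> verts E. fst x \<notin> {Node v, Node w} \<union> edge_points G v w}))"

definition connected_locally_2_connected :: "enat \<Rightarrow> ('a, 'b) lgraph \<Rightarrow> bool" where
  "connected_locally_2_connected r G \<longleftrightarrow>
    is_lgraph G \<and> connected (underlying G) \<and> (\<forall>v \<in> verts G. \<not> local_cutvertex r G v) \<and>
    (\<exists>p. undirected_cycle (subdivide G) p \<and> enat (length p) \<le> r)"

definition locally_2_connected :: "enat \<Rightarrow> ('a, 'b) lgraph \<Rightarrow> bool" where
  "locally_2_connected r G \<longleftrightarrow>
    is_lgraph G \<and> (\<forall>C. component G C \<longrightarrow> connected_locally_2_connected r C)"

definition connected_locally_3_connected :: "enat \<Rightarrow> ('a, 'b) lgraph \<Rightarrow> bool" where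
  "connected_locally_3_connected r G \<longleftrightarrow>
    connected_locally_2_connected r G \<and> (\<forall>v w. \<not> local_2_separator r G v w) \<and> 4 \<le> card (verts G)"

definition locally_3_connected :: "enat \<Rightarrow> ('a, 'b) lgraph \<Rightarrow> bool" where
  "locally_3_connected r G \<longleftrightarrow>
    locally_2_connected r G \<and> (\<forall>C. component G C \<longrightarrow> connected_locally_3_connected r C)"

definition cycle_graph_upto :: "enat \<Rightarrow> ('a, 'b) lgraph \<Rightarrow> bool" where
  "cycle_graph_upto r G \<longleftrightarrow>
    is_lgraph G \<and>
    (\<exists>p. undirected_cycle (subdivide G) p \<and> enat (length p) \<le> r
       \<and> arcs (subdivide G) = fst ` set p
       \<and> verts (subdivide G) = tail (bidirect (subdivide G)) ` set p)"


section \<open>Local 2-sums\<close>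

text \<open>
  A family \<open>G\<^sub>0, \<dots>, G\<^sub>n\<^sub>-\<^sub>1\<close> is a function on indices below \<open>n\<close>. Members that are equal are the same
  graph and contribute one copy to the disjoint union; several copies of a graph are
  obtained by taking members that are isomorphic, but not equal. The directed edge \<open>es i\<close> is an
  arc of \<open>bidirect (Gs i)\<close>, with underlying edge \<open>fst (es i)\<close>.
\<close>

definition start_of :: "(nat \<Rightarrow> ('a, 'b) lgraph) \<Rightarrow> (nat \<Rightarrow> 'b \<times> bool) \<Rightarrow> nat \<Rightarrow> 'a" where
  "start_of Gs es i = tail (bidirect (Gs i)) (es i)"

definition terminal_of :: "(nat \<Rightarrow> ('a, 'b) lgraph) \<Rightarrow> (nat \<Rightarrow> 'b \<times> bool) \<Rightarrow> nat \<Rightarrow> 'a" where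
  "terminal_of Gs es i = head (bidirect (Gs i)) (es i)"

definition remove_edge :: "('a, 'b) lgraph \<Rightarrow> 'b \<Rightarrow> ('a, 'b) lgraph" where
  "remove_edge G e = G \<lparr> arcs := arcs G - {e} \<rparr>"

definition edge_gap :: "(nat \<Rightarrow> ('a, 'b) lgraph) \<Rightarrow> (nat \<Rightarrow> 'b \<times> bool) \<Rightarrow> nat \<Rightarrow> ereal" where
  "edge_gap Gs es j =
    ldist (remove_edge (Gs j) (fst (es j))) (start_of Gs es j) (terminal_of Gs es j)"

text \<open>
  The last clause says that the two vertices of the sum obtained by the identifications are
  distinct. For \<open>n < 2\<close> the minimum in the condition on lengths would be over the empty set.
\<close>

definition summable_family ::
    "nat \<Rightarrow> (nat \<Rightarrow> ('a, 'b) lgraph) \<Rightarrow> (nat \<Rightarrow> 'b \<times> bool) \<Rightarrow> bool" where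
  "summable_family n Gs es \<longleftrightarrow>
    2 \<le> n \<and>
    (\<forall>i<n. is_lgraph (Gs i) \<and> es i \<in> arcs (bidirect (Gs i))) \<and>
    inj_on (\<lambda>i. (Gs i, fst (es i))) {..<n} \<and>
    (\<forall>i<n. ereal (len (Gs i) (fst (es i))) = (INF j \<in> {..<n} - {i}. edge_gap Gs es j)) \<and>
    (\<forall>i<n. \<forall>j<n. Gs i = Gs j \<longrightarrow> start_of Gs es i \<noteq> terminal_of Gs es j)"

definition local_family ::
    "enat \<Rightarrow> nat \<Rightarrow> (nat \<Rightarrow> ('a, 'b) lgraph) \<Rightarrow> (nat \<Rightarrow> 'b \<times> bool) \<Rightarrow> bool" where
  "local_family r n Gs es \<longleftrightarrow>
    (\<forall>i<n. \<forall>j<n. i \<noteq> j \<and> Gs i = Gs j \<longrightarrow>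
       ereal_of_enat r + 1 \<le> ldist (Gs i) (start_of Gs es i) (start_of Gs es j) \<and>
       ereal_of_enat r + 1 \<le> ldist (Gs i) (terminal_of Gs es i) (terminal_of Gs es j))"

datatype 'a sum_vertex = Start | Terminal | Rest 'a

definition sum_proj ::
    "nat \<Rightarrow> (nat \<Rightarrow> ('a, 'b) lgraph) \<Rightarrow> (nat \<Rightarrow> 'b \<times> bool) \<Rightarrow> ('a, 'b) lgraph \<Rightarrow> 'a \<Rightarrow>
      (('a, 'b) lgraph \<times> 'a) sum_vertex" where
  "sum_proj n Gs es K x =
    (if \<exists>i<n. Gs i = K \<and> start_of Gs es i = x then Start
     else if \<exists>i<n. Gs i = K \<and> terminal_of Gs es i = x then Terminal
     else Rest (K, x))"

definition two_sum ::
    "nat \<Rightarrow> (nat \<Rightarrow> ('a, 'b) lgraph) \<Rightarrow> (nat \<Rightarrow> 'b \<times> bool) \<Rightarrow>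
      ((('a, 'b) lgraph \<times> 'a) sum_vertex, ('a, 'b) lgraph \<times> 'b) lgraph" where
  "two_sum n Gs es =
    \<lparr> verts = {sum_proj n Gs es K x | K x. K \<in> Gs ` {..<n} \<and> x \<in> verts K},
      arcs = {(K, e). K \<in> Gs ` {..<n} \<and> e \<in> arcs K} - (\<lambda>i. (Gs i, fst (es i))) ` {..<n},
      tail = (\<lambda>(K, e). sum_proj n Gs es K (tail K e)),
      head = (\<lambda>(K, e). sum_proj n Gs es K (head K e)),
      len = (\<lambda>(K, e). len K e) \<rparr>"

text \<open>
  A 2-sum is formed up to isomorphism. Forming a 2-sum glues its summands together and cannot
  produce, say, two disjoint cycles; so a disconnected graph is understood to be obtained if each
  of its components is. This is what the rule \<open>componentwise\<close> provides.
\<close>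

inductive obtainable :: "enat \<Rightarrow> ('a, 'b) lgraph \<Rightarrow> bool" for r :: enat where
  three_connected: "locally_3_connected r G \<Longrightarrow> obtainable r G"
| short_cycle: "cycle_graph_upto r G \<Longrightarrow> obtainable r G"
| local_2_sum:
    "\<lbrakk> \<forall>i<n. obtainable r (Gs i); summable_family n Gs es; local_family r n Gs es;
       is_lgraph H; lgraph_iso (two_sum n Gs es) H \<rbrakk> \<Longrightarrow> obtainable r H"
| componentwise:
    "\<lbrakk> is_lgraph G; \<forall>C. component G C \<longrightarrow> obtainable r C \<rbrakk> \<Longrightarrow> obtainable r G"


section \<open>Well-formedness\<close>

text \<open>The defining equation of the library's \<open>\<mu>\<close> is available for well-formed graphs only.\<close>

lemma wf_bidirect: "wf_digraph G \<Longrightarrow> wf_digraph (bidirect G)"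
  by (auto simp: bidirect_def wf_digraph_def split: if_splits)

lemma wf_subdivide:
  assumes "is_lgraph G"
  shows "wf_digraph (subdivide G)"
proof -
  have "wf_digraph (underlying G)"
    using assms by (simp add: is_lgraph_def fin_digraph_def)
  then show ?thesis
    by (auto simp: subdivide_def wf_digraph_def pre_digraph.truncate_def)
qed

lemma gdist_conv:
  fixes G :: "('a, 'b) pre_digraph"
  assumes "wf_digraph G"
  shows "gdist G u v = (INF p \<in> {p. pre_digraph.awalk (bidirect G) u p v}. ereal (length p))"
proof -
  interpret B: wf_digraph "bidirect G"
    by (rule wf_bidirect[OF assms])
  have "B.awalk_cost (\<lambda>_. 1) p = real (length p)" for p :: "('b \<times> bool) list"
    by (induction p) auto
  then show ?thesis
    by (simp add: gdist_def B.\<mu>_def)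
qed

end

theory Submission
  imports Defs
begin

text \<open>
  Local connectivity is a property of closed walks of length at most \<open>r\<close>, since an edge \<open>yz\<close> lies in
  the ball of radius \<open>r/2\<close> around \<open>v\<close> iff it forms such a walk with shortest paths from \<open>v\<close> to \<open>y\<close>
  and \<open>z\<close>. So \<open>v\<close> is a local cutvertex iff the edges at \<open>v\<close> can be split into two classes such that no
  short closed walk at \<open>v\<close> leaves in one and returns in the other, and a local 2-separator \<open>{v, w}\<close>
  gives a split of the edges at \<open>v\<close> and \<open>w\<close> that is respected by short closed walks.

  Cut \<open>v\<close> and \<open>w\<close> into two copies each along this split, and join the copies on each side by a
  virtual edge as long as a shortest path through the other side. Replacing the part of a short
  closed walk on one side by the virtual edge shows that the new graph is again locally 2-connected;
  the copies of \<open>v\<close> are at distance more than \<open>r\<close>, and \<open>G\<close> is a local 2-sum of the components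
  of the new graph, of which there are one or two. If there are two, each has fewer edges than \<open>G\<close>. If there is
  one, the first \<open>\<int>/2\<close>-cohomology group of the graph with all short cycles filled in has become
  smaller. A graph that admits no such cut is locally 3-connected, or it has at most three
  vertices and is a cycle or consists of three parallel edges.
\<close>

section \<open>Weighted walks\<close>

text \<open>All conditions concern segments: walks between \<open>v\<close> and \<open>w\<close>
  with no inner visit to either. A segment from one of them to the other counts only if its length
  plus \<open>k\<close>, the distance of \<open>v\<close> and \<open>w\<close>, is at most
  \<open>r\<close>. The slack is natural: the rest of a short closed walk through it costs at least
  \<open>k\<close>, so all segments of short closed walks are controlled, while longer segments may
  change sides. Local 2-connectivity at \<open>v\<close> forces a short closed walk that uses both
  sides, so the shortest lengths through the sides satisfy \<open>gA + gB \<le> r\<close>, and each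
  virtual edge lies on a short cycle.

  A cut that leaves the graph connected adds two vertices and two edges, so counting these does not
  show termination. Every cochain of a component of the cut graph is, up to coboundaries, pulled
  back from \<open>G\<close>; a walk between the two copies of \<open>v\<close> becomes a closed
  walk of \<open>G\<close>, and the cochain of \<open>G\<close> that detects it becomes trivial
  after the cut.

  A side with a single edge would be split off as a cycle of length two and leave a copy of
  \<open>G\<close>. Hence a cut is only made if each side has two edges.\<close>

definition joins :: "('a, 'b, 'z) pre_digraph_scheme \<Rightarrow> 'b \<Rightarrow> 'a \<Rightarrow> 'a \<Rightarrow> bool" where
  "joins G e x y \<longleftrightarrow> e \<in> arcs G \<and> (tail G e = x \<and> head G e = y \<or> head G e = x \<and> tail G e = y)"

text \<open>A walk is recorded by its edges, which determine it together with its first vertex. The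
  edges of a graph keep their names when it is cut, so one list can be read in both graphs. The ends
  avoid \<open>X\<close> as well.\<close>

inductive wk :: "('a, 'b, 'z) pre_digraph_scheme \<Rightarrow> 'a set \<Rightarrow> 'a \<Rightarrow> 'b list \<Rightarrow> 'a \<Rightarrow> bool" for G X where
  Nil: "x \<in> verts G \<Longrightarrow> x \<notin> X \<Longrightarrow> wk G X x [] x"
| Cons: "joins G e x z \<Longrightarrow> x \<in> verts G \<Longrightarrow> x \<notin> X \<Longrightarrow> wk G X z es y \<Longrightarrow> wk G X x (e # es) y"

abbreviation wt :: "('a, 'b) lgraph \<Rightarrow> 'b list \<Rightarrow> nat" where
  "wt G es \<equiv> sum_list (map (len G) es)"

lemma joins_symD: "joins G e x y \<Longrightarrow> joins G e y x"
  by (auto simp: joins_def)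

lemma joins_arc: "joins G e x y \<Longrightarrow> e \<in> arcs G"
  by (simp add: joins_def)

lemma joins_ends: "joins G e x y \<Longrightarrow> joins G e x' y' \<Longrightarrow> x' = x \<and> y' = y \<or> x' = y \<and> y' = x"
  by (auto simp: joins_def)

lemma wk_Nil_iff: "wk G X x [] y \<longleftrightarrow> x = y \<and> x \<in> verts G \<and> x \<notin> X"
  by (auto intro: wk.Nil elim: wk.cases)

lemma wk_Cons_iff:
  "wk G X x (e # es) y \<longleftrightarrow> x \<in> verts G \<and> x \<notin> X \<and> (\<exists>z. joins G e x z \<and> wk G X z es y)"
  by (auto intro: wk.Cons elim: wk.cases)

lemma wk_ends: "wk G X x es y \<Longrightarrow> x \<in> verts G \<and> x \<notin> X \<and> y \<in> verts G \<and> y \<notin> X"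
  by (induction rule: wk.induct) auto

lemma wk_append_iff: "wk G X x (es @ fs) y \<longleftrightarrow> (\<exists>z. wk G X x es z \<and> wk G X z fs y)"
proof (induction es arbitrary: x)
  case Nil
  then show ?case using wk_ends[of G X x fs y] by (auto simp: wk_Nil_iff)
next
  case (Cons e es)
  then show ?case by (auto simp: wk_Cons_iff)
qed

lemma wk_append: "wk G X x es z \<Longrightarrow> wk G X z fs y \<Longrightarrow> wk G X x (es @ fs) y"
  using wk_append_iff by fast

lemma wk_snoc: "wk G X x es z \<Longrightarrow> joins G e z y \<Longrightarrow> y \<in> verts G \<Longrightarrow> y \<notin> X \<Longrightarrow> wk G X x (es @ [e]) y"
  by (auto simp: wk_append_iff wk_Cons_iff wk_Nil_iff dest: wk_ends)

lemma wk_single: "joins G e x y \<Longrightarrow> x \<in> verts G \<Longrightarrow> x \<notin> X \<Longrightarrow> y \<in> verts G \<Longrightarrow> y \<notin> X \<Longrightarrow> wk G X x [e] y"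
  by (auto simp: wk_Cons_iff wk_Nil_iff)

lemma wk_rev: "wk G X x es y \<Longrightarrow> wk G X y (rev es) x"
proof (induction rule: wk.induct)
  case (Nil x)
  then show ?case by (simp add: wk.Nil)
next
  case (Cons e x z es y)
  then show ?case using wk_snoc[OF Cons.IH joins_symD[OF Cons(1)]] by simp
qed

lemma wk_mono: "wk G X x es y \<Longrightarrow> Y \<subseteq> X \<Longrightarrow> wk G Y x es y"
  by (induction rule: wk.induct) (auto intro: wk.intros)

lemma wk_arcs: "wk G X x es y \<Longrightarrow> set es \<subseteq> arcs G"
  by (induction rule: wk.induct) (auto simp: joins_def)

lemma wk_map:
  assumes "wk G X x es y"
    and "\<And>e x y. e \<in> set es \<Longrightarrow> joins G e x y \<Longrightarrow> x \<notin> X \<Longrightarrow> y \<notin> X \<Longrightarrow> joins H (g e) (f x) (f y)"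
    and "\<And>x. x \<in> verts G \<Longrightarrow> x \<notin> X \<Longrightarrow> f x \<in> verts H \<and> f x \<notin> Y"
  shows "wk H Y (f x) (map g es) (f y)"
  using assms
proof (induction rule: wk.induct)
  case (Nil x)
  then show ?case by (auto intro: wk.Nil)
next
  case (Cons e x z es y)
  then show ?case using wk_ends[OF Cons(4)] by (auto intro!: wk.Cons)
qed

lemma wk_cong_mono:
  assumes "wk G X x es y"
    and "\<And>e x y. e \<in> set es \<Longrightarrow> joins G e x y \<Longrightarrow> x \<notin> X \<Longrightarrow> y \<notin> X \<Longrightarrow> joins H e x y"
    and "\<And>x. x \<in> verts G \<Longrightarrow> x \<notin> X \<Longrightarrow> x \<in> verts H \<and> x \<notin> Y"
  shows "wk H Y x es y"
  using wk_map[OF assms(1), where f = "\<lambda>x. x" and g = "\<lambda>e. e" and H = H and Y = Y] assms(2,3) by simp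

lemma wk_first_hit:
  assumes "wk G X x es y" "x \<notin> T"
  shows "wk G (X \<union> T) x es y \<or>
    (\<exists>es1 f es2 u z. es = es1 @ f # es2 \<and> wk G (X \<union> T) x es1 u \<and> joins G f u z
       \<and> z \<in> T \<and> wk G X z es2 y)"
  using assms
proof (induction rule: wk.induct)
  case (Nil x)
  then show ?case by (auto intro: wk.Nil)
next
  case (Cons e x z es y)
  show ?case
  proof (cases "z \<in> T")
    case True
    then have "e # es = [] @ e # es \<and> wk G (X \<union> T) x [] x \<and> joins G e x z \<and> z \<in> T \<and> wk G X z es y"
      using Cons by (auto intro: wk.Nil)
    then show ?thesis by blast
  next
    case False
    from Cons.IH[OF False] show ?thesis
    proof (elim disjE exE conjE)
      assume "wk G (X \<union> T) z es y"
      then show ?thesis using Cons by (auto intro: wk.Cons)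
    next
      fix es1 f es2 u z'
      assume *: "es = es1 @ f # es2" "wk G (X \<union> T) z es1 u" "joins G f u z'" "z' \<in> T" "wk G X z' es2 y"
      have "e # es = (e # es1) @ f # es2" "wk G (X \<union> T) x (e # es1) u"
        using * Cons by (auto intro: wk.Cons)
      then show ?thesis using * by blast
    qed
  qed
qed

lemma wk_last_hit:
  assumes "wk G X x es y" "y \<notin> T"
  shows "wk G (X \<union> T) x es y \<or>
    (\<exists>es1 f es2 u z. es = es1 @ f # es2 \<and> wk G X x es1 z \<and> z \<in> T \<and> joins G f z u
       \<and> wk G (X \<union> T) u es2 y)"
proof -
  from wk_first_hit[OF wk_rev[OF assms(1)] assms(2)] show ?thesis
  proof (elim disjE exE conjE)
    assume "wk G (X \<union> T) y (rev es) x"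
    then show ?thesis using wk_rev by fastforce
  next
    fix es1 f es2 u z
    assume *: "rev es = es1 @ f # es2" "wk G (X \<union> T) y es1 u" "joins G f u z" "z \<in> T" "wk G X z es2 x"
    have "es = rev es2 @ f # rev es1"
      using arg_cong[OF *(1), of rev] by simp
    moreover have "wk G X x (rev es2) z" "wk G (X \<union> T) u (rev es1) y"
      using * wk_rev by fast+
    moreover have "joins G f z u" using *(3) by (rule joins_symD)
    ultimately show ?thesis using *(4) by blast
  qed
qed

section \<open>Segments: walks whose inner vertices avoid a set\<close>

definition inc :: "('a, 'b, 'z) pre_digraph_scheme \<Rightarrow> 'b \<Rightarrow> 'a \<Rightarrow> bool" where
  "inc G e x \<longleftrightarrow> e \<in> arcs G \<and> (tail G e = x \<or> head G e = x)"

lemma inc_joins: "inc G e x \<longleftrightarrow> (\<exists>y. joins G e x y)"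
  by (auto simp: inc_def joins_def)

text \<open>The ends are free: they may lie in \<open>X\<close>, and they may coincide. A single
  edge has no inner vertex, whereas \<open>wk\<close> always has at least one vertex; hence the
  separate case.\<close>

definition sg :: "('a, 'b, 'z) pre_digraph_scheme \<Rightarrow> 'a set \<Rightarrow> 'a \<Rightarrow> 'b list \<Rightarrow> 'a \<Rightarrow> bool" where
  "sg G X s es t \<longleftrightarrow> (\<exists>e. es = [e] \<and> joins G e s t) \<or>
     (\<exists>e x ms y f. es = e # ms @ [f] \<and> joins G e s x \<and> wk G X x ms y \<and> joins G f y t)"

lemma sg_singleI: "joins G e s t \<Longrightarrow> sg G X s [e] t"
  by (auto simp: sg_def)

lemma sgI: "joins G e s x \<Longrightarrow> wk G X x ms y \<Longrightarrow> joins G f y t \<Longrightarrow> sg G X s (e # ms @ [f]) t"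
  by (auto simp: sg_def)

lemma sg_rev:
  assumes "sg G X s es t"
  shows "sg G X t (rev es) s"
  using assms unfolding sg_def
proof (elim disjE exE conjE)
  fix e x ms y f
  assume "es = e # ms @ [f]" "joins G e s x" "wk G X x ms y" "joins G f y t"
  then have "rev es = f # rev ms @ [e]" "joins G f t y" "wk G X y (rev ms) x" "joins G e x s"
    by (simp_all add: wk_rev) (simp_all add: joins_def, blast+)
  then show "(\<exists>e. rev es = [e] \<and> joins G e t s) \<or> (\<exists>e x ms y f. rev es = e # ms @ [f] \<and>
      joins G e t x \<and> wk G X x ms y \<and> joins G f y s)" by blast
qed (auto simp: joins_def)

lemma sg_ne: "sg G X s es t \<Longrightarrow> es \<noteq> []"
  by (auto simp: sg_def)

lemma sg_joins_hd: "sg G X s es t \<Longrightarrow> \<exists>x. joins G (hd es) s x"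
  and sg_joins_last: "sg G X s es t \<Longrightarrow> \<exists>x. joins G (last es) x t"
  by (auto simp: sg_def)

lemma sg_mono: "sg G X s es t \<Longrightarrow> Y \<subseteq> X \<Longrightarrow> sg G Y s es t"
  unfolding sg_def by (metis wk_mono)

lemma sg_wk:
  assumes "sg G X s es t" "s \<in> verts G" "t \<in> verts G" "s \<notin> Y" "t \<notin> Y" "Y \<subseteq> X"
  shows "wk G Y s es t"
  using assms(1) unfolding sg_def
proof (elim disjE exE conjE)
  fix e
  assume "es = [e]" "joins G e s t"
  then show ?thesis using assms by (auto intro: wk_single)
next
  fix e x ms y f
  assume *: "es = e # ms @ [f]" "joins G e s x" "wk G X x ms y" "joins G f y t"
  then have "wk G Y x (ms @ [f]) t"
    using assms by (auto intro: wk_snoc wk_mono)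
  then show ?thesis
    using assms * by (auto intro: wk.Cons)
qed

lemma wk_first_seg:
  assumes "wk G X s es t" "s \<in> T" "t \<in> T" "es \<noteq> []"
  obtains es1 z es2 where "es = es1 @ es2" "sg G (X \<union> T) s es1 z" "z \<in> T" "wk G X z es2 t"
proof -
  obtain e es' where es: "es = e # es'" using assms(4) by (cases es) auto
  obtain x where e: "joins G e s x" and w: "wk G X x es' t"
    using assms(1) es by (auto simp: wk_Cons_iff)
  show ?thesis
  proof (cases "x \<in> T")
    case True
    then show ?thesis using that[of "[e]" es' x] es e w by (auto intro: sg_singleI)
  next
    case False
    from wk_first_hit[OF w False] show ?thesis
    proof (elim disjE exE conjE)
      assume "wk G (X \<union> T) x es' t"
      then show ?thesis using assms(3) wk_ends by fast
    next
      fix es1 f es2 u z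
      assume *: "es' = es1 @ f # es2" "wk G (X \<union> T) x es1 u" "joins G f u z" "z \<in> T" "wk G X z es2 t"
      show ?thesis
        by (rule that[of "e # es1 @ [f]" es2 z]) (use * es e in \<open>auto intro: sgI\<close>)
    qed
  qed
qed

section \<open>Local connectivity by short closed walks\<close>

text \<open>The inner part avoids \<open>v\<close>, so \<open>v\<close> is visited only at the two
  ends of the closed walk.\<close>

definition short :: "enat \<Rightarrow> ('a, 'b) lgraph \<Rightarrow> 'a \<Rightarrow> 'b \<Rightarrow> 'b \<Rightarrow> bool" where
  "short r G v e f \<longleftrightarrow> (\<exists>x y es. joins G e v x \<and> wk G {v} x es y \<and> joins G f y v
     \<and> enat (len G e + wt G es + len G f) \<le> r)"

text \<open>The equivalence relation generated by \<open>short\<close> has all edges at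
  \<open>v\<close> in one class. Quantifying over invariant sets replaces chains of closed walks,
  and such sets are easy to move between graphs.\<close>

definition linked_at :: "enat \<Rightarrow> ('a, 'b) lgraph \<Rightarrow> 'a \<Rightarrow> bool" where
  "linked_at r G v \<longleftrightarrow> (\<forall>A. (\<forall>e f. short r G v e f \<longrightarrow> (e \<in> A \<longleftrightarrow> f \<in> A)) \<longrightarrow>
     (\<forall>e f. inc G e v \<longrightarrow> inc G f v \<longrightarrow> (e \<in> A \<longleftrightarrow> f \<in> A)))"

text \<open>Local 2-connectivity in terms of walks, with connectedness left aside. Two edges at
  every vertex take the place of the short cycle: linkedness turns them into a short closed walk
  that returns by another edge than it left.\<close>

definition loc2 :: "enat \<Rightarrow> ('a, 'b) lgraph \<Rightarrow> bool" where
  "loc2 r G \<longleftrightarrow> is_lgraph G \<and>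
     (\<forall>v \<in> verts G. (\<exists>e f. e \<noteq> f \<and> inc G e v \<and> inc G f v) \<and> linked_at r G v)"

definition conn :: "('a, 'b, 'z) pre_digraph_scheme \<Rightarrow> bool" where
  "conn G \<longleftrightarrow> verts G \<noteq> {} \<and> (\<forall>x \<in> verts G. \<forall>y \<in> verts G. \<exists>es. wk G {} x es y)"

lemma linked_atD:
  assumes "linked_at r G v" "\<And>e f. short r G v e f \<Longrightarrow> e \<in> A \<longleftrightarrow> f \<in> A" "inc G e v" "inc G f v"
  shows "e \<in> A \<longleftrightarrow> f \<in> A"
  using assms unfolding linked_at_def by blast

lemma short_sym: "short r G v e f \<Longrightarrow> short r G v f e"
proof -
  assume "short r G v e f"
  then obtain x y es where *: "joins G e v x" "wk G {v} x es y" "joins G f y v"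
     "enat (len G e + wt G es + len G f) \<le> r" by (auto simp: short_def)
  then show ?thesis unfolding short_def
    by (intro exI[of _ y] exI[of _ x] exI[of _ "rev es"])
       (use joins_symD[OF *(1)] joins_symD[OF *(3)] wk_rev[OF *(2)] *(4) in
         \<open>simp add: rev_map[symmetric] add.commute add.left_commute\<close>)
qed

lemma is_lgraphD:
  assumes "is_lgraph G"
  shows "finite (verts G)" "finite (arcs G)" "e \<in> arcs G \<Longrightarrow> tail G e \<in> verts G"
    "e \<in> arcs G \<Longrightarrow> head G e \<in> verts G" "e \<in> arcs G \<Longrightarrow> tail G e \<noteq> head G e"
    "e \<in> arcs G \<Longrightarrow> 0 < len G e"
proof -
  interpret fin_digraph "underlying G" using assms by (simp add: is_lgraph_def)
  interpret loopfree_digraph "underlying G" using assms by (simp add: is_lgraph_def)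
  show "finite (verts G)" using finite_verts by (simp add: pre_digraph.truncate_def)
  show "finite (arcs G)" using finite_arcs by (simp add: pre_digraph.truncate_def)
  show "e \<in> arcs G \<Longrightarrow> tail G e \<in> verts G" "e \<in> arcs G \<Longrightarrow> head G e \<in> verts G"
    using wellformed[of e] by (auto simp add: pre_digraph.truncate_def)
  show "e \<in> arcs G \<Longrightarrow> tail G e \<noteq> head G e"
    using no_loops[of e] by (auto simp add: pre_digraph.truncate_def)
  show "e \<in> arcs G \<Longrightarrow> 0 < len G e" using assms by (simp add: is_lgraph_def)
qed

lemma is_lgraphI:
  assumes "finite (verts G)" "finite (arcs G)" "\<And>e. e \<in> arcs G \<Longrightarrow> tail G e \<in> verts G"
    "\<And>e. e \<in> arcs G \<Longrightarrow> head G e \<in> verts G" "\<And>e. e \<in> arcs G \<Longrightarrow> tail G e \<noteq> head G e"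
    "\<And>e. e \<in> arcs G \<Longrightarrow> 0 < len G e"
  shows "is_lgraph G"
  unfolding is_lgraph_def using assms
  by (auto simp: pre_digraph.truncate_def fin_digraph_def fin_digraph_axioms_def
      wf_digraph_def loopfree_digraph_def loopfree_digraph_axioms_def)

lemma joins_verts: "is_lgraph G \<Longrightarrow> joins G e x y \<Longrightarrow> x \<in> verts G \<and> y \<in> verts G \<and> x \<noteq> y"
  using is_lgraphD(3-5)[of G e] by (auto simp: joins_def)

section \<open>Local 2-separations\<close>

text \<open>Initial segments that return to \<open>v\<close> are dropped until one reaches
  \<open>w\<close>.\<close>

lemma seg_of_walk:
  assumes "wk G X v es w" "v \<noteq> w"
  shows "\<exists>es'. sg G (X \<union> {v, w}) v es' w \<and> wt G es' \<le> wt G es \<and> set es' \<subseteq> set es"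
  using assms
proof (induction "length es" arbitrary: es rule: less_induct)
  case less
  then have ne: "es \<noteq> []" by (auto simp: wk_Nil_iff)
  obtain es1 z es2 where
    *: "es = es1 @ es2" "sg G (X \<union> {v, w}) v es1 z" "z \<in> {v, w}" "wk G X z es2 w"
    by (rule wk_first_seg[OF less(2), of "{v, w}"]) (use ne in auto)
  show ?case
  proof (cases "z = w")
    case True
    then show ?thesis using * by auto
  next
    case False
    then have "wk G X v es2 w" "length es2 < length es" using * sg_ne[OF *(2)] by auto
    with less obtain es' where "sg G (X \<union> {v, w}) v es' w" "wt G es' \<le> wt G es2" "set es' \<subseteq> set es2"
      by blast
    then show ?thesis using *(1) by fastforce
  qed
qed

lemma sg_to_first:
  assumes "joins G e s x" "wk G X x es y"
  shows "wk G (X \<union> T) x es y \<or>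
    (\<exists>es1 es2 z. e # es = es1 @ es2 \<and> z \<in> T \<and> sg G (X \<union> T) s es1 z \<and> hd es1 = e \<and> wk G X z es2 y)"
proof (cases "x \<in> T")
  case True
  then have "e # es = [e] @ es \<and> x \<in> T \<and> sg G (X \<union> T) s [e] x \<and> hd [e] = e \<and> wk G X x es y"
    using assms by (auto intro: sg_singleI)
  then show ?thesis by blast
next
  case False
  from wk_first_hit[OF assms(2) False] show ?thesis
  proof (elim disjE)
    assume "\<exists>es1 f es2 u z. es = es1 @ f # es2 \<and> wk G (X \<union> T) x es1 u \<and> joins G f u z \<and> z \<in> T \<and> wk G X z es2 y"
    then obtain es1 f es2 u z where *: "es = es1 @ f # es2" "wk G (X \<union> T) x es1 u" "joins G f u z"
      "z \<in> T" "wk G X z es2 y"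
      by auto
    then have "e # es = (e # es1 @ [f]) @ es2 \<and> z \<in> T \<and> sg G (X \<union> T) s (e # es1 @ [f]) z \<and>
        hd (e # es1 @ [f]) = e \<and> wk G X z es2 y"
      using assms(1) by (auto intro!: sgI)
    then show ?thesis by blast
  qed auto
qed

lemma sg_from_last:
  assumes "wk G X x es y" "joins G f y t"
  shows "wk G (X \<union> T) x es y \<or>
    (\<exists>es1 es2 z. es @ [f] = es1 @ es2 \<and> z \<in> T \<and> wk G X x es1 z \<and> sg G (X \<union> T) z es2 t \<and> last es2 = f)"
  using sg_to_first[OF joins_symD[OF assms(2)] wk_rev[OF assms(1)], of T]
proof (elim disjE exE conjE)
  assume "wk G (X \<union> T) y (rev es) x"
  from wk_rev[OF this] show ?thesis by simp
next
  fix es1 es2 z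
  assume *: "f # rev es = es1 @ es2" "z \<in> T" "sg G (X \<union> T) t es1 z" "hd es1 = f" "wk G X z es2 x"
  have "es @ [f] = rev es2 @ rev es1" using arg_cong[OF *(1), of rev] by simp
  moreover have "last (rev es1) = f" using *(4) sg_ne[OF *(3)] by (simp add: last_rev)
  ultimately show ?thesis using wk_rev[OF *(5)] sg_rev[OF *(3)] *(2) by blast
qed

lemma sg_split_hd:
  assumes "sg G X s es t" "t \<in> verts G" "t \<notin> Y" "Y \<subseteq> X"
  obtains x ms where "es = hd es # ms" "joins G (hd es) s x" "wk G Y x ms t"
  using assms(1)[unfolded sg_def]
proof (elim disjE exE conjE)
  fix e assume "es = [e]" "joins G e s t"
  then show ?thesis using that[of "[]" t] assms by (auto intro: wk.Nil)
next
  fix e x ms y f assume "es = e # ms @ [f]" "joins G e s x" "wk G X x ms y" "joins G f y t"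
  then show ?thesis using that[of "ms @ [f]" x] assms by (auto intro: wk_snoc wk_mono)
qed

lemma sg_split_last:
  assumes "sg G X s es t" "s \<in> verts G" "s \<notin> Y" "Y \<subseteq> X"
  obtains y ms where "es = ms @ [last es]" "joins G (last es) y t" "wk G Y s ms y"
proof -
  obtain x ms where *: "rev es = hd (rev es) # ms" "joins G (hd (rev es)) t x" "wk G Y x ms s"
    by (rule sg_split_hd[OF sg_rev[OF assms(1)] assms(2-)])
  have "es = rev ms @ [hd (rev es)]" using arg_cong[OF *(1), of rev] by simp
  then show ?thesis using that[of "rev ms" x] wk_rev[OF *(3)] joins_symD[OF *(2)] by (simp add: hd_rev)
qed

text \<open>The joint is not in \<open>X\<close> and so becomes an inner vertex. This allows a
  closed walk at \<open>x\<close> to be read from outside: its end followed by its beginning is a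
  segment between two visits of the separating vertices.\<close>

lemma sg_append:
  assumes "sg G X s es x" "sg G X x fs t" "x \<in> verts G" "x \<notin> X"
  shows "sg G X s (es @ fs) t"
proof -
  obtain y ms where 1: "es = hd es # ms" "joins G (hd es) s y" "wk G X y ms x"
    by (rule sg_split_hd[OF assms(1,3,4)]) auto
  obtain z ns where 2: "fs = ns @ [last fs]" "joins G (last fs) z t" "wk G X x ns z"
    by (rule sg_split_last[OF assms(2,3,4)]) auto
  have "es @ fs = hd es # (ms @ ns) @ [last fs]" by (subst 1(1), subst 2(1)) simp
  then show ?thesis using sgI[OF 1(2) wk_append[OF 1(3) 2(3)] 2(2)] by simp
qed

text \<open>If the closed walk meets \<open>w\<close>, it is cut at the first and at the last visit.
  The part in between is closed at \<open>w\<close>, and dropping it only shortens the walk.\<close>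

lemma short_cases:
  assumes "short r G v e f"
  obtains es where "sg G {v, w} v es v" "hd es = e" "last es = f" "enat (wt G es) \<le> r"
    | es1 es2 where "sg G {v, w} v es1 w" "sg G {v, w} w es2 v" "hd es1 = e" "last es2 = f"
      "enat (wt G es1 + wt G es2) \<le> r"
proof -
  obtain x y es where *: "joins G e v x" "wk G {v} x es y" "joins G f y v"
    "enat (len G e + wt G es + len G f) \<le> r"
    using assms unfolding short_def by blast
  have eq: "{v} \<union> {w} = {v, w}" by auto
  from sg_to_first[OF *(1,2), of "{w}"] show thesis
  proof (elim disjE exE conjE)
    assume "wk G ({v} \<union> {w}) x es y"
    then have "sg G {v, w} v (e # es @ [f]) v" using * sgI[of G e v x "{v, w}" es y f v] unfolding eq by blast
    then show thesis using that(1)[of "e # es @ [f]"] *(4) by (simp add: add.assoc)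
  next
    fix es1 es2 z
    assume z: "z \<in> {w}" and "e # es = es1 @ es2" "sg G ({v} \<union> {w}) v es1 z" "hd es1 = e" "wk G {v} z es2 y"
    then have 1: "e # es = es1 @ es2" "sg G {v, w} v es1 w" "hd es1 = e" "wk G {v} w es2 y"
      unfolding eq by auto
    have "\<not> wk G ({v} \<union> {w}) w es2 y" using wk_ends by fast
    with sg_from_last[OF 1(4) *(3), of "{w}"] obtain p q where
      2: "es2 @ [f] = p @ q" "sg G {v, w} w q v" "last q = f" unfolding eq by auto
    have "wt G es1 + wt G q \<le> wt G (es1 @ es2 @ [f])" using 2(1) by simp
    also have "\<dots> = len G e + wt G es + len G f"
      using arg_cong[OF 1(1), of "wt G"] by simp
    finally have "enat (wt G es1 + wt G q) \<le> r" using *(4) order_trans enat_ord_simps(1) by blast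
    then show thesis using that(2)[of es1 q] 1 2 by auto
  qed
qed

lemma short_of_segs:
  assumes "sg G {v, w} v es1 w" "sg G {v, w} w es2 v" "v \<noteq> w" "w \<in> verts G"
    "enat (wt G es1 + wt G es2) \<le> r"
  shows "short r G v (hd es1) (last es2)"
proof -
  obtain x ms where 1: "es1 = hd es1 # ms" "joins G (hd es1) v x" "wk G {v} x ms w"
    by (rule sg_split_hd[OF assms(1,4), of "{v}"]) (use assms(3) in auto)
  obtain y ns where 2: "es2 = ns @ [last es2]" "joins G (last es2) y v" "wk G {v} w ns y"
    by (rule sg_split_last[OF assms(2,4), of "{v}"]) (use assms(3) in auto)
  have "wt G es1 + wt G es2 = len G (hd es1) + wt G (ms @ ns) + len G (last es2)"
    by (subst 1(1), subst 2(1)) simp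
  then show ?thesis unfolding short_def using 1 2 wk_append[OF 1(3) 2(3)] assms(5)
    by (intro exI[of _ x] exI[of _ y] exI[of _ "ms @ ns"]) simp
qed

lemma short_of_closed_seg:
  assumes "is_lgraph G" "sg G {v} v es v" "enat (wt G es) \<le> r"
  shows "short r G v (hd es) (last es)"
  using assms(2)[unfolded sg_def]
proof (elim disjE exE conjE)
  fix e assume "joins G e v v"
  then show ?thesis using joins_verts[OF assms(1)] by blast
next
  fix e x ms y f
  assume "es = e # ms @ [f]" "joins G e v x" "wk G {v} x ms y" "joins G f y v"
  then show ?thesis unfolding short_def using assms(3)
    by (intro exI[of _ x] exI[of _ y] exI[of _ ms]) (simp add: add.assoc)
qed

text \<open>The length of a shortest path from \<open>v\<close> to \<open>w\<close> through side
  \<open>A\<close>. Both end edges are tested because only edges at \<open>v\<close> and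
  \<open>w\<close> carry information about sides.\<close>

definition gam :: "('a, 'b) lgraph \<Rightarrow> 'a \<Rightarrow> 'a \<Rightarrow> 'b set \<Rightarrow> nat" where
  "gam G v w A = (LEAST n. \<exists>es. sg G {v, w} v es w \<and> hd es \<in> A \<and> last es \<in> A \<and> wt G es = n)"

lemma gam_swap: "gam G w v A = gam G v w A"
proof -
  have "(\<exists>es. sg G {x, y} x es y \<and> hd es \<in> A \<and> last es \<in> A \<and> wt G es = n)"
    if "\<exists>es. sg G {y, x} y es x \<and> hd es \<in> A \<and> last es \<in> A \<and> wt G es = n" for n x y
  proof -
    from that obtain es where *: "sg G {y, x} y es x" "hd es \<in> A" "last es \<in> A" "wt G es = n" by blast
    have "es \<noteq> []" using sg_ne[OF *(1)] .
    then show ?thesis using sg_rev[OF *(1)] *(2-)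
      by (intro exI[of _ "rev es"]) (auto simp: insert_commute hd_rev last_rev rev_map[symmetric])
  qed
  then show ?thesis unfolding gam_def by (intro arg_cong[of _ _ Least] ext) blast
qed

text \<open>
  The sides of the separation are \<open>A\<close> and its complement; only the edges at \<open>v\<close> and \<open>w\<close> matter. The
  length of a walk between \<open>v\<close> and \<open>w\<close> is increased by \<open>k\<close>, their distance, to close it up.
\<close>

locale sep =
  fixes r :: enat and G :: "('a, 'b) lgraph" and v w :: 'a and k :: nat and A :: "'b set"
  assumes loc2: "loc2 r G"
    and v: "v \<in> verts G" and w: "w \<in> verts G" and vw: "v \<noteq> w"
    and geo: "\<exists>R. wk G {} v R w \<and> wt G R = k"
    and kmin: "\<And>es. wk G {} v es w \<Longrightarrow> k \<le> wt G es"
    and k2: "enat (2 * k) \<le> r"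
    and side: "\<And>s t es. s \<in> {v, w} \<Longrightarrow> t \<in> {v, w} \<Longrightarrow> sg G {v, w} s es t \<Longrightarrow>
      enat (wt G es + (if s = t then 0 else k)) \<le> r \<Longrightarrow> hd es \<in> A \<longleftrightarrow> last es \<in> A"
    and A_ex: "\<exists>e \<in> A. inc G e v \<or> inc G e w"
    and B_ex: "\<exists>e \<in> - A. inc G e v \<or> inc G e w"
begin

lemma lg: "is_lgraph G"
  using loc2 by (simp add: loc2_def)

text \<open>The hypotheses are symmetric in the two sides and, by \<open>sep_swap\<close>, in the
  two vertices; a fact proved for \<open>v\<close> and \<open>A\<close> is thereby available in four
  versions.\<close>

lemma sep_compl: "sep r G v w k (- A)"
  by unfold_locales (use loc2 v w vw geo kmin k2 side A_ex B_ex in auto)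

lemma sep_swap: "sep r G w v k A"
proof unfold_locales
  show "\<exists>R. wk G {} w R v \<and> wt G R = k"
    using geo wk_rev[of G "{}" v _ w] by (metis rev_map sum_list_rev)
  show "k \<le> wt G es" if "wk G {} w es v" for es
    using kmin[OF wk_rev[OF that]] by (simp add: rev_map[symmetric])
  show "hd es \<in> A \<longleftrightarrow> last es \<in> A"
    if "s \<in> {w, v}" "t \<in> {w, v}" "sg G {w, v} s es t"
      "enat (wt G es + (if s = t then 0 else k)) \<le> r" for s t es
    using side[of s t es] that by (simp add: insert_commute)
qed (use loc2 v w vw k2 A_ex B_ex in auto)

lemma kmin_sg: "s \<in> {v, w} \<Longrightarrow> t \<in> {v, w} \<Longrightarrow> s \<noteq> t \<Longrightarrow> sg G X s es t \<Longrightarrow> k \<le> wt G es"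
  using sg_wk[of G X s es t "{}"] v w kmin sep.kmin[OF sep_swap] by auto

lemma linked: "x \<in> verts G \<Longrightarrow> linked_at r G x"
  using loc2 by (simp add: loc2_def)

text \<open>Each segment has length at least \<open>k\<close>, which is exactly the slack that
  \<open>side\<close> demands for the other one.\<close>

lemma side_pair:
  assumes "sg G {v, w} v es1 w" "sg G {v, w} w es2 v" "enat (wt G es1 + wt G es2) \<le> r"
  shows "hd es1 \<in> A \<longleftrightarrow> last es1 \<in> A" "hd es2 \<in> A \<longleftrightarrow> last es2 \<in> A"
proof -
  have "k \<le> wt G es1" "k \<le> wt G es2" using assms kmin_sg[of v w] kmin_sg[of w v] vw by auto
  then have "enat (wt G es1 + k) \<le> r" "enat (wt G es2 + k) \<le> r"
    using assms(3) by (auto elim: order_trans[rotated])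
  then show "hd es1 \<in> A \<longleftrightarrow> last es1 \<in> A" "hd es2 \<in> A \<longleftrightarrow> last es2 \<in> A"
    using side[of v w es1] side[of w v es2] assms vw by auto
qed

lemma short_vw_cases:
  assumes "short r G v e f"
  shows "(\<exists>es. sg G {v, w} v es v \<and> hd es = e \<and> last es = f \<and> enat (wt G es) \<le> r \<and> (e \<in> A \<longleftrightarrow> f \<in> A)) \<or>
    (\<exists>es1 es2. sg G {v, w} v es1 w \<and> sg G {v, w} w es2 v \<and> hd es1 = e \<and> last es2 = f \<and>
      enat (wt G es1 + wt G es2) \<le> r \<and> (last es1 \<in> A \<longleftrightarrow> e \<in> A) \<and> (hd es2 \<in> A \<longleftrightarrow> f \<in> A))"
  using assms
proof (cases rule: short_cases[where w = w])
  case (1 es)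
  then show ?thesis using side[of v v es] by auto
next
  case (2 es1 es2)
  then show ?thesis using side_pair[of es1 es2] by metis
qed

text \<open>Otherwise \<open>A\<close> would be invariant under \<open>short\<close> at
  \<open>v\<close>, and linkedness would put all edges at \<open>v\<close> on one side.\<close>

lemma crossing_short:
  assumes "e \<in> A" "inc G e v" "f \<notin> A" "inc G f v"
  shows "\<exists>e f. short r G v e f \<and> e \<in> A \<and> f \<notin> A"
proof (rule ccontr)
  assume "\<not> ?thesis"
  then have "e \<in> A \<longleftrightarrow> f \<in> A"
    using linked_atD[OF linked[OF v], of A e f] assms short_sym by metis
  then show False using assms by blast
qed

text \<open>Suppose \<open>A\<close> has an edge at \<open>v\<close> but none at \<open>w\<close>.
  If both sides meet \<open>v\<close>, a short closed walk at \<open>v\<close> changes sides; it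
  must pass through \<open>w\<close>, and it enters \<open>w\<close> by an edge of \<open>A\<close>.
  If all edges at \<open>v\<close> are in \<open>A\<close>, a shortest path from \<open>v\<close> to
  \<open>w\<close> starts in \<open>A\<close> and, because of \<open>k2\<close>, also ends
  there.\<close>

lemma A_w:
  shows "\<exists>e \<in> A. inc G e w"
proof (rule ccontr)
  assume no: "\<not> ?thesis"
  with A_ex obtain e where e: "e \<in> A" "inc G e v" by blast
  show False
  proof (cases "\<exists>f. f \<notin> A \<and> inc G f v")
    case True
    then obtain e f where "short r G v e f" "e \<in> A" "f \<notin> A" using crossing_short e by blast
    with short_vw_cases[of e f] obtain es1 where "sg G {v, w} v es1 w" "last es1 \<in> A" by blast
    then show False using no inc_joins sg_joins_last joins_symD by metis
  next
    case False
    obtain R where R: "wk G {} v R w" "wt G R = k" using geo by blast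
    from seg_of_walk[OF R(1) vw] obtain es where es: "sg G {v, w} v es w" "wt G es \<le> k"
      using R(2) by auto
    have "enat (wt G es + k) \<le> r" using es(2) k2 by (auto elim: order_trans[rotated])
    then have "hd es \<in> A \<longleftrightarrow> last es \<in> A" using side[of v w es] es vw by auto
    moreover have "hd es \<in> A" using False es(1) sg_joins_hd inc_joins by metis
    moreover have "last es \<notin> A" using no es(1) sg_joins_last inc_joins joins_symD by metis
    ultimately show False by blast
  qed
qed

lemma A_v: "\<exists>e \<in> A. inc G e v"
  by (rule sep.A_w[OF sep_swap])

lemma B_v: "\<exists>e. e \<notin> A \<and> inc G e v" and B_w: "\<exists>e. e \<notin> A \<and> inc G e w"
  using sep.A_w[OF sep_compl] sep.A_v[OF sep_compl] by auto

text \<open>A closed segment at \<open>v\<close> respects the sides, so a short closed walk that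
  changes sides at \<open>v\<close> goes to \<open>w\<close> through one side and comes back through
  the other.\<close>

lemma crossing:
  obtains p q where "sg G {v, w} v p w" "hd p \<in> A" "last p \<in> A" "sg G {v, w} v q w" "hd q \<notin> A" "last q \<notin> A"
    "enat (wt G p + wt G q) \<le> r"
proof -
  obtain e f where *: "short r G v e f" "e \<in> A" "f \<notin> A" using crossing_short A_v B_v by blast
  with short_vw_cases[of e f] obtain es1 es2 where **: "sg G {v, w} v es1 w" "sg G {v, w} w es2 v"
    "hd es1 = e" "last es2 = f" "last es1 \<in> A" "hd es2 \<notin> A" "enat (wt G es1 + wt G es2) \<le> r" by blast
  moreover have "sg G {v, w} v (rev es2) w" using ** sg_rev by fast
  moreover have "es2 \<noteq> []" using ** sg_ne by fast
  ultimately show ?thesis using that[of es1 "rev es2"] *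
    by (auto simp: rev_map[symmetric] hd_rev last_rev)
qed

abbreviation "gA \<equiv> gam G v w A"
abbreviation "gB \<equiv> gam G v w (- A)"

lemma gA_seg: "\<exists>es. sg G {v, w} v es w \<and> hd es \<in> A \<and> last es \<in> A \<and> wt G es = gA"
proof -
  obtain p q where "sg G {v, w} v p w" "hd p \<in> A" "last p \<in> A" "sg G {v, w} v q w" "hd q \<notin> A"
    "last q \<notin> A" "enat (wt G p + wt G q) \<le> r" by (rule crossing)
  then have "\<exists>n. \<exists>es. sg G {v, w} v es w \<and> hd es \<in> A \<and> last es \<in> A \<and> wt G es = n" by blast
  from LeastI_ex[OF this] show ?thesis unfolding gam_def .
qed

lemma gA_le: "sg G {v, w} v es w \<Longrightarrow> hd es \<in> A \<Longrightarrow> last es \<in> A \<Longrightarrow> gA \<le> wt G es"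
  unfolding gam_def by (rule Least_le) blast

lemma gA_le': "sg G {v, w} w es v \<Longrightarrow> hd es \<in> A \<Longrightarrow> last es \<in> A \<Longrightarrow> gA \<le> wt G es"
  using sep.gA_le[OF sep_swap] gam_swap[of G w v A] by (simp add: insert_commute)

lemmas gB_le = sep.gA_le[OF sep_compl]

lemma k_le_gA: "k \<le> gA"
proof -
  obtain es where "sg G {v, w} v es w" "wt G es = gA" using gA_seg by blast
  then show ?thesis using kmin_sg[of v w _ es] vw by auto
qed

lemmas k_le_gB = sep.k_le_gA[OF sep_compl]

text \<open>A virtual edge is as long as a shortest path through the other side, so this bound says
  that it closes up to a short cycle with a shortest path on its own side.\<close>

lemma gA_gB: "enat (gA + gB) \<le> r"
proof -
  obtain p q where "sg G {v, w} v p w" "hd p \<in> A" "last p \<in> A" "sg G {v, w} v q w" "hd q \<notin> A" "last q \<notin> A"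
    "enat (wt G p + wt G q) \<le> r" by (rule crossing)
  moreover from this have "gA + gB \<le> wt G p + wt G q" by (intro add_mono gA_le gB_le) auto
  ultimately show ?thesis by (auto elim: order_trans[rotated])
qed

text \<open>Since \<open>2 * k \<le> r\<close>, a shortest path from \<open>v\<close> to
  \<open>w\<close> is subject to \<open>side\<close> and therefore stays on one side.\<close>

lemma k_cases: "k = gA \<or> k = gB"
proof -
  obtain R where R: "wk G {} v R w" "wt G R = k" using geo by blast
  from seg_of_walk[OF R(1) vw] obtain es where es: "sg G {v, w} v es w" "wt G es \<le> k"
    using R(2) by auto
  have "enat (wt G es + k) \<le> r" using es(2) k2 by (auto elim: order_trans[rotated])
  then have "hd es \<in> A \<longleftrightarrow> last es \<in> A" using side[of v w es] es vw by auto
  then show ?thesis using gA_le[of es] gB_le[of es] es k_le_gA k_le_gB by fastforce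
qed

lemma gA_pos: "0 < gA"
proof -
  obtain es where es: "sg G {v, w} v es w" "wt G es = gA" using gA_seg by blast
  then obtain x where "joins G (hd es) v x" using sg_joins_hd by metis
  then have "0 < len G (hd es)" using is_lgraphD(6)[OF lg] joins_arc by fast
  moreover have "len G (hd es) \<le> wt G es" using sg_ne[OF es(1)] by (cases es) auto
  ultimately show ?thesis using es(2) by simp
qed

lemmas gB_pos = sep.gA_pos[OF sep_compl]

end

section \<open>Cutting at a local 2-separation\<close>

definition em :: "'a \<Rightarrow> 'a \<Rightarrow> 'a \<Rightarrow> 'a \<Rightarrow> 'a \<Rightarrow> 'a" where
  "em v w p q x = (if x = v then p else if x = w then q else x)"

lemma em_swap: "v \<noteq> w \<Longrightarrow> em w v q p = em v w p q"
  by (auto simp: em_def)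

text \<open>The value of the \<int>/2-cochain \<open>S\<close> on a walk.\<close>

definition par :: "'b set \<Rightarrow> 'b list \<Rightarrow> bool" where
  "par S es \<longleftrightarrow> odd (length (filter (\<lambda>e. e \<in> S) es))"

lemma par_simps [simp]:
  "\<not> par S []" "par S (e # es) \<longleftrightarrow> (e \<in> S) \<noteq> par S es" "par S (es @ fs) \<longleftrightarrow> par S es \<noteq> par S fs"
  "par S (rev es) \<longleftrightarrow> par S es"
  by (auto simp: par_def rev_filter[symmetric])

text \<open>
  The cut graph is described by \<^const>\<open>joins\<close>, without reference to orientations, so that the sides,
  and \<open>v\<close> and \<open>w\<close>, can be exchanged: see \<open>cut_compl\<close> and \<open>cut_swap\<close>.
\<close>

locale cut = sep r G v w k A
  for r :: enat and G :: "('a, 'b) lgraph" and v w :: 'a and k :: nat and A :: "'b set" +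
  fixes G' :: "('a, 'b) lgraph" and a b :: 'b and vA wA vB wB :: 'a
  assumes lg': "is_lgraph G'"
    and verts': "verts G' = (verts G - {v, w}) \<union> {vA, wA, vB, wB}"
    and dist4: "distinct [vA, wA, vB, wB]"
    and fresh4: "{vA, wA, vB, wB} \<inter> (verts G - {v, w}) = {}"
    and arcs': "arcs G' = insert a (insert b (arcs G))"
    and ab: "a \<noteq> b" "a \<notin> arcs G" "b \<notin> arcs G"
    and joinsA: "\<And>e x y. e \<in> arcs G \<Longrightarrow> e \<in> A \<Longrightarrow> joins G' e x y \<longleftrightarrow>
      (\<exists>x0 y0. joins G e x0 y0 \<and> x = em v w vA wA x0 \<and> y = em v w vA wA y0)"
    and joinsB: "\<And>e x y. e \<in> arcs G \<Longrightarrow> e \<notin> A \<Longrightarrow> joins G' e x y \<longleftrightarrow>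
      (\<exists>x0 y0. joins G e x0 y0 \<and> x = em v w vB wB x0 \<and> y = em v w vB wB y0)"
    and joinsa: "\<And>x y. joins G' a x y \<longleftrightarrow> x = vA \<and> y = wA \<or> x = wA \<and> y = vA"
    and joinsb: "\<And>x y. joins G' b x y \<longleftrightarrow> x = vB \<and> y = wB \<or> x = wB \<and> y = vB"
    and len': "\<And>e. e \<in> arcs G \<Longrightarrow> len G' e = len G e"
    and lena: "len G' a = gam G v w (- A)"
    and lenb: "len G' b = gam G v w A"
begin

abbreviation "T \<equiv> {vA, wA, vB, wB}"

lemma cut_compl: "cut r G v w k (- A) G' b a vB wB vA wA"
proof -
  interpret c: sep r G v w k "- A" by (rule sep_compl)
  show ?thesis
    by unfold_locales (use lg' verts' dist4 fresh4 arcs' ab joinsA joinsB joinsa joinsb len' lena lenb in auto)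
qed

lemma cut_swap: "cut r G w v k A G' a b wA vA wB vB"
proof -
  interpret c: sep r G w v k A by (rule sep_swap)
  show ?thesis
    by unfold_locales (use lg' verts' dist4 fresh4 arcs' ab joinsA joinsB joinsa joinsb len' lena lenb vw in
        \<open>auto simp: em_swap gam_swap[of G w v]\<close>)
qed

section \<open>Projecting and lifting walks between the graph and the cut graph\<close>

definition pr :: "'a \<Rightarrow> 'a" where
  "pr x = (if x \<in> {vA, vB} then v else if x \<in> {wA, wB} then w else x)"

lemma pr_simps [simp]: "pr vA = v" "pr vB = v" "pr wA = w" "pr wB = w"
  using dist4 by (auto simp: pr_def)

lemma pr_em: "x \<in> verts G \<Longrightarrow> pr (em v w vA wA x) = x" "x \<in> verts G \<Longrightarrow> pr (em v w vB wB x) = x"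
  using dist4 fresh4 by (auto simp: pr_def em_def)

lemma pr_verts: "x \<in> verts G' \<Longrightarrow> pr x \<in> verts G"
  using verts' v w by (auto simp: pr_def)

lemma pr_old: "x \<in> verts G' \<Longrightarrow> x \<notin> T \<Longrightarrow> pr x = x \<and> x \<in> verts G \<and> x \<noteq> v \<and> x \<noteq> w"
  using verts' by (auto simp: pr_def)

lemma joins_pr: "e \<in> arcs G \<Longrightarrow> joins G' e x y \<Longrightarrow> joins G e (pr x) (pr y)"
  using joinsA[of e x y] joinsB[of e x y] pr_em joins_verts[OF lg] by metis

lemma joins_old: "joins G e x y \<Longrightarrow> x \<notin> {v, w} \<Longrightarrow> y \<notin> {v, w} \<Longrightarrow> joins G' e x y"
proof -
  assume *: "joins G e x y" "x \<notin> {v, w}" "y \<notin> {v, w}"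
  then have "em v w p q x = x" "em v w p q y = y" for p q by (auto simp: em_def)
  then have "\<exists>x0 y0. joins G e x0 y0 \<and> x = em v w p q x0 \<and> y = em v w p q y0" for p q
    using *(1) by metis
  then show ?thesis using joinsA joinsB joins_arc[OF *(1)] by blast
qed

lemma em_v [simp]: "em v w p q v = p" and em_w [simp]: "em v w p q w = q"
  using vw by (auto simp: em_def)

lemma joins_em:
  assumes "joins G e x y" "e \<in> A"
  shows "joins G' e (em v w vA wA x) (em v w vA wA y)"
  using joinsA[OF joins_arc[OF assms(1)] assms(2)] assms(1) by blast

text \<open>The edge \<open>b\<close> only joins the copies on the other side, and an edge outside
  \<open>A\<close> has its ends at \<open>v\<close> and \<open>w\<close> moved to those copies,
  while \<open>vA\<close> and \<open>wA\<close> are no old vertices.\<close>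

lemma joins_A_terminal:
  assumes "joins G' e x y" "x \<in> {vA, wA}"
  shows "e = a \<or> e \<in> A \<and> e \<in> arcs G"
proof -
  have "e \<in> arcs G'" using assms joins_arc by fast
  then consider "e = a" | "e = b" | "e \<in> arcs G" using arcs' by auto
  then show ?thesis
  proof cases
    case 2
    then show ?thesis using joinsb assms dist4 by auto
  next
    case 3
    have "e \<in> A"
    proof (rule ccontr)
      assume "e \<notin> A"
      then obtain x0 y0 where x0: "joins G e x0 y0" "x = em v w vB wB x0"
        using joinsB[OF 3] assms(1) by blast
      then have "x0 \<in> verts G" using joins_verts[OF lg] by blast
      then have "em v w vB wB x0 \<notin> {vA, wA}"
        using dist4 fresh4 by (cases "x0 = v"; cases "x0 = w") (auto simp: em_def)
      then show False using x0 assms(2) by simp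
    qed
    then show ?thesis using 3 by simp
  qed auto
qed

lemma joins_B_terminal:
  assumes "joins G' e x y" "x \<in> {vB, wB}"
  shows "e = b \<or> e \<notin> A \<and> e \<in> arcs G"
  using cut.joins_A_terminal[OF cut_compl assms] by auto

lemma wt': "set es \<subseteq> arcs G \<Longrightarrow> wt G' es = wt G es"
  by (induction es) (auto simp: len')

lemma lift_wk:
  assumes "wk G X x es y" "{v, w} \<subseteq> X" "X' \<inter> (verts G - {v, w}) \<subseteq> X"
  shows "wk G' X' x es y"
  by (rule wk_cong_mono[OF assms(1)]) (use assms verts' in \<open>auto intro!: joins_old\<close>)

text \<open>Inner vertices differ from \<open>v\<close> and \<open>w\<close>, so only the ends are
  renamed, and the end edges say in which way. Of the set \<open>X'\<close> that is to be avoided,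
  only the old vertices matter for the interior.\<close>

lemma lift_sg:
  assumes "sg G X s es t" "{v, w} \<subseteq> X" "X' \<inter> (verts G - {v, w}) \<subseteq> X"
    "s \<in> {v, w} \<Longrightarrow> hd es \<in> A" "t \<in> {v, w} \<Longrightarrow> last es \<in> A"
  shows "sg G' X' (em v w vA wA s) es (em v w vA wA t)"
  using assms(1)[unfolded sg_def]
proof (elim disjE exE conjE)
  have em_id: "em v w vA wA x = x" if "x \<notin> {v, w}" for x using that by (auto simp: em_def)
  {
    fix e
    assume *: "es = [e]" "joins G e s t"
    have "joins G' e (em v w vA wA s) (em v w vA wA t)"
    proof (cases "s \<in> {v, w} \<or> t \<in> {v, w}")
      case True
      then show ?thesis using joins_em[OF *(2)] assms(4,5) * by auto
    next
      case False
      then show ?thesis using joins_old[OF *(2)] em_id by simp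
    qed
    then show ?thesis using * sg_singleI by metis
  next
    fix e x ms y f
    assume *: "es = e # ms @ [f]" "joins G e s x" "wk G X x ms y" "joins G f y t"
    have xy: "x \<notin> {v, w}" "y \<notin> {v, w}" using wk_ends[OF *(3)] assms by auto
    have "joins G' e (em v w vA wA s) x"
      using joins_em[OF *(2)] joins_old[OF *(2)] assms(4) * em_id[OF xy(1)] em_id[of s] xy(1)
      by (cases "s \<in> {v, w}") auto
    moreover have "joins G' f y (em v w vA wA t)"
      using joins_em[OF *(4)] joins_old[OF *(4)] assms(5) * em_id[OF xy(2)] em_id[of t] xy(2)
      by (cases "t \<in> {v, w}") auto
    ultimately show ?thesis
      using sgI lift_wk[OF *(3) assms(2,3)] *(1) by metis
  }
qed

lemma wkT_arcs: "wk G' T x ms y \<Longrightarrow> set ms \<subseteq> arcs G"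
proof (induction rule: wk.induct)
  case (Cons e x z es y)
  have "e \<in> arcs G'" using Cons(1) joins_arc by fast
  moreover have "e \<noteq> a" "e \<noteq> b" using Cons(1,3) joinsa joinsb by auto
  ultimately show ?case using Cons.IH arcs' by auto
qed simp

text \<open>A segment other than a virtual edge meets no copy in its interior, so it consists of old
  edges; its last edge tells on which side it ends. The case of an end on the other side is the one
  that \<open>side\<close> rules out for short segments.\<close>

lemma proj_sg:
  assumes "sg G' T s es t" "s \<in> {vA, wA}" "t \<in> T"
  shows "es = [a] \<and> (s = vA \<and> t = wA \<or> s = wA \<and> t = vA) \<or>
    sg G {v, w} (pr s) es (pr t) \<and> hd es \<in> A \<and> (last es \<in> A \<longleftrightarrow> t \<in> {vA, wA}) \<and> set es \<subseteq> arcs G"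
  using assms(1)[unfolded sg_def]
proof (elim disjE exE conjE)
  fix e
  assume *: "es = [e]" "joins G' e s t"
  show ?thesis
  proof (cases "e = a")
    case True
    then show ?thesis using * joinsa by auto
  next
    case False
    then have eA: "e \<in> A" "e \<in> arcs G" using joins_A_terminal[OF *(2) assms(2)] by auto
    moreover have "t \<in> {vA, wA}"
      using assms(3) joins_B_terminal[OF joins_symD[OF *(2)]] eA ab by auto
    ultimately show ?thesis using * joins_pr[of e s t] by (auto intro: sg_singleI)
  qed
next
  fix e x ms y f
  assume *: "es = e # ms @ [f]" "joins G' e s x" "wk G' T x ms y" "joins G' f y t"
  have xy: "x \<in> verts G'" "y \<in> verts G'" "x \<notin> T" "y \<notin> T" using wk_ends[OF *(3)] by auto
  have e: "e \<in> A" "e \<in> arcs G"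
    using joins_A_terminal[OF *(2) assms(2)] *(2) xy joinsa by auto
  have f: "f \<in> arcs G" using joins_arc[OF *(4)] *(4) arcs' joinsa joinsb xy by auto
  have fA: "f \<in> A \<longleftrightarrow> t \<in> {vA, wA}"
    using joins_A_terminal[OF joins_symD[OF *(4)]] joins_B_terminal[OF joins_symD[OF *(4)]] assms(3) f ab by auto
  have ms: "set ms \<subseteq> arcs G" using wkT_arcs[OF *(3)] .
  have "wk G {v, w} (pr x) (map (\<lambda>e. e) ms) (pr y)"
  proof (rule wk_map[OF *(3)])
    show "joins G g (pr p) (pr q)" if "g \<in> set ms" "joins G' g p q" "p \<notin> T" "q \<notin> T" for g p q
      using joins_pr that ms by blast
    show "pr p \<in> verts G \<and> pr p \<notin> {v, w}" if "p \<in> verts G'" "p \<notin> T" for p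
      using pr_old[OF that] by auto
  qed
  then have "sg G {v, w} (pr s) es (pr t)" "set es \<subseteq> arcs G"
    using ms * e f joins_pr[OF e(2) *(2)] joins_pr[OF f *(4)] by (auto intro: sgI)
  then show ?thesis using * e fA by auto
qed

text \<open>A segment is either a virtual edge, of length \<open>gA\<close> or \<open>gB\<close>, or
  it projects to a segment between \<open>v\<close> and \<open>w\<close>. All of these have length
  at least \<open>k\<close>.\<close>

lemma seg_lower:
  assumes "sg G' T s es t" "s \<in> T" "t \<in> T" "pr s \<noteq> pr t"
  shows "k \<le> wt G' es"
proof -
  have st: "pr s \<in> {v, w}" "pr t \<in> {v, w}" using assms by auto
  have low: "k \<le> wt G' es" if "sg G {v, w} (pr s) es (pr t)" "set es \<subseteq> arcs G"
    using kmin_sg[OF st assms(4) that(1)] wt'[OF that(2)] by simp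
  show ?thesis
  proof (cases "s \<in> {vA, wA}")
    case True
    have "k \<le> wt G' [a]" using lena k_le_gB by simp
    then show ?thesis using proj_sg[OF assms(1) True assms(3)] low by metis
  next
    case False
    interpret d: cut r G v w k "- A" G' b a vB wB vA wA by (rule cut_compl)
    have T: "d.T = T" by auto
    have prd: "d.pr = pr" by (auto simp: d.pr_def pr_def)
    have "k \<le> wt G' [b]" using lenb k_le_gA by simp
    moreover have sB: "s \<in> {vB, wB}" using False assms by auto
    have tT: "t \<in> d.T" using assms(3) unfolding T .
    ultimately show ?thesis
      using d.proj_sg[OF assms(1)[folded T] sB tT] low unfolding prd by metis
  qed
qed

lemma walk_lower:
  assumes "wk G' {} s es t" "s \<in> T" "t \<in> T" "pr s \<noteq> pr t"
  shows "k \<le> wt G' es"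
  using assms
proof (induction "length es" arbitrary: es s rule: less_induct)
  case less
  have ne: "es \<noteq> []" using less by (auto simp: wk_Nil_iff)
  obtain es1 z es2 where *: "es = es1 @ es2" "sg G' ({} \<union> T) s es1 z" "z \<in> T" "wk G' {} z es2 t"
    by (rule wk_first_seg[OF less(2) less(3,4) ne])
  then have sg: "sg G' T s es1 z" by simp
  have l: "length es2 < length es" using * sg_ne[OF *(2)] by auto
  show ?case
  proof (cases "pr z = pr t")
    case False
    then show ?thesis using less(1)[OF l *(4,3) less(4)] *(1) by auto
  next
    case True
    then have "k \<le> wt G' es1" using seg_lower[OF sg less(3) *(3)] less by auto
    then show ?thesis using *(1) by auto
  qed
qed

text \<open>Short closed walks respect the separation, so the two copies of a separating vertex are far
  apart in the cut graph.\<close>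

lemma copies_far:
  assumes "wk G' {} s es t" "s \<in> {vA, wA}" "t \<in> {vB, wB}"
  shows "\<not> enat (wt G' es + (if pr s = pr t then 0 else k)) \<le> r"
  using assms
proof (induction "length es" arbitrary: es s rule: less_induct)
  case less
  have ne: "es \<noteq> []" using less dist4 by (auto simp: wk_Nil_iff)
  have sT: "s \<in> T" "t \<in> T" using less by auto
  obtain es1 z es2 where *: "es = es1 @ es2" "sg G' ({} \<union> T) s es1 z" "z \<in> T" "wk G' {} z es2 t"
    by (rule wk_first_seg[OF less(2) sT ne])
  then have sg: "sg G' T s es1 z" by simp
  have prT: "pr s \<in> {v, w}" "pr z \<in> {v, w}" "pr t \<in> {v, w}" using less *(3) by auto
  have leI: "\<not> enat n \<le> r" if "\<not> enat m \<le> r" "m \<le> n" for m n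
    using that by (meson enat_ord_simps(1) order_trans)
  show ?case
  proof (cases "z \<in> {vA, wA}")
    case True
    have "length es2 < length es" using * sg_ne[OF *(2)] by auto
    from less(1)[OF this *(4) True less(4)]
    have far: "\<not> enat (wt G' es2 + (if pr z = pr t then 0 else k)) \<le> r" .
    have "(if pr s = pr z then 0 else k) \<le> wt G' es1"
      using seg_lower[OF sg sT(1) *(3)] by auto
    then have "wt G' es2 + (if pr z = pr t then 0 else k) \<le> wt G' es + (if pr s = pr t then 0 else k)"
      using *(1) prT by (auto split: if_splits)
    then show ?thesis using leI[OF far] by blast
  next
    case False
    then have z: "z \<in> {vB, wB}" using * by auto
    \<comment> \<open>Here the segment itself leads from \<open>A\<close> to the other side, which
      \<open>side\<close> forbids below the bound. If \<open>z\<close> and \<open>t\<close> lie over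
      different vertices, the rest of the walk pays for the missing \<open>k\<close>; in the first
      case the segment paid for it.\<close>
    have p: "sg G {v, w} (pr s) es1 (pr z)" "hd es1 \<in> A" "last es1 \<notin> A" "set es1 \<subseteq> arcs G"
      using proj_sg[OF sg less(3) *(3)] z False by auto
    then have far: "\<not> enat (wt G' es1 + (if pr s = pr z then 0 else k)) \<le> r"
      using side[OF prT(1,2) p(1)] wt'[OF p(4)] by auto
    have "(if pr z = pr t then 0 else k) \<le> wt G' es2"
      using walk_lower[OF *(4,3) sT(2)] by auto
    then have "wt G' es1 + (if pr s = pr z then 0 else k) \<le> wt G' es + (if pr s = pr t then 0 else k)"
      using *(1) prT by (auto split: if_splits)
    then show ?thesis using leI[OF far] by blast
  qed
qed

end

lemma sg_arcs:
  assumes "sg G X s es t"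
  shows "set es \<subseteq> arcs G"
  using assms[unfolded sg_def]
proof (elim disjE exE conjE)
  fix e x ms y f
  assume "es = e # ms @ [f]" "joins G e s x" "wk G X x ms y" "joins G f y t"
  then show ?thesis using wk_arcs[of G X x ms y] joins_arc[of G e s x] joins_arc[of G f y t] by simp
qed (simp add: joins_def)

section \<open>The cut graph is again locally 2-connected\<close>

context cut
begin

text \<open>A short closed walk at \<open>x\<close> that meets both separating vertices is cut along them, and the part
  on the other side is replaced by the virtual edge.\<close>

lemma short_lift_A:
  assumes x: "x \<in> verts G - {v, w}"
    and es1: "sg G ({x} \<union> {v, w}) x es1 z1" "z1 \<in> {v, w}" "last es1 \<in> A"
    and m: "wk G {x} z1 m z2"
    and es3: "sg G ({x} \<union> {v, w}) z2 es3 x" "z2 \<in> {v, w}" "hd es3 \<in> A"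
    and wt: "enat (wt G es1 + wt G m + wt G es3) \<le> r"
  shows "short r G' x (hd es1) (last es3)"
proof -
  let ?em = "em v w vA wA"
  have xG': "x \<in> verts G'" "x \<notin> T" "?em x = x" using x verts' fresh4 by (auto simp: em_def)
  have z: "?em z1 \<in> {vA, wA}" "?em z2 \<in> {vA, wA}" using es1(2) es3(2) by auto
  have zx: "?em z1 \<in> verts G'" "?em z1 \<noteq> x" "?em z2 \<in> verts G'" "?em z2 \<noteq> x"
    using z verts' xG' by auto
  have arcs1: "set es1 \<subseteq> arcs G" and arcs3: "set es3 \<subseteq> arcs G"
    using sg_arcs[OF es1(1)] sg_arcs[OF es3(1)] by auto
  have s1: "sg G' {x} x es1 (?em z1)"
    using lift_sg[OF es1(1), of "{x}"] es1 x xG' by auto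
  have s3: "sg G' {x} (?em z2) es3 x"
    using lift_sg[OF es3(1), of "{x}"] es3 x xG' by auto
  have "\<exists>m'. wk G' {x} (?em z1) m' (?em z2) \<and> wt G' m' \<le> wt G m"
  proof (cases "z1 = z2")
    case True
    then show ?thesis using zx by (intro exI[of _ "[]"]) (auto intro: wk.Nil)
  next
    case False
    obtain m' where m': "sg G ({x} \<union> {z1, z2}) z1 m' z2" "wt G m' \<le> wt G m" "set m' \<subseteq> set m"
      using seg_of_walk[OF m False] by blast
    have zz: "{z1, z2} = {v, w}" using False es1(2) es3(2) by auto
    \<comment> \<open>Read from outside, the closed walk is a segment from \<open>z2\<close> to
      \<open>z1\<close>, hence of length at least \<open>k\<close>. This leaves the inner part
      enough slack for \<open>side\<close>.\<close>
    have out: "sg G {v, w} z2 (es3 @ es1) z1"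
      by (rule sg_append[OF sg_mono[OF es3(1)] sg_mono[OF es1(1)]]) (use x in auto)
    have "k \<le> wt G (es3 @ es1)" using kmin_sg[OF es3(2) es1(2) _ out] False by auto
    then have "wt G m' + k \<le> wt G es1 + wt G m + wt G es3" using m'(2) by simp
    then have "enat (wt G m' + k) \<le> r" using wt by (meson enat_ord_simps(1) order_trans)
    moreover have sgm: "sg G {v, w} z1 m' z2" using sg_mono[OF m'(1)] zz by auto
    ultimately have side: "hd m' \<in> A \<longleftrightarrow> last m' \<in> A"
      using side[OF es1(2) es3(2)] False by auto
    show ?thesis
    proof (cases "hd m' \<in> A")
      case True
      have "sg G' {x} (?em z1) m' (?em z2)"
        using lift_sg[OF m'(1), of "{x}"] zz True side by auto
      then have "wk G' {x} (?em z1) m' (?em z2)"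
        using sg_wk[of G' "{x}" "?em z1" m' "?em z2" "{x}"] zx by auto
      moreover have "set m' \<subseteq> arcs G" using m'(3) wk_arcs[OF m] by auto
      ultimately show ?thesis using m'(2) wt' by auto
    next
      case F: False
      have "hd m' \<in> - A" "last m' \<in> - A" using side F by auto
      then have "gB \<le> wt G m'"
        using gB_le[of m'] sep.gA_le'[OF sep_compl, of m'] sgm es1(2) es3(2) False by auto
      then have "wt G' [a] \<le> wt G m" using lena m'(2) by simp
      moreover have "joins G' a (?em z1) (?em z2)" using joinsa es1(2) es3(2) False by auto
      then have "wk G' {x} (?em z1) [a] (?em z2)" using zx by (auto intro: wk_single)
      ultimately show ?thesis by blast
    qed
  qed
  then obtain m' where m': "wk G' {x} (?em z1) m' (?em z2)" "wt G' m' \<le> wt G m" by blast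
  obtain p ps where p: "es1 = hd es1 # ps" "joins G' (hd es1) x p" "wk G' {x} p ps (?em z1)"
    by (rule sg_split_hd[OF s1, of "{x}"]) (use zx in auto)
  obtain q qs where q: "es3 = qs @ [last es3]" "joins G' (last es3) q x" "wk G' {x} (?em z2) qs q"
    by (rule sg_split_last[OF s3, of "{x}"]) (use zx in auto)
  have "wk G' {x} p (ps @ m' @ qs) q" using p q m' by (auto intro: wk_append)
  moreover have "len G' (hd es1) + wt G' (ps @ m' @ qs) + len G' (last es3) \<le> wt G es1 + wt G m + wt G es3"
  proof -
    have "wt G' es1 = len G' (hd es1) + wt G' ps" by (subst p(1)) simp
    moreover have "wt G' es3 = wt G' qs + len G' (last es3)" by (subst q(1)) simp
    ultimately show ?thesis using wt'[OF arcs1] wt'[OF arcs3] m'(2) by simp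
  qed
  then have "enat (len G' (hd es1) + wt G' (ps @ m' @ qs) + len G' (last es3)) \<le> r"
    using wt by (meson enat_ord_simps(1) order_trans)
  ultimately show ?thesis unfolding short_def using p(2) q(2) by blast
qed

text \<open>A closed walk that avoids \<open>v\<close> and \<open>w\<close> is unchanged by the cut.
  Otherwise its part before the first and after the last visit forms one segment between visits, and
  \<open>side\<close> puts both of its end edges on the same side; that side decides into which
  copies the walk is lifted.\<close>

lemma short_lift:
  assumes "short r G x e f" "x \<in> verts G - {v, w}"
  shows "short r G' x e f"
proof -
  obtain p q es where *: "joins G e x p" "wk G {x} p es q" "joins G f q x"
    "enat (len G e + wt G es + len G f) \<le> r" using assms(1) unfolding short_def by blast
  show ?thesis
  proof (cases "wk G ({x} \<union> {v, w}) p es q")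
    case True
    have pq: "p \<notin> {v, w}" "q \<notin> {v, w}" using wk_ends[OF True] by auto
    have "joins G' e x p" "joins G' f q x" "e \<in> arcs G" "f \<in> arcs G"
      using * pq assms(2) joins_old joins_arc by auto
    moreover have "wk G' {x} p es q" by (rule lift_wk[OF True]) auto
    moreover have "set es \<subseteq> arcs G" using wk_arcs[OF True] .
    ultimately show ?thesis unfolding short_def using *(4) wt'[of es] len' by (metis (no_types))
  next
    case False
    with sg_to_first[OF *(1,2), of "{v, w}"] obtain es1 es2 z1 where
      1: "e # es = es1 @ es2" "z1 \<in> {v, w}" "sg G ({x} \<union> {v, w}) x es1 z1" "hd es1 = e" "wk G {x} z1 es2 q"
      by blast
    have "\<not> wk G ({x} \<union> {v, w}) z1 es2 q" using wk_ends[of G "{x} \<union> {v, w}" z1 es2 q] 1(2) by blast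
    with sg_from_last[OF 1(5) *(3), of "{v, w}"] obtain m es3 z2 where
      2: "es2 @ [f] = m @ es3" "z2 \<in> {v, w}" "wk G {x} z1 m z2" "sg G ({x} \<union> {v, w}) z2 es3 x" "last es3 = f"
      by blast
    have "wt G es1 + wt G m + wt G es3 = len G e + wt G es + len G f"
      using arg_cong[OF 1(1), of "wt G"] arg_cong[OF 2(1), of "wt G"] by simp
    then have wt: "enat (wt G es1 + wt G m + wt G es3) \<le> r" using *(4) by simp
    have x: "x \<in> verts G" "x \<notin> {v, w}" using assms(2) by auto
    have out: "sg G {v, w} z2 (es3 @ es1) z1"
      by (rule sg_append[OF sg_mono[OF 2(4)] sg_mono[OF 1(3)]]) (use x in auto)
    have "(if z2 = z1 then 0 else k) \<le> wt G m"
      using kmin[of m] sep.kmin[OF sep_swap, of m] wk_mono[OF 2(3), of "{}"] 1(2) 2(2) by auto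
    then have "wt G (es3 @ es1) + (if z2 = z1 then 0 else k) \<le> wt G es1 + wt G m + wt G es3" by simp
    then have "enat (wt G (es3 @ es1) + (if z2 = z1 then 0 else k)) \<le> r"
      using wt by (meson enat_ord_simps(1) order_trans)
    from side[OF 2(2) 1(2) out this] have side: "hd es3 \<in> A \<longleftrightarrow> last es1 \<in> A"
      using sg_ne[OF 1(3)] sg_ne[OF 2(4)] by simp
    show ?thesis
    proof (cases "hd es3 \<in> A")
      case True
      then show ?thesis
        using short_lift_A[OF assms(2) 1(3,2) _ 2(3,4,2) _ wt] side 1(4) 2(5) by simp
    next
      case False
      then show ?thesis
        using cut.short_lift_A[OF cut_compl assms(2) 1(3,2) _ 2(3,4,2) _ wt] side 1(4) 2(5) by simp
    qed
  qed
qed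

lemma inc_old: "x \<in> verts G - {v, w} \<Longrightarrow> inc G' e x \<longleftrightarrow> inc G e x"
proof
  assume x: "x \<in> verts G - {v, w}" and "inc G' e x"
  then obtain y where e: "joins G' e x y" by (auto simp: inc_joins)
  have "x \<notin> T" "x \<in> verts G'" using x fresh4 verts' by auto
  then have "e \<noteq> a" "e \<noteq> b" "pr x = x" using e joinsa joinsb pr_old by auto
  then show "inc G e x" using joins_pr[of e x y] e joins_arc[OF e] arcs' by (auto simp: inc_joins)
next
  assume x: "x \<in> verts G - {v, w}" and "inc G e x"
  then obtain y where e: "joins G e x y" by (auto simp: inc_joins)
  have "em v w p q x = x" for p q using x by (auto simp: em_def)
  then show "inc G' e x"
    using joinsA[OF joins_arc[OF e]] joinsB[OF joins_arc[OF e]] e unfolding inc_joins by metis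
qed

lemma linked_old:
  assumes "x \<in> verts G - {v, w}"
  shows "linked_at r G' x"
  unfolding linked_at_def
proof (intro allI impI)
  fix Z e f
  assume Z: "\<forall>e f. short r G' x e f \<longrightarrow> (e \<in> Z) = (f \<in> Z)" and "inc G' e x" "inc G' f x"
  then have ef: "inc G e x" "inc G f x" using inc_old assms by auto
  have "x \<in> verts G" using assms by simp
  from linked_atD[OF linked[OF this] _ ef, of Z] show "(e \<in> Z) = (f \<in> Z)"
    using Z short_lift[OF _ assms] by blast
qed

lemma inc_vA: "inc G' e vA \<Longrightarrow> e = a \<or> e \<in> A \<and> inc G e v"
  using joins_A_terminal joins_pr unfolding inc_joins by (metis insertI1 pr_simps(1))

text \<open>An invariant set at \<open>vA\<close> is carried back to an invariant set at
  \<open>v\<close>, where linkedness is known. Short closed walks at \<open>v\<close> that use the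
  other side correspond to closed walks at \<open>vA\<close> through the virtual edge.\<close>

lemma linked_vA: "linked_at r G' vA"
  unfolding linked_at_def
proof (intro allI impI)
  fix Z e f
  assume Z: "\<forall>e f. short r G' vA e f \<longrightarrow> (e \<in> Z) = (f \<in> Z)" and ef: "inc G' e vA" "inc G' f vA"
  \<comment> \<open>All edges on the other side get the colour of the virtual edge \<open>a\<close>
    that stands for them. An edge \<open>b0\<close> at \<open>v\<close> on that side then compares
    every edge of \<open>A\<close> at \<open>v\<close> with \<open>a\<close>.\<close>
  define Z' where "Z' = {e. if e \<in> A then e \<in> Z else a \<in> Z}"
  have vAwA: "vA \<noteq> wA" "wA \<in> verts G'" using dist4 verts' by auto
  have fresh: "{vA, wA} \<inter> (verts G - {v, w}) \<subseteq> {v, w}" "{vA} \<inter> (verts G - {v, w}) \<subseteq> {v, w}"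
    using fresh4 by auto
  have lift1: "sg G' {vA, wA} vA es wA" if "sg G {v, w} v es w" "hd es \<in> A" "last es \<in> A" for es
    using lift_sg[OF that(1) order_refl fresh(1)] that by simp
  have lift2: "sg G' {vA, wA} wA es vA" if "sg G {v, w} w es v" "hd es \<in> A" "last es \<in> A" for es
    using lift_sg[OF that(1) order_refl fresh(1)] that by simp
  note arcs = sg_arcs
  have a1: "sg G' {vA, wA} vA [a] wA" "sg G' {vA, wA} wA [a] vA"
    using joinsa by (auto intro: sg_singleI)
  have inv: "e \<in> Z' \<longleftrightarrow> f \<in> Z'" if "short r G v e f" for e f
    using short_vw_cases[OF that]
  proof (elim disjE exE conjE)
    fix es assume *: "sg G {v, w} v es v" "hd es = e" "last es = f" "enat (wt G es) \<le> r" "(e \<in> A) = (f \<in> A)"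
    show ?thesis
    proof (cases "e \<in> A")
      case True
      have "sg G' {vA} vA es vA" using lift_sg[OF *(1) order_refl fresh(2)] * True by simp
      then have "short r G' vA e f"
        using short_of_closed_seg[OF lg', of vA es r] wt'[OF arcs[OF *(1)]] * by simp
      then show ?thesis using Z True *(5) by (auto simp: Z'_def)
    next
      case False
      then show ?thesis using *(5) by (simp add: Z'_def)
    qed
  next
    fix es1 es2
    assume *: "sg G {v, w} v es1 w" "sg G {v, w} w es2 v" "hd es1 = e" "last es2 = f"
      "enat (wt G es1 + wt G es2) \<le> r" "(last es1 \<in> A) = (e \<in> A)" "(hd es2 \<in> A) = (f \<in> A)"
    have ar: "set es1 \<subseteq> arcs G" "set es2 \<subseteq> arcs G" using arcs[OF *(1)] arcs[OF *(2)] by auto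
    have leI: "enat n \<le> r" if "n \<le> wt G es1 + wt G es2" for n
      using *(5) that by (meson enat_ord_simps(1) order_trans)
    show ?thesis
    proof (cases "e \<in> A"; cases "f \<in> A")
      assume A: "e \<in> A" "f \<in> A"
      have "short r G' vA (hd es1) (last es2)"
        by (rule short_of_segs[OF lift1 lift2 vAwA leI]) (use * A ar wt' in auto)
      then show ?thesis using Z A * by (auto simp: Z'_def)
    next
      assume A: "e \<in> A" "f \<notin> A"
      have "gB \<le> wt G es2" using sep.gA_le'[OF sep_compl *(2)] * A by simp
      then have "short r G' vA (hd es1) (last [a])"
        by (intro short_of_segs[OF lift1 a1(2) vAwA leI]) (use * A ar wt' lena in auto)
      then show ?thesis using Z A * by (auto simp: Z'_def)
    next
      assume A: "e \<notin> A" "f \<in> A"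
      have "gB \<le> wt G es1" using gB_le[OF *(1)] * A by simp
      then have "short r G' vA (hd [a]) (last es2)"
        by (intro short_of_segs[OF a1(1) lift2 vAwA leI]) (use * A ar wt' lena in auto)
      then show ?thesis using Z A * by (auto simp: Z'_def)
    next
      assume "e \<notin> A" "f \<notin> A"
      then show ?thesis by (simp add: Z'_def)
    qed
  qed
  obtain b0 where b0: "b0 \<notin> A" "inc G b0 v" using B_v by blast
  have "e \<in> Z \<longleftrightarrow> a \<in> Z" if "inc G' e vA" for e
  proof (cases "e = a")
    case False
    then have "e \<in> A" "inc G e v" using inc_vA[OF that] by auto
    then show ?thesis using linked_atD[OF linked[OF v] inv \<open>inc G e v\<close> b0(2)] b0(1) by (simp add: Z'_def)
  qed simp
  then show "(e \<in> Z) = (f \<in> Z)" using ef by blast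
qed

lemma two_edges_vA: "\<exists>e f. e \<noteq> f \<and> inc G' e vA \<and> inc G' f vA"
proof -
  obtain e where e: "e \<in> A" "inc G e v" using A_v by blast
  then obtain y where y: "joins G e v y" by (auto simp: inc_joins)
  have "inc G' e vA" using joins_em[OF y e(1)] by (auto simp: inc_joins)
  moreover have "inc G' a vA" using joinsa by (auto simp: inc_joins)
  moreover have "e \<noteq> a" using joins_arc[OF y] ab by auto
  ultimately show ?thesis by blast
qed

lemma loc2': "loc2 r G'"
  unfolding loc2_def
proof (intro conjI ballI lg')
  fix x assume "x \<in> verts G'"
  then consider "x \<in> verts G - {v, w}" | "x = vA" | "x = wA" | "x = vB" | "x = wB"
    using verts' by auto
  note cases = this
  show "\<exists>e f. e \<noteq> f \<and> inc G' e x \<and> inc G' f x"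
    using cases
  proof cases
    case 1
    then show ?thesis using loc2 inc_old[OF 1] by (auto simp: loc2_def)
  qed (use two_edges_vA cut.two_edges_vA[OF cut_swap] cut.two_edges_vA[OF cut_compl]
      cut.two_edges_vA[OF cut.cut_swap[OF cut_compl]] in simp_all)
  show "linked_at r G' x"
    using cases
  proof cases
    case 1
    then show ?thesis by (rule linked_old)
  qed (use linked_vA cut.linked_vA[OF cut_swap] cut.linked_vA[OF cut_compl]
      cut.linked_vA[OF cut.cut_swap[OF cut_compl]] in simp_all)
qed

section \<open>The gap of a virtual edge and the distance between copies\<close>

lemma Tverts: "T \<subseteq> verts G'"
  using verts' by auto

lemma gap_walk: "\<exists>es. wk G' {} vA es wA \<and> set es \<subseteq> arcs G \<and> wt G' es = gA"
proof -
  obtain es where es: "sg G {v, w} v es w" "hd es \<in> A" "last es \<in> A" "wt G es = gA" using gA_seg by blast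
  have "sg G' {} vA es wA" using lift_sg[OF es(1) order_refl, of "{}"] es by simp
  then have "wk G' {} vA es wA" using sg_wk[of G' "{}" vA es wA "{}"] Tverts by auto
  moreover have "set es \<subseteq> arcs G" using wk_arcs[OF sg_wk[OF es(1) v w, of "{}"]] by simp
  ultimately show ?thesis using wt' es(4) by metis
qed

lemma gap_le:
  assumes "wk G' {} vA es wA" "a \<notin> set es"
  shows "gA \<le> wt G' es"
  using assms
proof (induction "length es" arbitrary: es rule: less_induct)
  case less
  have sT: "vA \<in> T" "wA \<in> T" by auto
  have ne: "es \<noteq> []" using less dist4 by (auto simp: wk_Nil_iff)
  obtain es1 z es2 where *: "es = es1 @ es2" "sg G' ({} \<union> T) vA es1 z" "z \<in> T" "wk G' {} z es2 wA"
    by (rule wk_first_seg[OF less(2) sT ne])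
  then have sg: "sg G' T vA es1 z" by simp
  have w1: "wk G' {} vA es1 z" by (rule sg_wk[OF sg]) (use *(3) Tverts in auto)
  have big: "gA \<le> n" if "\<not> enat n \<le> r" for n
    using that gA_gB by (cases r) auto
  show ?case
  proof (cases "z = vA")
    case True
    then show ?thesis using less(1)[of es2] *(1,4) sg_ne[OF sg] less(3) by auto
  next
    case F: False
    show ?thesis
    proof (cases "z = wA")
      case True
      have "es1 \<noteq> [a]" using less(3) *(1) by auto
      then have "sg G {v, w} v es1 w" "hd es1 \<in> A" "last es1 \<in> A" "set es1 \<subseteq> arcs G"
        using proj_sg[OF sg _ *(3)] True by auto
      then show ?thesis using gA_le[of es1] wt'[of es1] *(1) by simp
    next
      case False
      then have z: "z = vB \<or> z = wB" using F *(3) by auto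
      show ?thesis
      proof (cases "z = vB")
        case True
        then have "\<not> enat (wt G' es1) \<le> r" using copies_far[OF w1] by simp
        then show ?thesis using big *(1) by fastforce
      next
        case False
        then have "z = wB" using z by simp
        then have "\<not> enat (wt G' (rev es2)) \<le> r" using copies_far[OF wk_rev[OF *(4)]] by simp
        then show ?thesis using big *(1) by (fastforce simp: rev_map[symmetric])
      qed
    qed
  qed
qed

lemma far_v: "wk G' {} vA es vB \<Longrightarrow> \<not> enat (wt G' es) \<le> r"
  and far_w: "wk G' {} wA es wB \<Longrightarrow> \<not> enat (wt G' es) \<le> r"
  using copies_far[of vA es vB] copies_far[of wA es wB] by auto

end

section \<open>Components\<close>

text \<open>The incidence and length functions are taken over unchanged, so that vertices of the
  same component yield equal records. A 2-sum takes equal members of its family to be one graph, and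
  this is how a cut graph that stays connected is used twice.\<close>

definition comp_of :: "('a, 'b) lgraph \<Rightarrow> 'a \<Rightarrow> ('a, 'b) lgraph" where
  "comp_of G x = G \<lparr> verts := {y. \<exists>es. wk G {} x es y}, arcs := {e \<in> arcs G. \<exists>es. wk G {} x es (tail G e)} \<rparr>"

lemma comp_simps [simp]:
  "verts (comp_of G x) = {y. \<exists>es. wk G {} x es y}" "tail (comp_of G x) = tail G" "head (comp_of G x) = head G"
  "len (comp_of G x) = len G"
  by (auto simp: comp_of_def)

lemma arcs_comp_subset: "arcs (comp_of G x) \<subseteq> arcs G"
  by (auto simp: comp_of_def)

lemma joins_comp:
  assumes "is_lgraph G"
  shows "joins (comp_of G x) e p q \<longleftrightarrow> joins G e p q \<and> p \<in> verts (comp_of G x)"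
proof -
  have step: "\<exists>es. wk G {} x es q" if "joins G e p q" "wk G {} x es p" for es p q
    using wk_snoc[OF that(2,1)] joins_verts[OF assms that(1)] by auto
  show ?thesis
  proof
    assume *: "joins (comp_of G x) e p q"
    then have j: "joins G e p q" "p = tail G e \<or> q = tail G e" "\<exists>es. wk G {} x es (tail G e)"
      by (auto simp: joins_def comp_of_def)
    then show "joins G e p q \<and> p \<in> verts (comp_of G x)"
      using step[OF joins_symD[OF j(1)]] by auto
  next
    assume *: "joins G e p q \<and> p \<in> verts (comp_of G x)"
    then have "\<exists>es. wk G {} x es (tail G e)"
      using step[of p q] by (auto simp: joins_def)
    then show "joins (comp_of G x) e p q" using * by (auto simp: joins_def comp_of_def)
  qed
qed

lemma verts_comp_subset: "verts (comp_of G x) \<subseteq> verts G"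
  using wk_ends by fastforce

lemma wk_comp:
  assumes "is_lgraph G"
  shows "wk (comp_of G x) X p es q \<longleftrightarrow> wk G X p es q \<and> p \<in> verts (comp_of G x)"
proof
  assume *: "wk (comp_of G x) X p es q"
  have "wk G X p es q"
    by (rule wk_cong_mono[OF *]) (use joins_comp[OF assms] verts_comp_subset[of G x] in blast)+
  then show "wk G X p es q \<and> p \<in> verts (comp_of G x)" using wk_ends[OF *] by blast
next
  assume "wk G X p es q \<and> p \<in> verts (comp_of G x)"
  then have "wk G X p es q" "p \<in> verts (comp_of G x)" by auto
  then show "wk (comp_of G x) X p es q"
  proof (induction rule: wk.induct)
    case (Nil p)
    then show ?case by (simp add: wk_Nil_iff)
  next
    case (Cons e p z es y)
    have j: "joins (comp_of G x) e p z" using Cons joins_comp[OF assms] by blast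
    have "joins (comp_of G x) e z p" using j by (rule joins_symD)
    then have "z \<in> verts (comp_of G x)" using joins_comp[OF assms] by blast
    then show ?case using Cons j by (intro wk.Cons) auto
  qed
qed

lemma is_lgraph_comp:
  assumes "is_lgraph G"
  shows "is_lgraph (comp_of G x)"
proof -
  note A = is_lgraphD[OF assms]
  show ?thesis
  proof (rule is_lgraphI)
    show "finite (verts (comp_of G x))" using A(1) verts_comp_subset finite_subset by metis
    show "finite (arcs (comp_of G x))" using A(2) arcs_comp_subset finite_subset by metis
    fix e assume e: "e \<in> arcs (comp_of G x)"
    then have "joins (comp_of G x) e (tail G e) (head G e)" "joins (comp_of G x) e (head G e) (tail G e)"
      by (auto simp: joins_def)
    then have "tail G e \<in> verts (comp_of G x)" "head G e \<in> verts (comp_of G x)"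
      using joins_comp[OF assms] by blast+
    then show "tail (comp_of G x) e \<in> verts (comp_of G x)" "head (comp_of G x) e \<in> verts (comp_of G x)" by auto
    show "tail (comp_of G x) e \<noteq> head (comp_of G x) e" "0 < len (comp_of G x) e"
      using e A(5,6)[of e] arcs_comp_subset[of G x] by auto
  qed
qed

lemma conn_comp:
  assumes "is_lgraph G" "x \<in> verts G"
  shows "conn (comp_of G x)"
  unfolding conn_def
proof (intro conjI ballI)
  show "verts (comp_of G x) \<noteq> {}" using assms(2) wk.Nil[of x G "{}"] by auto
  fix p q assume p: "p \<in> verts (comp_of G x)" and q: "q \<in> verts (comp_of G x)"
  then obtain es fs where "wk G {} x es p" "wk G {} x fs q" by auto
  then have "wk G {} p (rev es @ fs) q" by (auto intro: wk_append wk_rev)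
  then show "\<exists>es. wk (comp_of G x) {} p es q" using wk_comp[OF assms(1)] p by blast
qed

lemma inc_comp:
  assumes "is_lgraph G" "y \<in> verts (comp_of G x)"
  shows "inc (comp_of G x) e y \<longleftrightarrow> inc G e y"
  using joins_comp[OF assms(1)] assms(2) unfolding inc_joins by blast

lemma short_comp:
  assumes "is_lgraph G" "y \<in> verts (comp_of G x)"
  shows "short r (comp_of G x) y e f \<longleftrightarrow> short r G y e f"
proof -
  have "p \<in> verts (comp_of G x)" if "joins G e y p" for e p
    using that assms joins_comp[OF assms(1)] joins_symD by metis
  moreover have "joins (comp_of G x) f q y \<longleftrightarrow> joins G f q y" for f q
    using assms joins_comp[OF assms(1)] joins_symD by metis
  ultimately show ?thesis
    unfolding short_def wk_comp[OF assms(1)] joins_comp[OF assms(1), of x _ y] using assms(2)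
    by (simp only: comp_simps(4)) blast
qed

lemma linked_at_comp:
  assumes "is_lgraph G" "y \<in> verts (comp_of G x)"
  shows "linked_at r (comp_of G x) y \<longleftrightarrow> linked_at r G y"
  unfolding linked_at_def short_comp[OF assms] inc_comp[OF assms] ..

lemma loc2_comp:
  assumes "loc2 r G"
  shows "loc2 r (comp_of G x)"
proof -
  have G: "is_lgraph G" using assms by (simp add: loc2_def)
  show ?thesis
    unfolding loc2_def
    using is_lgraph_comp[OF G] inc_comp[OF G] linked_at_comp[OF G] assms verts_comp_subset[of G x]
    unfolding loc2_def by blast
qed

section \<open>Parity classes of closed walks\<close>

text \<open>
  \<open>loc_even r G\<close> consists of the edge sets that meet every closed walk of length at most \<open>r\<close> an even
  number of times, and \<open>classes r G\<close> of the homomorphisms from closed walks to \<open>\<int>/2\<close> they induce. The number of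
  classes is the order of the first cohomology group with coefficients in \<open>\<int>/2\<close> of \<open>G\<close> with all
  short cycles filled in. It drops when a cut at a local 2-separation leaves the graph connected.
\<close>

definition loc_even :: "enat \<Rightarrow> ('a, 'b) lgraph \<Rightarrow> 'b set set" where
  "loc_even r G = {S. S \<subseteq> arcs G \<and> (\<forall>x es. wk G {} x es x \<longrightarrow> enat (wt G es) \<le> r \<longrightarrow> \<not> par S es)}"

definition odd_walks :: "('a, 'b) lgraph \<Rightarrow> 'b set \<Rightarrow> 'b list set" where
  "odd_walks G S = {es. (\<exists>x. wk G {} x es x) \<and> par S es}"

definition classes :: "enat \<Rightarrow> ('a, 'b) lgraph \<Rightarrow> 'b list set set" where
  "classes r G = odd_walks G ` loc_even r G"

lemma finite_loc_even: "is_lgraph G \<Longrightarrow> finite (loc_even r G)"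
  by (rule finite_subset[of _ "Pow (arcs G)"]) (auto simp: loc_even_def is_lgraphD)

lemma card_image_factor:
  assumes "finite L" "\<And>x y. x \<in> L \<Longrightarrow> y \<in> L \<Longrightarrow> p x = p y \<Longrightarrow> q x = q y" "M \<subseteq> q ` L"
  shows "card M \<le> card (p ` L)"
    and "x \<in> L \<Longrightarrow> y \<in> L \<Longrightarrow> p x \<noteq> p y \<Longrightarrow> q x = q y \<Longrightarrow> card M < card (p ` L)"
proof -
  define F where "F m = q (inv_into L p m)" for m
  have F: "F (p x) = q x" if "x \<in> L" for x
    unfolding F_def using that by (intro assms(2) inv_into_into f_inv_into_f) auto
  then have q: "q ` L = F ` (p ` L)" by (auto simp: image_image)
  have M: "card M \<le> card (F ` (p ` L))" using assms(1,3) q by (metis card_mono finite_imageI)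
  then show "card M \<le> card (p ` L)" using assms(1) card_image_le[of "p ` L" F] by fastforce
  assume xy: "x \<in> L" "y \<in> L" "p x \<noteq> p y" "q x = q y"
  then have "\<not> inj_on F (p ` L)" using F by (auto simp: inj_on_def)
  then have "card (F ` (p ` L)) < card (p ` L)"
    using assms(1) by (metis card_image_le finite_imageI inj_on_iff_eq_card order_le_less)
  then show "card M < card (p ` L)" using M by simp
qed

lemma par_cong: "(\<And>e. e \<in> set es \<Longrightarrow> e \<in> S \<longleftrightarrow> e \<in> S') \<Longrightarrow> par S es \<longleftrightarrow> par S' es"
  by (induction es) auto

lemma par_xor: "par {e. P e \<noteq> Q e} es \<longleftrightarrow> par {e. P e} es \<noteq> par {e. Q e} es"
  by (induction es) auto

lemma par_empty [simp]: "\<not> par {} es"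
  by (induction es) auto

text \<open>The edges at \<open>z\<close> form the coboundary of \<open>z\<close>, whose value on a
  walk depends on the ends only.\<close>

lemma par_inc:
  assumes "is_lgraph G" "wk G X x es y"
  shows "par {e. inc G e z} es \<longleftrightarrow> (x = z) \<noteq> (y = z)"
  using assms(2)
proof (induction rule: wk.induct)
  case (Cons e x u es y)
  have "inc G e z \<longleftrightarrow> x = z \<or> u = z" using Cons(1) by (auto simp: inc_def joins_def)
  moreover have "x \<noteq> u" using joins_verts[OF assms(1) Cons(1)] by auto
  ultimately show ?case using Cons.IH by auto
qed auto

context sep
begin

text \<open>Every segment of the walk satisfies the bound with slack, since the remainder costs at
  least \<open>k\<close> whenever it joins different vertices. The parities add up correctly because
  there are only two vertices to alternate between; \<open>\<tau>\<close> is the common parity of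
  the segments from one to the other.\<close>

lemma walk_parity:
  assumes seg: "\<And>s t es. s \<in> {v, w} \<Longrightarrow> t \<in> {v, w} \<Longrightarrow> sg G {v, w} s es t \<Longrightarrow>
      enat (wt G es + (if s = t then 0 else k)) \<le> r \<Longrightarrow> par S es \<longleftrightarrow> s \<noteq> t \<and> \<tau>"
    and "wk G {} s es t" "s \<in> {v, w}" "t \<in> {v, w}" "enat (wt G es + (if s = t then 0 else k)) \<le> r"
  shows "par S es \<longleftrightarrow> s \<noteq> t \<and> \<tau>"
  using assms(2-)
proof (induction "length es" arbitrary: es s rule: less_induct)
  case less
  show ?case
  proof (cases "es = []")
    case True
    then show ?thesis using less by (auto simp: wk_Nil_iff)
  next
    case False
    obtain es1 z es2 where *: "es = es1 @ es2" "sg G ({} \<union> {v, w}) s es1 z" "z \<in> {v, w}" "wk G {} z es2 t"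
      by (rule wk_first_seg[OF less(2,3,4) False])
    then have sg: "sg G {v, w} s es1 z" by simp
    have l: "length es2 < length es" using * sg_ne[OF sg] by auto
    have low1: "(if s = z then 0 else k) \<le> wt G es1"
      using kmin_sg[OF less(3) *(3) _ sg] by auto
    have low2: "(if z = t then 0 else k) \<le> wt G es2"
      using kmin[of es2] sep.kmin[OF sep_swap, of es2] *(3,4) less(4) by auto
    have leI: "enat n \<le> r" if "n \<le> wt G es + (if s = t then 0 else k)" for n
      using less(5) that by (meson enat_ord_simps(1) order_trans)
    have "wt G es1 + (if s = z then 0 else k) \<le> wt G es + (if s = t then 0 else k)"
      using low2 *(1,3) less(3,4) by (auto split: if_splits)
    then have p1: "par S es1 \<longleftrightarrow> s \<noteq> z \<and> \<tau>" using seg[OF less(3) *(3) sg leI] by blast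
    have "wt G es2 + (if z = t then 0 else k) \<le> wt G es + (if s = t then 0 else k)"
      using low1 *(1,3) less(3,4) by (auto split: if_splits)
    then have p2: "par S es2 \<longleftrightarrow> z \<noteq> t \<and> \<tau>" using less(1)[OF l *(4,3) less(4) leI] by blast
    show ?thesis using p1 p2 *(1,3) less(3,4) by auto
  qed
qed

text \<open>A closed walk that meets \<open>v\<close> or \<open>w\<close> is rotated so as to start
  there, which changes neither its length nor its parity.\<close>

lemma loc_even_of_segs:
  assumes seg: "\<And>s t es. s \<in> {v, w} \<Longrightarrow> t \<in> {v, w} \<Longrightarrow> sg G {v, w} s es t \<Longrightarrow>
      enat (wt G es + (if s = t then 0 else k)) \<le> r \<Longrightarrow> par S es \<longleftrightarrow> s \<noteq> t \<and> \<tau>"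
    and avoid: "\<And>x es. wk G {v, w} x es x \<Longrightarrow> enat (wt G es) \<le> r \<Longrightarrow> \<not> par S es"
    and "S \<subseteq> arcs G"
  shows "S \<in> loc_even r G"
  unfolding loc_even_def
proof (intro CollectI conjI allI impI assms(3))
  fix x es assume *: "wk G {} x es x" "enat (wt G es) \<le> r"
  have closed: "\<not> par S es" if "wk G {} s es s" "enat (wt G es) \<le> r" "s \<in> {v, w}" for s es
    using walk_parity[OF seg that(1,3,3)] that(2) by auto
  show "\<not> par S es"
  proof (cases "x \<in> {v, w}")
    case True
    then show ?thesis using closed * by blast
  next
    case False
    from wk_first_hit[OF *(1) False] show ?thesis
    proof (elim disjE exE conjE)
      assume "wk G ({} \<union> {v, w}) x es x"
      then show ?thesis using avoid[of x es] *(2) by simp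
    next
      fix es1 f es2 u z
      assume 1: "es = es1 @ f # es2" "wk G ({} \<union> {v, w}) x es1 u" "joins G f u z" "z \<in> {v, w}" "wk G {} z es2 x"
      have "wk G {} x (es1 @ [f]) z"
        using wk_snoc[OF wk_mono[OF 1(2), of "{}"] 1(3)] 1(4) v w by auto
      from wk_append[OF 1(5) this] have "wk G {} z (es2 @ es1 @ [f]) z" .
      moreover have "enat (wt G (es2 @ es1 @ [f])) \<le> r" using *(2) 1(1) by (simp add: ac_simps)
      ultimately have "\<not> par S (es2 @ es1 @ [f])" using closed 1(4) by blast
      then show ?thesis using 1(1) by auto
    qed
  qed
qed

end

context cut
begin

lemma lift_seg_wk:
  assumes "sg G {v, w} s es t" "s \<in> {v, w}" "t \<in> {v, w}" "hd es \<in> A" "last es \<in> A"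
  shows "wk G' {} (em v w vA wA s) es (em v w vA wA t)"
proof -
  have "sg G' {} (em v w vA wA s) es (em v w vA wA t)"
    using lift_sg[OF assms(1) order_refl, of "{}"] assms by simp
  then show ?thesis using sg_wk[of G' "{}" _ es _ "{}"] assms(2,3) Tverts by auto
qed

text \<open>A path through \<open>A\<close> has to be compared with \<open>a\<close> by short closed
  walks. If \<open>k = gB\<close>, the edge \<open>a\<close> itself has length \<open>k\<close> and
  closes the path up. Otherwise \<open>k = gA\<close>, and a shortest path through \<open>A\<close>
  serves as intermediary: it closes up with the given path at cost \<open>k\<close>, and with
  \<open>a\<close> because \<open>gA + gB \<le> r\<close>.\<close>

lemma seg_parity:
  assumes S: "\<And>x es. wk G' {} x es x \<Longrightarrow> enat (wt G' es) \<le> r \<Longrightarrow> \<not> par S es"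
    and "sg G {v, w} s es t" "s \<in> {v, w}" "t \<in> {v, w}" "hd es \<in> A" "last es \<in> A"
    and "enat (wt G es + (if s = t then 0 else k)) \<le> r"
  shows "par S es \<longleftrightarrow> s \<noteq> t \<and> a \<in> S"
proof -
  have wk: "wk G' {} (em v w vA wA s) es (em v w vA wA t)" using lift_seg_wk assms(2-6) by blast
  have arcs: "set es \<subseteq> arcs G" using sg_arcs[OF assms(2)] .
  show ?thesis
  proof (cases "s = t")
    case True
    then show ?thesis using S[of _ es] wk wt'[OF arcs] assms(7) by auto
  next
    case False
    have a: "wk G' {} wA [a] vA" using joinsa Tverts by (auto intro: wk_single)
    have main: "par S es \<longleftrightarrow> a \<in> S" if es: "wk G' {} vA es wA" "enat (wt G' es + k) \<le> r" for es
    proof (cases "k = gB")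
      case True
      have "wk G' {} vA (es @ [a]) vA" using es a by (auto intro: wk_append)
      then have "\<not> par S (es @ [a])" using S[of vA "es @ [a]"] es(2) lena True by auto
      then show ?thesis by auto
    next
      case False
      then have kA: "k = gA" using k_cases by simp
      obtain fs where fs: "wk G' {} vA fs wA" "wt G' fs = gA" using gap_walk by blast
      have "\<not> par S (es @ rev fs)"
        using S[OF wk_append[OF es(1) wk_rev[OF fs(1)]]] es(2) kA fs(2) by (simp add: rev_map[symmetric])
      moreover have "\<not> par S (fs @ [a])"
        using S[OF wk_append[OF fs(1) a]] fs(2) lena gA_gB by simp
      ultimately show ?thesis by auto
    qed
    consider "s = v" "t = w" | "s = w" "t = v" using False assms(3,4) by auto
    then show ?thesis
    proof cases
      case 1
      then show ?thesis using main[of es] wk wt'[OF arcs] assms(7) False by auto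
    next
      case 2
      then show ?thesis using main[of "rev es"] wk_rev[OF wk] wt'[OF arcs] assms(7) False
        by (auto simp: rev_map[symmetric])
    qed
  qed
qed

text \<open>The pullback of \<open>S\<close> along the map that sends both virtual edges to a shortest \<open>v\<close>--\<open>w\<close> path \<open>R\<close>.\<close>

definition pull :: "'b list \<Rightarrow> 'b set \<Rightarrow> 'b set" where
  "pull R S = {e. e \<in> S \<inter> arcs G \<or> e \<in> {a, b} \<and> par S R}"

text \<open>A virtual edge is at least as long as \<open>R\<close>, which replaces it. The projected
  walk is chosen before \<open>S\<close>, so that it serves for all cochains at once.\<close>

lemma proj_wk:
  assumes R: "wk G {} v R w" "wt G R = k" and "wk G' {} x es y"
  shows "\<exists>es'. wk G {} (pr x) es' (pr y) \<and> wt G es' \<le> wt G' es \<and> (\<forall>S. par S es' \<longleftrightarrow> par (pull R S) es)"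
  using assms(3)
proof (induction rule: wk.induct)
  case (Nil x)
  then show ?case using pr_verts by (intro exI[of _ "[]"]) (auto intro: wk.Nil)
next
  case (Cons e x z es y)
  then obtain es' where es': "wk G {} (pr z) es' (pr y)" "wt G es' \<le> wt G' es"
    "\<forall>S. par S es' \<longleftrightarrow> par (pull R S) es" by blast
  have "\<exists>fs. wk G {} (pr x) fs (pr z) \<and> wt G fs \<le> len G' e \<and> (\<forall>S. par S fs \<longleftrightarrow> e \<in> pull R S)"
  proof (cases "e \<in> arcs G")
    case True
    then have "joins G e (pr x) (pr z)" using joins_pr Cons(1) by blast
    then show ?thesis using True ab len'[OF True] joins_verts[OF lg]
      by (intro exI[of _ "[e]"]) (auto intro: wk_single simp: pull_def)
  next
    case False
    then have e: "e \<in> {a, b}" using joins_arc[OF Cons(1)] arcs' by auto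
    then have l: "k \<le> len G' e" using lena lenb k_le_gA k_le_gB by auto
    have "pr x = v \<and> pr z = w \<or> pr x = w \<and> pr z = v"
      using e Cons(1) joinsa joinsb by auto
    then have "wk G {} (pr x) R (pr z) \<or> wk G {} (pr x) (rev R) (pr z)" using R wk_rev by metis
    moreover have "par S R \<longleftrightarrow> e \<in> pull R S" for S using e ab by (auto simp: pull_def)
    ultimately show ?thesis using l R(2) by (metis par_simps(4) rev_map sum_list_rev)
  qed
  then obtain fs where fs: "wk G {} (pr x) fs (pr z)" "wt G fs \<le> len G' e" "\<forall>S. par S fs \<longleftrightarrow> e \<in> pull R S"
    by blast
  have "par S (fs @ es') \<longleftrightarrow> par (pull R S) (e # es)" for S
    using es'(3)[rule_format, of S] fs(3)[rule_format, of S] par_simps(2)[of "pull R S" e es] par_simps(3)[of S fs es']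
    by simp
  then show ?case using wk_append[OF fs(1) es'(1)] es'(2) fs(2) by (intro exI[of _ "fs @ es'"]) auto
qed

text \<open>Pulling back is onto the classes of the component of \<open>vA\<close>. A cochain
  \<open>S'\<close> there assigns \<open>a\<close> and \<open>b\<close> values that may differ,
  whereas a pullback assigns the parity of \<open>R\<close> to both; a coboundary repairs
  this.\<close>

lemma extend_parity:
  assumes R: "wk G {} v R w" "wt G R = k" and S': "S' \<in> loc_even r (comp_of G' vA)"
  shows "\<exists>S \<in> loc_even r G. odd_walks (comp_of G' vA) S' = odd_walks (comp_of G' vA) (pull R S)"
proof -
  let ?K = "comp_of G' vA"
  \<comment> \<open>Adding the coboundary of \<open>vB\<close>, if necessary, flips \<open>b\<close>
    but not \<open>a\<close>, and it does not affect closed walks. In \<open>S2\<close> both virtual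
    edges have the same value, which is the parity of all short enough paths from \<open>v\<close>
    to \<open>w\<close>.\<close>
  define \<theta> where "\<theta> \<longleftrightarrow> (a \<in> S') \<noteq> (b \<in> S')"
  define S2 where "S2 = {e. (e \<in> S') \<noteq> (\<theta> \<and> inc G' e vB)}"
  define S where "S = S2 \<inter> arcs G"
  have S2: "par S2 es \<longleftrightarrow> par S' es" if "wk G' {} x es x" for x es
  proof -
    have "par {e. \<theta> \<and> inc G' e vB} es \<longleftrightarrow> False"
      using par_inc[OF lg' that, of vB] by (cases \<theta>) auto
    then show ?thesis unfolding S2_def par_xor by simp
  qed
  have even: "\<not> par S2 es" if wk: "wk G' {} x es x" and "enat (wt G' es) \<le> r" for x es
  proof (cases "x \<in> verts ?K")
    case True
    then have "wk ?K {} x es x" using wk wk_comp[OF lg'] by blast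
    then have "\<not> par S' es" using S' that(2) by (auto simp: loc_even_def)
    then show ?thesis using S2[OF wk] by simp
  next
    case False
    \<comment> \<open>A walk that starts off the component never enters it, and \<open>S'\<close>
      has no edges elsewhere.\<close>
    have "par S' es \<longleftrightarrow> par {} es" if "wk G' {} x es y" "x \<notin> verts ?K" for x y es
    proof (rule par_cong)
      fix e assume e: "e \<in> set es"
      have "e \<notin> arcs ?K" using that e
      proof (induction rule: wk.induct)
        case (Cons f x z fs y)
        have z: "z \<notin> verts ?K"
        proof
          assume "z \<in> verts ?K"
          then have "joins ?K f z x" using joins_symD[OF Cons(1)] joins_comp[OF lg'] by blast
          then have "joins ?K f x z" by (rule joins_symD)
          then show False using Cons.prems(1) joins_comp[OF lg'] by blast
        qed
        show ?case
        proof
          assume eK: "e \<in> arcs ?K"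
          then have "e \<noteq> f \<Longrightarrow> False" using Cons z by auto
          moreover have "e = f \<Longrightarrow> joins ?K e x z" using Cons(1) eK by (auto simp: joins_def)
          ultimately show False using joins_comp[OF lg'] Cons.prems(1) by blast
        qed
      qed simp
      then show "e \<in> S' \<longleftrightarrow> e \<in> {}" using S' by (auto simp: loc_even_def)
    qed
    from this[OF wk False] show ?thesis using S2[OF wk] by simp
  qed
  have ba: "b \<in> S2 \<longleftrightarrow> a \<in> S2"
    using joinsa joinsb dist4 by (auto simp: S2_def \<theta>_def inc_joins)
  have SS2: "par S es \<longleftrightarrow> par S2 es" if "set es \<subseteq> arcs G" for es
    by (rule par_cong) (use that in \<open>auto simp: S_def\<close>)
  have segS: "par S es \<longleftrightarrow> s \<noteq> t \<and> a \<in> S2"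
    if "s \<in> {v, w}" "t \<in> {v, w}" "sg G {v, w} s es t" "enat (wt G es + (if s = t then 0 else k)) \<le> r" for s t es
  proof (cases "hd es \<in> A")
    case True
    then show ?thesis
      using seg_parity[of S2 s es t] even that side[OF that] SS2[OF sg_arcs[OF that(3)]] by blast
  next
    case False
    then show ?thesis
      using cut.seg_parity[OF cut_compl, of S2 s es t] even that side[OF that]
        SS2[OF sg_arcs[OF that(3)]] ba by blast
  qed
  have "S \<in> loc_even r G"
  proof (rule loc_even_of_segs[OF segS])
    fix x es assume *: "wk G {v, w} x es x" "enat (wt G es) \<le> r"
    have ar: "set es \<subseteq> arcs G" using wk_arcs[OF *(1)] .
    have "wk G' {} x es x" by (rule lift_wk[OF *(1)]) auto
    then show "\<not> par S es" using even[of x es] *(2) wt'[OF ar] SS2[OF ar] by simp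
  qed (auto simp: S_def)
  moreover have "odd_walks ?K S' = odd_walks ?K (pull R S)"
  proof -
    have SR: "par S R \<longleftrightarrow> a \<in> S2"
      using walk_parity[OF segS R(1)] R(2) k2 vw by (auto simp: mult_2)
    have "par S' es \<longleftrightarrow> par (pull R S) es" if "wk ?K {} x es x" for x es
    proof -
      have wk: "wk G' {} x es x" using that wk_comp[OF lg'] by blast
      have "par (pull R S) es \<longleftrightarrow> par S2 es"
        by (rule par_cong) (use wk_arcs[OF wk] arcs' ab SR ba in \<open>auto simp: pull_def S_def\<close>)
      then show ?thesis using S2[OF wk] by simp
    qed
    then show ?thesis by (auto simp: odd_walks_def)
  qed
  ultimately show ?thesis by blast
qed

text \<open>Pulling back is well defined on classes: a closed walk of the cut graph projects to a
  closed walk on which every cochain has the parity of its pullback.\<close>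

lemma pull_odd_walks:
  assumes R: "wk G {} v R w" "wt G R = k" and "odd_walks G S1 = odd_walks G S2"
  shows "odd_walks (comp_of G' vA) (pull R S1) = odd_walks (comp_of G' vA) (pull R S2)"
proof -
  have "odd_walks (comp_of G' vA) (pull R S1) \<subseteq> odd_walks (comp_of G' vA) (pull R S2)"
    if eq: "odd_walks G S1 = odd_walks G S2" for S1 S2
  proof
    fix es assume "es \<in> odd_walks (comp_of G' vA) (pull R S1)"
    then obtain x where x: "wk (comp_of G' vA) {} x es x" "par (pull R S1) es" by (auto simp: odd_walks_def)
    then have "wk G' {} x es x" using wk_comp[OF lg'] by blast
    then obtain es' where es': "wk G {} (pr x) es' (pr x)" "\<forall>S. par S es' \<longleftrightarrow> par (pull R S) es"
      using proj_wk[OF R] by blast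
    then have "es' \<in> odd_walks G S1" using x(2) by (auto simp: odd_walks_def)
    then have "es' \<in> odd_walks G S2" using eq by simp
    then show "es \<in> odd_walks (comp_of G' vA) (pull R S2)" using x(1) es'(2) by (auto simp: odd_walks_def)
  qed
  then show ?thesis using assms(3) by blast
qed

text \<open>Pulling back induces a surjection from the classes of \<open>G\<close> to those of the
  component. If \<open>vB\<close> is in the component, a nontrivial class is sent to the trivial
  one, and the surjection is not injective.\<close>

lemma card_classes_le: "card (classes r (comp_of G' vA)) \<le> card (classes r G)"
  and card_classes_less: "vB \<in> verts (comp_of G' vA) \<Longrightarrow> card (classes r (comp_of G' vA)) < card (classes r G)"
proof -
  let ?K = "comp_of G' vA"
  obtain R where R: "wk G {} v R w" "wt G R = k" using geo by blast
  have sub: "classes r ?K \<subseteq> (\<lambda>S. odd_walks ?K (pull R S)) ` loc_even r G"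
    unfolding classes_def using extend_parity[OF R] by blast
  note * = card_image_factor[OF finite_loc_even[OF lg, of r] _ sub, of "odd_walks G",
      folded classes_def, OF pull_odd_walks[OF R]]
  show "card (classes r ?K) \<le> card (classes r G)" by (rule *(1))
  assume "vB \<in> verts ?K"
  then obtain es where es: "wk G' {} vA es vB" by auto
  \<comment> \<open>In the cut graph this is the coboundary of \<open>{vB, wB}\<close>, hence
    trivial there; the virtual edges do not occur in it, since each of them has both or none of its
    ends in this set.\<close>
  define S0 where "S0 = {e \<in> arcs G. inc G' e vB \<noteq> inc G' e wB}"
  have incb: "inc G' e vB \<longleftrightarrow> inc G' e wB" if "e \<in> {a, b}" for e
    using that joinsa joinsb dist4 by (auto simp: inc_joins)
  have S0: "par S0 fs \<longleftrightarrow> ((x = vB) \<noteq> (y = vB)) \<noteq> ((x = wB) \<noteq> (y = wB))" if "wk G' {} x fs y" for fs x y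
  proof -
    have "par S0 fs \<longleftrightarrow> par {e. inc G' e vB \<noteq> inc G' e wB} fs"
      by (rule par_cong) (use wk_arcs[OF that] arcs' incb in \<open>auto simp: S0_def\<close>)
    then show ?thesis unfolding par_xor using par_inc[OF lg' that] by simp
  qed
  have segS: "par S0 fs \<longleftrightarrow> s \<noteq> t \<and> False"
    if "s \<in> {v, w}" "t \<in> {v, w}" "sg G {v, w} s fs t" "enat (wt G fs + (if s = t then 0 else k)) \<le> r" for s t fs
  proof (cases "hd fs \<in> A")
    case True
    then have "wk G' {} (em v w vA wA s) fs (em v w vA wA t)"
      using lift_seg_wk that side[OF that] by blast
    from S0[OF this] show ?thesis using that(1,2) dist4 by auto
  next
    case False
    then have "wk G' {} (em v w vB wB s) fs (em v w vB wB t)"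
      using cut.lift_seg_wk[OF cut_compl that(3,1,2)] side[OF that] by simp
    from S0[OF this] show ?thesis using that(1,2) dist4 by auto
  qed
  have 1: "S0 \<in> loc_even r G"
  proof (rule loc_even_of_segs[OF segS])
    fix x es assume *: "wk G {v, w} x es x" "enat (wt G es) \<le> r"
    have "wk G' {} x es x" by (rule lift_wk[OF *(1)]) auto
    from S0[OF this] show "\<not> par S0 es" by simp
  qed (auto simp: S0_def)
  have S0R: "\<not> par S0 R" using walk_parity[OF segS R(1)] R(2) k2 vw by (auto simp: mult_2)
  have pullS0: "par (pull R S0) fs \<longleftrightarrow> par S0 fs" for fs
    by (rule par_cong) (use S0R ab in \<open>auto simp: pull_def S0_def\<close>)
  have 2: "{} \<in> loc_even r G" by (auto simp: loc_even_def)
  obtain es' where es': "wk G {} (pr vA) es' (pr vB)" "\<forall>S. par S es' \<longleftrightarrow> par (pull R S) es"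
    using proj_wk[OF R es] by blast
  \<comment> \<open>The walk from \<open>vA\<close> to \<open>vB\<close> projects to a closed walk
    at \<open>v\<close>, so \<open>S0\<close> is not trivial in \<open>G\<close>.\<close>
  have "par S0 es'" using es'(2) pullS0 S0[OF es] dist4 by auto
  then have "es' \<in> odd_walks G S0" using es'(1) by (auto simp: odd_walks_def)
  then have 3: "odd_walks G S0 \<noteq> odd_walks G {}" by (auto simp: odd_walks_def)
  have "\<not> par (pull R S0) fs" if "wk ?K {} x fs x" for x fs
    using S0[of x fs x] pullS0 that wk_comp[OF lg'] by blast
  then have 4: "odd_walks ?K (pull R S0) = odd_walks ?K (pull R {})"
    by (auto simp: odd_walks_def pull_def)
  show "card (classes r ?K) < card (classes r G)" by (rule *(2)[OF _ 1 2 3 4])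
qed

end

section \<open>Walks, distances and balls in unit length graphs\<close>

abbreviation dtail :: "('a, 'b) pre_digraph \<Rightarrow> 'b \<times> bool \<Rightarrow> 'a" where
  "dtail H \<equiv> tail (bidirect H)"
abbreviation dhead :: "('a, 'b) pre_digraph \<Rightarrow> 'b \<times> bool \<Rightarrow> 'a" where
  "dhead H \<equiv> head (bidirect H)"
abbreviation dverts :: "('a, 'b) pre_digraph \<Rightarrow> 'a \<Rightarrow> ('b \<times> bool) list \<Rightarrow> 'a list" where
  "dverts H \<equiv> pre_digraph.awalk_verts (bidirect H)"

lemma bidirect_simps [simp]:
  "verts (bidirect H) = verts H" "d \<in> arcs (bidirect H) \<longleftrightarrow> fst d \<in> arcs H"
  by (auto simp: bidirect_def mem_Times_iff)

lemma joins_dart: "d \<in> arcs (bidirect H) \<Longrightarrow> joins H (fst d) (dtail H d) (dhead H d)"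
  by (cases d) (auto simp: joins_def bidirect_def)

lemma dart_of_joins:
  assumes "joins H e x y"
  obtains d where "fst d = e" "dtail H d = x" "dhead H d = y" "d \<in> arcs (bidirect H)"
proof -
  consider "tail H e = x" "head H e = y" | "head H e = x" "tail H e = y"
    using assms by (auto simp: joins_def)
  then show ?thesis
  proof cases
    case 1
    then show ?thesis using that[of "(e, True)"] assms by (simp add: joins_def bidirect_def)
  next
    case 2
    then show ?thesis using that[of "(e, False)"] assms by (simp add: joins_def bidirect_def)
  qed
qed

lemma wk_of_awalk:
  assumes "wf_digraph H" "pre_digraph.awalk (bidirect H) u p v" "set (dverts H u p) \<inter> X = {}"
  shows "wk H X u (map fst p) v"
proof -
  interpret B: wf_digraph "bidirect H" by (rule wf_bidirect[OF assms(1)])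
  show ?thesis using assms(2,3)
  proof (induction p arbitrary: u)
    case Nil
    then show ?case by (auto simp: B.awalk_Nil_iff wk_Nil_iff)
  next
    case (Cons d p)
    then have d: "d \<in> arcs (bidirect H)" "u = dtail H d" "B.awalk (dhead H d) p v"
      by (auto simp: B.awalk_Cons_iff)
    then have "wk H X (dhead H d) (map fst p) v" using Cons by auto
    moreover have "u \<in> verts H" using B.awalk_hd_in_verts[OF Cons(2)] by simp
    moreover have "u \<notin> X" using Cons(3) d by auto
    ultimately show ?case using joins_dart[OF d(1)] d(2) by (auto intro: wk.Cons)
  qed
qed

lemma awalk_of_wk:
  assumes "wf_digraph H" "wk H X u es v"
  obtains p where "map fst p = es" "pre_digraph.awalk (bidirect H) u p v" "set (dverts H u p) \<inter> X = {}"
proof -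
  interpret B: wf_digraph "bidirect H" by (rule wf_bidirect[OF assms(1)])
  have "\<exists>p. map fst p = es \<and> B.awalk u p v \<and> set (dverts H u p) \<inter> X = {}" using assms(2)
  proof (induction rule: wk.induct)
    case (Nil x)
    then show ?case by (intro exI[of _ "[]"]) (auto simp: B.awalk_Nil_iff)
  next
    case (Cons e x z es y)
    then obtain p where p: "map fst p = es" "B.awalk z p y" "set (dverts H z p) \<inter> X = {}" by blast
    obtain d where d: "fst d = e" "dtail H d = x" "dhead H d = z" "d \<in> arcs (bidirect H)"
      by (rule dart_of_joins[OF Cons(1)])
    show ?case
      using p d Cons by (intro exI[of _ "d # p"]) (auto simp: B.awalk_Cons_iff)
  qed
  then show ?thesis using that by blast
qed

lemma connected_iff_conn:
  assumes "wf_digraph H"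
  shows "connected H \<longleftrightarrow> conn H"
proof -
  interpret wf_digraph H by (rule assms)
  let ?S = "with_proj (mk_symmetric H)"
  have adj: "x \<rightarrow>\<^bsub>?S\<^esub> y \<longleftrightarrow> (\<exists>e. joins H e x y)" for x y
    by (auto simp: parcs_mk_symmetric joins_def)
  have "x \<rightarrow>\<^sup>*\<^bsub>?S\<^esub> y \<longleftrightarrow> (\<exists>es. wk H {} x es y)" for x y
  proof
    assume "x \<rightarrow>\<^sup>*\<^bsub>?S\<^esub> y"
    then show "\<exists>es. wk H {} x es y"
      unfolding reachable_def
    proof (induction rule: rtrancl_on_induct)
      case base
      then show ?case by (intro exI[of _ "[]"]) (auto simp: wk_Nil_iff)
    next
      case (step y z)
      then obtain es e where "wk H {} x es y" "joins H e y z" using adj by blast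
      then show ?case using step wk_snoc[of H "{}" x es y e z] by auto
    qed
  next
    assume "\<exists>es. wk H {} x es y"
    then obtain es where "wk H {} x es y" ..
    then show "x \<rightarrow>\<^sup>*\<^bsub>?S\<^esub> y"
      unfolding reachable_def
    proof (induction rule: wk.induct)
      case (Nil x)
      then show ?case by simp
    next
      case (Cons e x z es y)
      then have "(x, z) \<in> arcs_ends ?S" using adj by blast
      then show ?case using Cons by (auto intro: converse_rtrancl_on_into_rtrancl_on)
    qed
  qed
  then show ?thesis unfolding connected_def strongly_connected_def conn_def by simp
qed

lemma conn_coloring:
  assumes "conn H" "\<And>e x y. joins H e x y \<Longrightarrow> f x = f y" "x \<in> verts H" "y \<in> verts H"
  shows "f x = f y"
proof -
  obtain es where "wk H {} x es y" using assms unfolding conn_def by blast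
  then show ?thesis by (induction rule: wk.induct) (use assms(2) in auto)
qed

text \<open>The colour records reachability from a fixed vertex. Two-colourings that are constant
  along edges are easier to carry between graphs than components.\<close>

lemma not_conn_coloring:
  assumes "\<not> conn H" "verts H \<noteq> {}"
  obtains f :: "'a \<Rightarrow> bool" and x y where
    "\<And>e x y. x \<in> verts H \<Longrightarrow> y \<in> verts H \<Longrightarrow> joins H e x y \<Longrightarrow> f x = f y"
    "x \<in> verts H" "y \<in> verts H" "f x" "\<not> f y"
proof -
  obtain x y where xy: "x \<in> verts H" "y \<in> verts H" "\<nexists>es. wk H {} x es y"
    using assms unfolding conn_def by blast
  show ?thesis
  proof (rule that[of "\<lambda>z. \<exists>es. wk H {} x es z" x y])
    fix e p q
    assume pq: "p \<in> verts H" "q \<in> verts H" and j: "joins H e p q"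
    have "\<exists>es. wk H {} x es q'" if "\<exists>es. wk H {} x es p'" "joins H e p' q'" "q' \<in> verts H" for p' q'
      using that wk_snoc by fast
    from this[OF _ j pq(2)] this[OF _ joins_symD[OF j] pq(1)]
    show "(\<exists>es. wk H {} x es p) = (\<exists>es. wk H {} x es q)" by blast
  qed (use xy wk.Nil[of x H "{}"] in auto)
qed

lemma disconnected_iff: "wf_digraph H \<Longrightarrow> disconnected H \<longleftrightarrow> verts H \<noteq> {} \<and> \<not> conn H"
  by (simp add: disconnected_def connected_iff_conn)

section \<open>Distances and balls\<close>

definition geod :: "('a, 'b) pre_digraph \<Rightarrow> 'a \<Rightarrow> 'b list \<Rightarrow> 'a \<Rightarrow> bool" where
  "geod H u es v \<longleftrightarrow> wk H {} u es v \<and> (\<forall>fs. wk H {} u fs v \<longrightarrow> length es \<le> length fs)"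

lemma ex_geod:
  assumes "wk H {} u fs v"
  obtains es where "geod H u es v" "length es \<le> length fs"
proof -
  define n where "n = (LEAST n. \<exists>es. wk H {} u es v \<and> length es = n)"
  have "\<exists>es. wk H {} u es v \<and> length es = n"
    unfolding n_def by (rule LeastI_ex) (use assms in blast)
  moreover have "n \<le> length es" if "wk H {} u es v" for es
    unfolding n_def by (rule Least_le) (use that in blast)
  ultimately show ?thesis using that assms unfolding geod_def by metis
qed

lemma gdist_cases:
  assumes "wf_digraph H"
  shows "(\<exists>es. geod H u es v \<and> gdist H u v = ereal (length es)) \<or>
    gdist H u v = \<infinity> \<and> (\<nexists>es. wk H {} u es v)"
proof -
  let ?P = "{p. pre_digraph.awalk (bidirect H) u p v}"
  have g: "gdist H u v = (INF p \<in> ?P. ereal (length p))" by (rule gdist_conv[OF assms])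
  show ?thesis
  proof (cases "\<exists>es. wk H {} u es v")
    case True
    then obtain fs where fs: "wk H {} u fs v" ..
    obtain es where es: "geod H u es v" by (rule ex_geod[OF fs])
    obtain p where p: "map fst p = es" "p \<in> ?P"
      using es awalk_of_wk[OF assms, of "{}" u es v] unfolding geod_def by blast
    have "length p \<le> length q" if "q \<in> ?P" for q
      using es wk_of_awalk[OF assms, of u q v "{}"] that p(1) unfolding geod_def by fastforce
    then have "(INF p \<in> ?P. ereal (length p)) = ereal (length p)"
      using p(2) by (intro antisym INF_greatest INF_lower) auto
    then show ?thesis using g es p(1) by (metis length_map)
  next
    case False
    then have "?P = {}" using wk_of_awalk[OF assms, of u _ v "{}"] by auto
    then show ?thesis using g False by (simp add: top_ereal_def)
  qed
qed

lemma gdist_geod: "wf_digraph H \<Longrightarrow> geod H u es v \<Longrightarrow> gdist H u v = ereal (length es)"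
  using gdist_cases[of H u v] unfolding geod_def by (metis le_antisym)

text \<open>A later visit of \<open>u\<close> would allow the beginning of the walk to be
  skipped.\<close>

lemma geod_step:
  assumes "geod H u es v" "u \<noteq> v"
  obtains e x es' where "es = e # es'" "joins H e u x" "wk H {u} x es' v"
proof -
  have wk: "wk H {} u es v" using assms by (simp add: geod_def)
  then obtain e es' where es: "es = e # es'" using assms(2) by (cases es) (auto simp: wk_Nil_iff)
  then obtain x where x: "joins H e u x" "wk H {} x es' v" using wk by (auto simp: wk_Cons_iff)
  have "v \<notin> {u}" using assms by auto
  from wk_last_hit[OF x(2) this] show ?thesis
  proof (elim disjE exE conjE)
    assume "wk H ({} \<union> {u}) x es' v"
    then show ?thesis using that[OF es x(1)] by simp
  next
    fix es1 f es2 z y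
    assume *: "es' = es1 @ f # es2" "z \<in> {u}" "joins H f z y" "wk H ({} \<union> {u}) y es2 v"
    have "wk H {} u (f # es2) v"
      using * wk_ends[OF wk] wk_mono[OF *(4), of "{}"] by (auto intro: wk.Cons)
    then have "length es \<le> length (f # es2)" using assms(1)[unfolded geod_def] by blast
    then show ?thesis using es * by simp
  qed
qed

text \<open>Doubling the length turns comparisons with the radius into comparisons in
  \<open>enat\<close>, uniformly for even, odd and infinite \<open>r\<close>.\<close>

lemma le_half: "ereal (real n) \<le> half r \<longleftrightarrow> enat (2 * n) \<le> r"
proof (cases r)
  case (enat m)
  have "ereal (real n) \<le> ereal (real m / 2) \<longleftrightarrow> 2 * n \<le> m" by (simp; linarith)
  then show ?thesis using enat by simp
qed simp

lemma eq_half: "ereal (real n) = half r \<longleftrightarrow> enat (2 * n) = r"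
proof (cases r)
  case (enat m)
  have "ereal (real n) = ereal (real m / 2) \<longleftrightarrow> 2 * n = m" by (simp; linarith)
  then show ?thesis using enat by simp
qed simp

lemma ball_simps [simp]: "tail (ball_graph \<rho> H v) = tail H" "head (ball_graph \<rho> H v) = head H"
  by (auto simp: ball_graph_def Let_def induce_subgraph_def)

lemma wf_ball: "wf_digraph H \<Longrightarrow> wf_digraph (ball_graph \<rho> H v)"
  by (auto simp: ball_graph_def Let_def wf_digraph_def)

lemma verts_ball:
  assumes "wf_digraph H"
  shows "y \<in> verts (ball_graph (half r) H v) \<longleftrightarrow> (\<exists>es. wk H {} v es y \<and> enat (2 * length es) \<le> r)"
proof -
  have "y \<in> verts (ball_graph (half r) H v) \<longleftrightarrow> y \<in> verts H \<and> gdist H v y \<le> half r \<and> gdist H v y < \<infinity>"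
    by (simp add: ball_graph_def Let_def)
  also have "\<dots> \<longleftrightarrow> (\<exists>es. wk H {} v es y \<and> enat (2 * length es) \<le> r)"
    using gdist_cases[OF assms, of v y]
  proof (elim disjE exE conjE)
    fix es assume es: "geod H v es y" "gdist H v y = ereal (length es)"
    have "enat (2 * length es) \<le> r" if "wk H {} v fs y" "enat (2 * length fs) \<le> r" for fs
      using es(1) that unfolding geod_def by (meson enat_ord_simps(1) mult_le_mono2 order_trans)
    moreover have "gdist H v y \<le> half r \<longleftrightarrow> enat (2 * length es) \<le> r" unfolding es(2) by (rule le_half)
    moreover have "y \<in> verts H" "wk H {} v es y" using es wk_ends[of H "{}" v es y] by (auto simp: geod_def)
    moreover have "gdist H v y < \<infinity>" using es(2) by simp
    ultimately show ?thesis by blast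
  qed auto
  finally show ?thesis .
qed

lemma arcs_ball: "joins (ball_graph (half r) H v) e y z \<longleftrightarrow> joins H e y z \<and>
    y \<in> verts (ball_graph (half r) H v) \<and> z \<in> verts (ball_graph (half r) H v) \<and>
    \<not> (gdist H v y = half r \<and> gdist H v z = half r)"
  by (auto simp: joins_def ball_graph_def Let_def)

text \<open>The distance of \<open>y\<close> is at most \<open>length p\<close> and at most
  \<open>length q + 1\<close>, so its double is at most the length of the closed walk; the same
  holds for \<open>z\<close>. If both distances were \<open>r/2\<close>, then \<open>p\<close> and
  \<open>q\<close> alone would have total length at least \<open>r\<close>.\<close>

lemma ball_joinsI:
  assumes "wf_digraph H" "wk H {} v p y" "joins H e y z" "wk H {} z q v" "enat (length p + 1 + length q) \<le> r"
  shows "joins (ball_graph (half r) H v) e y z"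
proof -
  have y: "y \<in> verts H" "z \<in> verts H" using wk_ends assms by fast+
  have 1: "wk H {} v (rev q) z" using wk_rev[OF assms(4)] .
  have 2: "wk H {} v (p @ [e]) z" using wk_snoc[OF assms(2,3) y(2)] by simp
  have 3: "wk H {} v (rev q @ [e]) y" using wk_snoc[OF 1 joins_symD[OF assms(3)] y(1)] by simp
  obtain a where a: "geod H v a y" "length a \<le> length p" using ex_geod[OF assms(2)] .
  obtain b where b: "geod H v b z" "length b \<le> length (rev q)" using ex_geod[OF 1] .
  have a2: "length a \<le> length q + 1" using 3 a(1) unfolding geod_def by fastforce
  have b2: "length b \<le> length p + 1" using 2 b(1) unfolding geod_def by fastforce
  have le: "enat n \<le> r" if "n \<le> length p + 1 + length q" for n
    using assms(5) that by (meson enat_ord_simps(1) order_trans)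
  have "y \<in> verts (ball_graph (half r) H v)"
    unfolding verts_ball[OF assms(1)] using a a2 le[of "2 * length a"] by (auto simp: geod_def)
  moreover have "z \<in> verts (ball_graph (half r) H v)"
    unfolding verts_ball[OF assms(1)] using b b2 le[of "2 * length b"] by (auto simp: geod_def)
  moreover have "\<not> (gdist H v y = half r \<and> gdist H v z = half r)"
  proof
    assume "gdist H v y = half r \<and> gdist H v z = half r"
    then have "enat (2 * length a) = r" "enat (2 * length b) = r"
      using gdist_geod[OF assms(1) a(1)] gdist_geod[OF assms(1) b(1)] eq_half by metis+
    then show False using a(2) b(2) assms(5) by auto
  qed
  ultimately show ?thesis unfolding arcs_ball using assms(3) by blast
qed

text \<open>Every edge of \<open>ps\<close> lies on the closed walk formed by \<open>us\<close>,
  \<open>ps\<close> and \<open>qs\<close>, hence in the ball.\<close>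

lemma ball_const:
  assumes "wf_digraph H"
    and f: "\<And>e y z. joins (ball_graph (half r) H v) e y z \<Longrightarrow> y \<notin> Y \<Longrightarrow> z \<notin> Y \<Longrightarrow> f y = f z"
    and "wk H Y P ps Q" "wk H {} v us P" "wk H {} Q qs v" "enat (length us + length ps + length qs) \<le> r"
  shows "f P = f Q"
  using assms(3-)
proof (induction arbitrary: us rule: wk.induct)
  case (Cons e P R ps Q)
  have R: "R \<in> verts H" "R \<notin> Y" using wk_ends[OF Cons(4)] by auto
  have "joins (ball_graph (half r) H v) e P R"
    by (rule ball_joinsI[OF assms(1) Cons.prems(1) Cons(1) wk_append[OF wk_mono[OF Cons(4)] Cons.prems(2)]])
      (use Cons.prems(3) in \<open>auto simp: ac_simps\<close>)
  then have "f P = f R" using f Cons(3) R(2) by blast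
  moreover have "wk H {} v (us @ [e]) R" using wk_snoc[OF Cons.prems(1) Cons(1)] R by simp
  then have "f R = f Q" using Cons.IH Cons.prems(2,3) by simp
  ultimately show ?case by simp
qed simp

text \<open>Twice each distance is at most \<open>r\<close>, and not both are equal to
  \<open>r\<close>. By parity the sum of the two distances is then at most \<open>r - 1\<close>,
  which leaves room for the edge.\<close>

lemma ball_joinsD:
  assumes "wf_digraph H" "joins (ball_graph (half r) H v) e y z" "geod H v p y" "geod H v q z"
  shows "enat (length p + 1 + length q) \<le> r"
proof -
  have *: "enat (2 * length p) \<le> r" "enat (2 * length q) \<le> r"
    using assms(2)[unfolded arcs_ball verts_ball[OF assms(1)]] assms(3,4) unfolding geod_def
    by (meson enat_ord_simps(1) mult_le_mono2 order_trans)+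
  have "\<not> (enat (2 * length p) = r \<and> enat (2 * length q) = r)"
    using assms(2)[unfolded arcs_ball] gdist_geod[OF assms(1,3)] gdist_geod[OF assms(1,4)] eq_half by metis
  then show ?thesis using * by (cases r) auto
qed

section \<open>Walks in subdivisions\<close>

text \<open>With both ends of \<open>e\<close> included, the piece \<open>(e, k)\<close> joins the
  points at \<open>k\<close> and \<open>Suc k\<close> in all cases.\<close>

definition epos :: "('a, 'b) lgraph \<Rightarrow> 'b \<Rightarrow> nat \<Rightarrow> ('a, 'b) point" where
  "epos G e k = (if k = 0 then Node (tail G e) else if k = len G e then Node (head G e) else Inner e k)"

lemma subdivide_simps:
  "arcs (subdivide G) = {(e, k). e \<in> arcs G \<and> k < len G e}"
  "k < len G e \<Longrightarrow> tail (subdivide G) (e, k) = epos G e k"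
  "k < len G e \<Longrightarrow> head (subdivide G) (e, k) = epos G e (Suc k)"
  by (auto simp: subdivide_def epos_def)

lemma verts_subdivide:
  "Node x \<in> verts (subdivide G) \<longleftrightarrow> x \<in> verts G"
  "Inner e k \<in> verts (subdivide G) \<longleftrightarrow> e \<in> arcs G \<and> 0 < k \<and> k < len G e"
  by (auto simp: subdivide_def)

lemma joins_subdivide:
  "joins (subdivide G) (e, k) P Q \<longleftrightarrow> e \<in> arcs G \<and> k < len G e \<and>
    (P = epos G e k \<and> Q = epos G e (Suc k) \<or> P = epos G e (Suc k) \<and> Q = epos G e k)"
  by (auto simp: joins_def subdivide_simps)

lemma epos_Inner: "epos G e k = Inner f i \<longleftrightarrow> e = f \<and> i = k \<and> 0 < k \<and> k \<noteq> len G e"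
  "Inner f i = epos G e k \<longleftrightarrow> e = f \<and> i = k \<and> 0 < k \<and> k \<noteq> len G e"
  by (auto simp: epos_def)

lemma epos_Node: "epos G e k = Node x \<longleftrightarrow> k = 0 \<and> x = tail G e \<or> 0 < k \<and> k = len G e \<and> x = head G e"
  "Node x = epos G e k \<longleftrightarrow> k = 0 \<and> x = tail G e \<or> 0 < k \<and> k = len G e \<and> x = head G e"
  by (auto simp: epos_def)

lemma epos_verts: "is_lgraph G \<Longrightarrow> e \<in> arcs G \<Longrightarrow> k \<le> len G e \<Longrightarrow> epos G e k \<in> verts (subdivide G)"
  using is_lgraphD(3,4)[of G e] by (auto simp: epos_def verts_subdivide)

definition anch :: "('a, 'b) lgraph \<Rightarrow> ('a, 'b) point \<Rightarrow> 'a \<Rightarrow> nat \<Rightarrow> bool" where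
  "anch G P z o' \<longleftrightarrow> P = Node z \<and> o' = 0 \<or>
    (\<exists>e k. P = Inner e k \<and> e \<in> arcs G \<and> 0 < k \<and> k < len G e \<and>
       (z = tail G e \<and> o' = k \<or> z = head G e \<and> o' = len G e - k))"

text \<open>An inner point is anchored at either end of its edge, at the cost of its distance along
  the edge, and a node is anchored at itself. The induction adds one step in front: it moves along
  an edge, or it completes a passage of the edge, which is then added to \<open>es\<close>. A walk
  that stays inside one edge reaches no anchor and is listed separately.\<close>

lemma contract:
  assumes "is_lgraph G" "wk (subdivide G) (Node ` X) P ps Q"
  shows "(\<exists>e i j. P = Inner e i \<and> Q = Inner e j \<and> i \<le> j + length ps \<and> j \<le> i + length ps) \<or>
    (\<exists>z o1 z' o2 es. anch G P z o1 \<and> anch G Q z' o2 \<and> wk G X z es z' \<and> o1 + wt G es + o2 \<le> length ps)"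
  using assms(2)
proof (induction rule: wk.induct)
  case (Nil P)
  show ?case
  proof (cases P)
    case (Node x)
    then have "wk G X x [] x" using Nil by (auto simp: wk_Nil_iff verts_subdivide)
    then show ?thesis using Node by (intro disjI2 exI[of _ x] exI[of _ 0] exI[of _ "[]"]) (auto simp: anch_def)
  qed auto
next
  case (Cons p P P1 ps Q)
  obtain e k where p: "p = (e, k)" by (cases p)
  have e: "e \<in> arcs G" "k < len G e"
    and PP: "P = epos G e k \<and> P1 = epos G e (Suc k) \<or> P = epos G e (Suc k) \<and> P1 = epos G e k"
    using Cons(1) by (auto simp: p joins_subdivide)
  have Pv: "y \<in> verts G" "y \<notin> X" if "P = Node y" for y
    using Cons(2,3) that by (auto simp: verts_subdivide)
  from Cons.IH show ?case
  proof (elim disjE exE conjE)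
    fix f i j
    assume *: "P1 = Inner f i" "Q = Inner f j" "i \<le> j + length ps" "j \<le> i + length ps"
    have f: "f = e" "i = k \<or> i = Suc k" "0 < i" "i < len G e" using PP * e by (auto simp: epos_Inner)
    have Q: "0 < j" "j < len G e" using wk_ends[OF Cons(4)] *(2) f(1) by (auto simp: verts_subdivide)
    show ?thesis
    proof (cases P)
      case (Inner g l)
      then have "g = e" "l = k \<or> l = Suc k" using PP e by (auto simp: epos_Inner)
      then show ?thesis using * f Inner by auto
    next
      case (Node y)
      then have y: "i = 1 \<and> y = tail G e \<or> Suc i = len G e \<and> y = head G e"
        using PP * f e by (auto simp: epos_Inner epos_Node)
      have wk: "wk G X y [] y" using Pv[OF Node] by (simp add: wk_Nil_iff)
      from y show ?thesis
      proof
        assume "i = 1 \<and> y = tail G e"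
        then have "anch G Q y j" "j \<le> length (p # ps)" using * f Q e by (auto simp: anch_def)
        then show ?thesis using wk Node by (intro disjI2 exI[of _ y] exI[of _ 0] exI[of _ j] exI[of _ "[]"]) (auto simp: anch_def)
      next
        assume "Suc i = len G e \<and> y = head G e"
        then have "anch G Q y (len G e - j)" "len G e - j \<le> length (p # ps)" using * f Q e by (auto simp: anch_def)
        then show ?thesis using wk Node by (intro disjI2 exI[of _ y] exI[of _ 0] exI[of _ "len G e - j"] exI[of _ "[]"]) (auto simp: anch_def)
      qed
    qed
  next
    fix z o1 z' o2 es
    assume *: "anch G P1 z o1" "anch G Q z' o2" "wk G X z es z'" "o1 + wt G es + o2 \<le> length ps"
    have far: ?thesis if "anch G P y 0" "joins G e y z" "y \<in> verts G" "y \<notin> X" "len G e \<le> Suc o1" for y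
      using that * by (intro disjI2 exI[of _ y] exI[of _ 0] exI[of _ z'] exI[of _ o2] exI[of _ "e # es"])
        (auto intro: wk.Cons)
    have near: ?thesis if "anch G P z o1'" "o1' \<le> Suc o1" for o1'
      using that * by (intro disjI2 exI[of _ z] exI[of _ o1'] exI[of _ z'] exI[of _ o2] exI[of _ "es"]) auto
    show ?thesis
    proof (cases P)
      case (Inner f i)
      then have f: "f = e" "i = k \<or> i = Suc k" "0 < i" "i < len G e" using PP e by (auto simp: epos_Inner)
      show ?thesis
      proof (cases P1)
        case (Node u)
        then have u: "i = 1 \<and> u = tail G e \<or> Suc i = len G e \<and> u = head G e" "z = u"
          using PP Inner * f e by (auto simp: epos_Inner epos_Node anch_def)
        then have "anch G P z 1" using Inner f e by (auto simp: anch_def)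
        then show ?thesis using near by simp
      next
        case P1: (Inner g j)
        have g: "g = e" "j = k \<or> j = Suc k" "i \<le> Suc j" "j \<le> Suc i"
          using PP P1 Inner f e by (auto simp: epos_Inner)
        have "z = tail G e \<and> o1 = j \<or> z = head G e \<and> o1 = len G e - j"
          using *(1) P1 g by (auto simp: anch_def)
        then show ?thesis
        proof
          assume "z = tail G e \<and> o1 = j"
          then show ?thesis using near[of i] Inner f g e by (auto simp: anch_def)
        next
          assume "z = head G e \<and> o1 = len G e - j"
          then show ?thesis using near[of "len G e - i"] Inner f g e by (auto simp: anch_def)
        qed
      qed
    next
      case (Node y)
      have aP: "anch G P y 0" using Node by (simp add: anch_def)
      show ?thesis
      proof (cases P1)
        case P1: (Node u)
        have "len G e = 1" "joins G e y u" "z = u"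
          using PP e Node P1 *(1) by (auto simp: epos_Node anch_def joins_def)
        then show ?thesis using far[OF aP] Pv[OF Node] by auto
      next
        case P1: (Inner g j)
        have g: "g = e" "j = 1 \<and> y = tail G e \<or> Suc j = len G e \<and> y = head G e"
          using PP P1 Node e by (auto simp: epos_Inner epos_Node)
        have z: "z = tail G e \<and> o1 = j \<or> z = head G e \<and> o1 = len G e - j"
          using *(1) P1 g by (auto simp: anch_def)
        show ?thesis
        proof (cases "z = y")
          case True
          then show ?thesis using near[of 0] aP by simp
        next
          case False
          then have "joins G e y z" "len G e \<le> Suc o1" using g z e by (auto simp: joins_def)
          then show ?thesis using far[OF aP] Pv[OF Node] by auto
        qed
      qed
    qed
  qed
qed

lemma contract_Nodes:
  assumes "is_lgraph G" "wk (subdivide G) (Node ` X) (Node x) ps (Node y)"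
  obtains es where "wk G X x es y" "wt G es \<le> length ps"
  using contract[OF assms] that by (auto simp: anch_def)

lemma piece_walk:
  assumes "is_lgraph G" "e \<in> arcs G" "i \<le> j" "j \<le> len G e" "\<And>l. i \<le> l \<Longrightarrow> l \<le> j \<Longrightarrow> epos G e l \<notin> Y"
  shows "\<exists>ps. wk (subdivide G) Y (epos G e i) ps (epos G e j) \<and> length ps = j - i"
  using assms(3-)
proof (induction j rule: dec_induct)
  case base
  then show ?case using epos_verts[OF assms(1,2)] by (intro exI[of _ "[]"]) (auto simp: wk_Nil_iff)
next
  case (step j)
  then obtain ps where ps: "wk (subdivide G) Y (epos G e i) ps (epos G e j)" "length ps = j - i" by auto
  have "wk (subdivide G) Y (epos G e i) (ps @ [(e, j)]) (epos G e (Suc j))"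
    by (rule wk_snoc[OF ps(1)]) (use step assms epos_verts[OF assms(1,2)] in \<open>auto simp: joins_subdivide\<close>)
  then show ?case using ps(2) step by (intro exI[of _ "ps @ [(e, j)]"]) auto
qed

text \<open>The neighbour of \<open>Node x\<close> on \<open>e\<close> in the subdivision; it is the
  other end of \<open>e\<close> if \<open>e\<close> has length one.\<close>

definition pt :: "('a, 'b) lgraph \<Rightarrow> 'b \<Rightarrow> 'a \<Rightarrow> ('a, 'b) point" where
  "pt G e x = (if tail G e = x then epos G e 1 else epos G e (len G e - 1))"

definition piece :: "('a, 'b) lgraph \<Rightarrow> 'b \<Rightarrow> 'a \<Rightarrow> 'b \<times> nat" where
  "piece G e x = (e, if tail G e = x then 0 else len G e - 1)"

lemma joins_piece:
  assumes "is_lgraph G" "inc G e x"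
  shows "joins (subdivide G) (piece G e x) (Node x) (pt G e x)"
proof -
  have "0 < len G e" using is_lgraphD(6)[OF assms(1)] assms(2) by (auto simp: inc_def)
  then show ?thesis using assms(2) by (auto simp: piece_def pt_def joins_subdivide inc_def epos_def)
qed

lemma pt_anch:
  assumes "is_lgraph G" "inc G e x" "anch G (pt G e x) z o'" "z \<noteq> x"
  shows "joins G e x z" "Suc o' = len G e"
proof -
  have "0 < len G e" using is_lgraphD(6)[OF assms(1)] assms(2) by (auto simp: inc_def)
  moreover have "tail G e \<noteq> head G e" using is_lgraphD(5)[OF assms(1)] assms(2) by (auto simp: inc_def)
  ultimately show "joins G e x z" "Suc o' = len G e"
    using assms(2-) by (auto simp: pt_def anch_def inc_def joins_def epos_Inner epos_Node split: if_splits)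
qed

lemma pt_Inner: "pt G e x = Inner f k \<Longrightarrow> f = e"
  by (auto simp: pt_def epos_Inner split: if_splits)

lemma edge_walk:
  assumes "is_lgraph G" "joins G e x y" "Node y \<notin> Y" "\<And>k. Inner e k \<notin> Y"
  shows "\<exists>ps. wk (subdivide G) Y (pt G e x) ps (Node y) \<and> Suc (length ps) = len G e"
proof -
  have e: "e \<in> arcs G" "0 < len G e" "tail G e \<noteq> head G e"
    using is_lgraphD(5,6)[OF assms(1)] joins_arc[OF assms(2)] by auto
  consider "tail G e = x" "head G e = y" | "head G e = x" "tail G e = y"
    using assms(2) by (auto simp: joins_def)
  then show ?thesis
  proof cases
    case 1
    have "epos G e l \<notin> Y" if "1 \<le> l" for l using that assms(3,4) 1 by (auto simp: epos_def)
    then have "\<exists>ps. wk (subdivide G) Y (epos G e 1) ps (epos G e (len G e)) \<and> length ps = len G e - 1"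
      by (intro piece_walk[OF assms(1) e(1)]) (use e in auto)
    moreover have "epos G e (len G e) = Node y" "pt G e x = epos G e 1" using 1 e by (auto simp: epos_def pt_def)
    ultimately show ?thesis using e by fastforce
  next
    case 2
    have "epos G e l \<notin> Y" if "l \<le> len G e - 1" for l using that assms(3,4) 2 e by (auto simp: epos_def)
    then have "\<exists>ps. wk (subdivide G) Y (epos G e 0) ps (epos G e (len G e - 1)) \<and> length ps = len G e - 1 - 0"
      by (intro piece_walk[OF assms(1) e(1)]) (use e in auto)
    then obtain ps where ps: "wk (subdivide G) Y (epos G e 0) ps (epos G e (len G e - 1))" "length ps = len G e - 1"
      by auto
    moreover have "epos G e 0 = Node y" "pt G e x = epos G e (len G e - 1)" using 2 e by (auto simp: epos_def pt_def)
    ultimately show ?thesis using e wk_rev[OF ps(1)] by (intro exI[of _ "rev ps"]) auto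
  qed
qed

lemma expand:
  assumes "is_lgraph G" "wk G X x es y" "\<And>z. Node z \<in> Y \<Longrightarrow> z \<in> X"
    "\<And>e k. e \<in> set es \<Longrightarrow> Inner e k \<notin> Y"
  shows "\<exists>ps. wk (subdivide G) Y (Node x) ps (Node y) \<and> length ps = wt G es"
  using assms(2-)
proof (induction rule: wk.induct)
  case (Nil x)
  then show ?case by (intro exI[of _ "[]"]) (auto simp: wk_Nil_iff verts_subdivide)
next
  case (Cons e x z es y)
  then obtain ps where ps: "wk (subdivide G) Y (Node z) ps (Node y)" "length ps = wt G es" by auto
  have "Node z \<notin> Y" "\<And>k. Inner e k \<notin> Y" using Cons wk_ends[OF ps(1)] by auto
  with edge_walk[OF assms(1) Cons(1)] obtain qs where
    qs: "wk (subdivide G) Y (pt G e x) qs (Node z)" "Suc (length qs) = len G e" by blast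
  have "inc G e x" using Cons(1) by (auto simp: inc_joins)
  then have "wk (subdivide G) Y (Node x) (piece G e x # qs) (Node z)"
    using joins_piece[OF assms(1)] qs Cons by (intro wk.Cons) (auto simp: verts_subdivide)
  from wk_append[OF this ps(1)] show ?case using qs ps by (intro exI[of _ "(piece G e x # qs) @ ps"]) auto
qed

text \<open>The walk starts and ends one step inside the segment, so its first and last pieces are
  missing; they account for the 2.\<close>

lemma expand_seg:
  assumes "is_lgraph G" "joins G e s x" "wk G X x ms y" "joins G f y t"
    "\<And>z. Node z \<in> Y \<Longrightarrow> z \<in> X" "\<And>g k. g \<in> set (e # ms @ [f]) \<Longrightarrow> Inner g k \<notin> Y"
  shows "\<exists>ps. wk (subdivide G) Y (pt G e s) ps (pt G f t) \<and> length ps + 2 = wt G (e # ms @ [f])"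
proof -
  obtain ps where ps: "wk (subdivide G) Y (Node x) ps (Node y)" "length ps = wt G ms"
    using expand[OF assms(1,3), of Y] assms(5,6) by auto
  have N: "Node x \<notin> Y" "Node y \<notin> Y" using wk_ends[OF ps(1)] by auto
  obtain qs where qs: "wk (subdivide G) Y (pt G e s) qs (Node x)" "Suc (length qs) = len G e"
    using edge_walk[OF assms(1,2) N(1)] assms(6) by auto
  obtain us where us: "wk (subdivide G) Y (pt G f t) us (Node y)" "Suc (length us) = len G f"
    using edge_walk[OF assms(1) joins_symD[OF assms(4)] N(2)] assms(6) by auto
  show ?thesis
    using wk_append[OF qs(1) wk_append[OF ps(1) wk_rev[OF us(1)]]] ps qs us
    by (intro exI[of _ "qs @ ps @ rev us"]) auto
qed

lemma ldist_cases:
  assumes "is_lgraph G"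
  shows "(\<exists>es. wk G {} u es v \<and> ldist G u v = ereal (wt G es) \<and> (\<forall>fs. wk G {} u fs v \<longrightarrow> wt G es \<le> wt G fs)) \<or>
    ldist G u v = \<infinity> \<and> (\<nexists>es. wk G {} u es v)"
proof -
  have ex: "\<exists>ps. wk (subdivide G) {} (Node u) ps (Node v) \<and> length ps = wt G es" if "wk G {} u es v" for es
    by (rule expand[OF assms that]) auto
  from gdist_cases[OF wf_subdivide[OF assms], of "Node u" "Node v"] show ?thesis
  proof (elim disjE exE conjE)
    fix ps assume ps: "geod (subdivide G) (Node u) ps (Node v)"
      "gdist (subdivide G) (Node u) (Node v) = ereal (length ps)"
    have "wk (subdivide G) (Node ` {}) (Node u) ps (Node v)" using ps(1) by (simp add: geod_def)
    from contract_Nodes[OF assms this] obtain es where es: "wk G {} u es v" "wt G es \<le> length ps" .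
    have min: "length ps \<le> wt G fs" if "wk G {} u fs v" for fs
      using ex[OF that] ps(1) by (auto simp: geod_def)
    have "wt G es = length ps" using min[OF es(1)] es(2) by simp
    then show ?thesis using es min ps(2) by (auto simp: ldist_def)
  next
    assume "gdist (subdivide G) (Node u) (Node v) = \<infinity>" "\<nexists>es. wk (subdivide G) {} (Node u) es (Node v)"
    then show ?thesis using ex by (auto simp: ldist_def)
  qed
qed

lemma ldist_eqI:
  assumes "is_lgraph G" "wk G {} u es v" "\<And>fs. wk G {} u fs v \<Longrightarrow> wt G es \<le> wt G fs"
  shows "ldist G u v = ereal (wt G es)"
  using ldist_cases[OF assms(1), of u v]
proof (elim disjE exE conjE)
  fix es' assume "wk G {} u es' v" "ldist G u v = ereal (wt G es')" "\<forall>fs. wk G {} u fs v \<longrightarrow> wt G es' \<le> wt G fs"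
  then show ?thesis using assms(2,3) by (metis le_antisym)
qed (use assms in auto)

section \<open>Local cutvertices\<close>

lemma del_vert_simps: "joins (pre_digraph.del_vert B x) e y z \<longleftrightarrow> joins B e y z \<and> y \<noteq> x \<and> z \<noteq> x"
  "verts (pre_digraph.del_vert B x) = verts B - {x}"
  by (auto simp: joins_def pre_digraph.del_vert_def)

lemma wf_del_vert: "wf_digraph B \<Longrightarrow> wf_digraph (pre_digraph.del_vert B x)"
  by (auto simp: wf_digraph_def pre_digraph.del_vert_def)

lemma local_cutvertex_iff:
  assumes "is_lgraph G" "v \<in> verts G"
  shows "local_cutvertex r G v \<longleftrightarrow>
    (\<exists>P. P \<noteq> Node v \<and> P \<in> verts (ball_graph (half r) (subdivide G) (Node v))) \<and>
    \<not> conn (pre_digraph.del_vert (ball_graph (half r) (subdivide G) (Node v)) (Node v))"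
  using assms(2) disconnected_iff[OF wf_del_vert[OF wf_ball[OF wf_subdivide[OF assms(1)]]]]
  unfolding local_cutvertex_def by (auto simp: del_vert_simps)

lemma piece_of_joins:
  assumes "is_lgraph G" "joins (subdivide G) p (Node v) P"
  shows "\<exists>e. inc G e v \<and> P = pt G e v \<and> p = piece G e v"
proof -
  obtain e k where p: "p = (e, k)" by (cases p)
  have e: "e \<in> arcs G" "k < len G e" using assms(2) by (auto simp: p joins_subdivide)
  then have ne: "tail G e \<noteq> head G e" using is_lgraphD(5)[OF assms(1)] by blast
  have "k = 0 \<and> v = tail G e \<and> P = epos G e (Suc k) \<or> Suc k = len G e \<and> v = head G e \<and> P = epos G e k"
    using assms(2) e unfolding p joins_subdivide by (auto simp: epos_Node)
  then have "inc G e v \<and> P = pt G e v \<and> p = piece G e v"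
  proof
    assume "k = 0 \<and> v = tail G e \<and> P = epos G e (Suc k)"
    then show ?thesis using e by (simp add: p inc_def pt_def piece_def)
  next
    assume *: "Suc k = len G e \<and> v = head G e \<and> P = epos G e k"
    then have "len G e - 1 = k" by arith
    then show ?thesis using e ne * by (simp add: p inc_def pt_def piece_def)
  qed
  then show ?thesis by blast
qed

lemma arcs_ball_verts:
  "joins (ball_graph \<rho> H v) e y z \<Longrightarrow> y \<in> verts (ball_graph \<rho> H v) \<and> z \<in> verts (ball_graph \<rho> H v)"
  "joins (ball_graph \<rho> H v) e y z \<Longrightarrow> joins H e y z"
  by (auto simp: joins_def ball_graph_def Let_def)

text \<open>A colouring that splits the punctured ball induces a set of edges at \<open>v\<close>,
  by the colours of the neighbours of \<open>v\<close>. The set is invariant, because short closed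
  walks run inside the ball, and it is not trivial, because each point of the ball has the colour of
  the first point on a shortest path to it.\<close>

lemma linked_not_cut:
  assumes "is_lgraph G" "v \<in> verts G" "linked_at r G v"
  shows "\<not> local_cutvertex r G v"
proof
  let ?S = "subdivide G"
  let ?B = "ball_graph (half r) ?S (Node v)"
  let ?D = "pre_digraph.del_vert ?B (Node v)"
  note wf = wf_subdivide[OF assms(1)]
  assume "local_cutvertex r G v"
  then have "\<not> conn ?D" "verts ?D \<noteq> {}"
    using local_cutvertex_iff[OF assms(1,2)] by (auto simp: del_vert_simps)
  then obtain f P Q where f: "\<And>e x y. x \<in> verts ?D \<Longrightarrow> y \<in> verts ?D \<Longrightarrow> joins ?D e x y \<Longrightarrow> f x = f y"
    and PQ: "P \<in> verts ?D" "Q \<in> verts ?D" "f P" "\<not> f Q" by (rule not_conn_coloring) blast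
  have fB: "f x = f y" if "joins ?B e x y" "x \<noteq> Node v" "y \<noteq> Node v" for e x y
    using f[of x y e] that arcs_ball_verts[OF that(1)] by (simp add: del_vert_simps)
  have edge: "\<exists>e. inc G e v \<and> f P = f (pt G e v)" if P: "P \<in> verts ?D" for P
  proof -
    obtain es0 where es0: "wk ?S {} (Node v) es0 P" "enat (2 * length es0) \<le> r"
      using P verts_ball[OF wf] by (auto simp: del_vert_simps)
    obtain es where es: "geod ?S (Node v) es P" "length es \<le> length es0" using ex_geod[OF es0(1)] .
    have le: "enat (2 * length es) \<le> r" using es(2) es0(2) by (meson enat_ord_simps(1) mult_le_mono2 order_trans)
    have "Node v \<noteq> P" using P by (auto simp: del_vert_simps)
    from geod_step[OF es(1) this] obtain p X es' where
      1: "es = p # es'" "joins ?S p (Node v) X" "wk ?S {Node v} X es' P" .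
    obtain e where e: "inc G e v" "X = pt G e v" using piece_of_joins[OF assms(1) 1(2)] by blast
    have wk1: "wk ?S {} (Node v) [p] X"
      using 1 assms(2) wk_ends[OF 1(3)] by (intro wk_single) (auto simp: verts_subdivide)
    have "f X = f P"
      by (rule ball_const[OF wf _ 1(3) wk1 wk_rev])
        (use fB es(1) le 1(1) in \<open>auto simp: geod_def mult_2\<close>)
    then show ?thesis using e by auto
  qed
  define A where "A = {e. f (pt G e v)}"
  have "e \<in> A \<longleftrightarrow> e' \<in> A" if sh: "short r G v e e'" for e e'
  proof -
    obtain x y es where *: "joins G e v x" "wk G {v} x es y" "joins G e' y v"
      "enat (len G e + wt G es + len G e') \<le> r" using sh unfolding short_def by blast
    obtain ps where ps: "wk ?S {Node v} (pt G e v) ps (pt G e' v)" "length ps + 2 = wt G (e # es @ [e'])"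
      using expand_seg[OF assms(1) *(1-3), of "{Node v}"] by auto
    have inc: "inc G e v" "inc G e' v" using *(1) joins_symD[OF *(3)] by (auto simp: inc_joins)
    note j = joins_piece[OF assms(1) inc(1)] joins_piece[OF assms(1) inc(2)]
    have vS: "Node v \<in> verts ?S" using assms(2) by (simp add: verts_subdivide)
    have len: "enat (length ps + 2) \<le> r" using *(4) ps(2) by (simp add: ac_simps)
    have "wk ?S {} (Node v) [piece G e v] (pt G e v)" "wk ?S {} (pt G e' v) [piece G e' v] (Node v)"
      using j(1) joins_symD[OF j(2)] vS wk_ends[OF ps(1)] by (auto intro: wk_single)
    from ball_const[OF wf _ ps(1) this, of r f] have "f (pt G e v) = f (pt G e' v)"
      using fB len by auto
    then show ?thesis by (simp add: A_def)
  qed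
  then have "e \<in> A \<longleftrightarrow> e' \<in> A" if "inc G e v" "inc G e' v" for e e'
    using linked_atD[OF assms(3) _ that] by blast
  then show False using edge[OF PQ(1)] edge[OF PQ(2)] PQ(3,4) by (auto simp: A_def)
qed

text \<open>An invariant set of edges colours the punctured ball: a point gets the colour of the
  first edge of a shortest path from \<open>v\<close> to it. With \<open>2 \<le> r\<close> the
  neighbours of \<open>v\<close> lie in the ball, so connectedness makes all edges at
  \<open>v\<close> agree.\<close>

lemma not_cut_linked:
  assumes "is_lgraph G" "v \<in> verts G" "\<not> local_cutvertex r G v" "enat 2 \<le> r"
  shows "linked_at r G v"
  unfolding linked_at_def
proof (intro allI impI)
  fix A e1 e2
  assume A: "\<forall>e f. short r G v e f \<longrightarrow> (e \<in> A) = (f \<in> A)" and inc: "inc G e1 v" "inc G e2 v"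
  let ?S = "subdivide G"
  let ?B = "ball_graph (half r) ?S (Node v)"
  let ?D = "pre_digraph.del_vert ?B (Node v)"
  note wf = wf_subdivide[OF assms(1)]
  have vS: "Node v \<in> verts ?S" using assms(2) by (simp add: verts_subdivide)
  have ptne: "pt G e v \<noteq> Node v" "pt G e v \<in> verts ?S" if "inc G e v" for e
  proof -
    have "e \<in> arcs G" "0 < len G e" "tail G e \<noteq> head G e" using that is_lgraphD(5,6)[OF assms(1)] by (auto simp: inc_def)
    then show "pt G e v \<noteq> Node v" "pt G e v \<in> verts ?S"
      using epos_verts[OF assms(1), of e] by (auto simp: pt_def epos_Node)
  qed
  have key: "e \<in> A \<longleftrightarrow> e' \<in> A"
    if "inc G e v" "inc G e' v" "wk ?S {Node v} (pt G e v) ps (pt G e' v)" "enat (length ps + 2) \<le> r" for e e' ps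
  proof -
    have "wk ?S (Node ` {v}) (pt G e v) ps (pt G e' v)" using that(3) by simp
    from contract[OF assms(1) this] show ?thesis
    proof (elim disjE exE conjE)
      fix g i j assume "pt G e v = Inner g i" "pt G e' v = Inner g j"
      then show ?thesis using pt_Inner by metis
    next
      fix z o1 z' o2 es
      assume *: "anch G (pt G e v) z o1" "anch G (pt G e' v) z' o2" "wk G {v} z es z'" "o1 + wt G es + o2 \<le> length ps"
      have "z \<noteq> v" "z' \<noteq> v" using wk_ends[OF *(3)] by auto
      note p = pt_anch[OF assms(1) that(1) *(1) this(1)] and p' = pt_anch[OF assms(1) that(2) *(2) this(2)]
      have "len G e + wt G es + len G e' \<le> length ps + 2" using p(2) p'(2) *(4) by simp
      then have "enat (len G e + wt G es + len G e') \<le> r" using that(4) by (meson enat_ord_simps(1) order_trans)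
      then have "short r G v e e'"
        unfolding short_def using p(1) joins_symD[OF p'(1)] *(3) by blast
      then show ?thesis using A by blast
    qed
  qed
  \<comment> \<open>A shortest path from \<open>v\<close> to \<open>P\<close> with its first piece
    split off, which lies on the edge \<open>e\<close>.\<close>
  define g where "g P es e \<longleftrightarrow> inc G e v \<and> geod ?S (Node v) (piece G e v # es) P \<and> wk ?S {Node v} (pt G e v) es P" for P es e
  have ex_g: "\<exists>es e. g P es e" if P: "P \<in> verts ?D" for P
  proof -
    obtain es0 where es0: "wk ?S {} (Node v) es0 P"
      using P verts_ball[OF wf] by (auto simp: del_vert_simps)
    obtain es where es: "geod ?S (Node v) es P" using ex_geod[OF es0(1)] .
    have "Node v \<noteq> P" using P by (auto simp: del_vert_simps)
    from geod_step[OF es(1) this] obtain p X es' where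
      1: "es = p # es'" "joins ?S p (Node v) X" "wk ?S {Node v} X es' P" .
    then show ?thesis using piece_of_joins[OF assms(1) 1(2)] es unfolding g_def by blast
  qed
  define c where "c P \<longleftrightarrow> (\<exists>es e. g P es e \<and> e \<in> A)" for P
  have adj: "e \<in> A \<longleftrightarrow> e' \<in> A" if "joins ?D q P P'" "g P es e" "g P' es' e'" for P P' q es es' e e'
  proof -
    have j: "joins ?B q P P'" "joins ?S q P P'" using that(1) arcs_ball_verts(2) by (auto simp: del_vert_simps)
    have "wk ?S {Node v} (pt G e v) (es @ q # rev es') (pt G e' v)"
      using that(2,3) j(2) wk_ends[of ?S "{Node v}" _ es P] unfolding g_def
      by (intro wk_append[of ?S _ _ es P] wk.Cons[of ?S q P P'] wk_rev) auto
    moreover have "enat (length (piece G e v # es) + 1 + length (piece G e' v # es')) \<le> r"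
      using ball_joinsD[OF wf j(1)] that(2,3) unfolding g_def by blast
    then have "enat (length (es @ q # rev es') + 2) \<le> r" by (simp add: ac_simps)
    ultimately show ?thesis using key that(2,3) unfolding g_def by blast
  qed
  \<comment> \<open>Two shortest paths to one point of the ball close up to a walk of length at most
    \<open>r\<close>, so the colour does not depend on the path.\<close>
  have same: "e \<in> A \<longleftrightarrow> e' \<in> A" if P: "P \<in> verts ?D" and "g P es e" "g P es' e'" for P es es' e e'
  proof -
    have "wk ?S {Node v} (pt G e v) (es @ rev es') (pt G e' v)"
      using that(2,3) unfolding g_def by (intro wk_append[of ?S _ _ es P] wk_rev) auto
    moreover have "enat (length (es @ rev es') + 2) \<le> r"
    proof -
      obtain fs where fs: "wk ?S {} (Node v) fs P" "enat (2 * length fs) \<le> r"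
        using P verts_ball[OF wf] by (auto simp: del_vert_simps)
      have "length (piece G e v # es) \<le> length fs" "length (piece G e' v # es') \<le> length fs"
        using that(2,3) fs(1) unfolding g_def geod_def by blast+
      then have "length (es @ rev es') + 2 \<le> 2 * length fs" by simp
      then show ?thesis using fs(2) by (meson enat_ord_simps(1) order_trans)
    qed
    ultimately show ?thesis using key that(2,3) unfolding g_def by blast
  qed
  have c_g: "c P \<longleftrightarrow> e \<in> A" if "P \<in> verts ?D" "g P es e" for P es e
    using same[OF that(1)] that(2) unfolding c_def by blast
  have ptD: "pt G e v \<in> verts ?D" "g (pt G e v) [] e" if e: "inc G e v" for e
  proof -
    have wk: "wk ?S {} (Node v) [piece G e v] (pt G e v)"
      using joins_piece[OF assms(1) e] ptne[OF e] vS by (intro wk_single) auto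
    then show "pt G e v \<in> verts ?D"
      using ptne[OF e] assms(4) verts_ball[OF wf] by (auto simp: del_vert_simps intro!: exI[of _ "[piece G e v]"])
    have "fs \<noteq> []" if "wk ?S {} (Node v) fs (pt G e v)" for fs
      using that ptne[OF e] by (auto simp: wk_Nil_iff)
    then have "geod ?S (Node v) [piece G e v] (pt G e v)"
      using wk unfolding geod_def by (auto simp: Suc_le_eq)
    then show "g (pt G e v) [] e" using e ptne[OF e] unfolding g_def by (auto simp: wk_Nil_iff)
  qed
  have "verts ?D \<noteq> {}" using ptD[OF inc(1)] by blast
  then have "conn ?D" using assms(3) local_cutvertex_iff[OF assms(1,2)] by (auto simp: del_vert_simps)
  moreover have "c P = c P'" if "joins ?D q P P'" for q P P'
  proof -
    have j: "joins ?B q P P'" "P \<noteq> Node v" "P' \<noteq> Node v" using that by (auto simp: del_vert_simps)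
    have "P \<in> verts ?D" "P' \<in> verts ?D" using arcs_ball_verts(1)[OF j(1)] j by (auto simp: del_vert_simps)
    then show ?thesis using ex_g adj[OF that] c_g by metis
  qed
  ultimately have "c (pt G e1 v) = c (pt G e2 v)"
    using conn_coloring[of ?D c] ptD inc by blast
  then show "(e1 \<in> A) = (e2 \<in> A)" using c_g ptD inc by blast
qed

section \<open>Cycles\<close>

text \<open>At an inner vertex the walk arrives by one edge and leaves by another; at its base point
  these are the last and the first edge. They coincide only if the walk has length one, which would
  be a loop.\<close>

lemma closed_walk_other_edge:
  assumes "wk H {} u es u" "distinct es" "e \<in> set es" "joins H e P Q" "\<And>f x. \<not> joins H f x x"
  shows "\<exists>f \<in> set es. f \<noteq> e \<and> inc H f P"
proof -
  obtain es1 es2 where es: "es = es1 @ e # es2" using assms(3) by (meson split_list)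
  have ne: "e \<notin> set es1" "e \<notin> set es2" using assms(2) es by auto
  obtain x y where w: "wk H {} u es1 x" "joins H e x y" "wk H {} y es2 u"
    using assms(1) unfolding es wk_append_iff wk_Cons_iff by blast
  have hd2: "\<exists>f \<in> set es2. inc H f z" if "wk H {} z es2 t" "es2 \<noteq> []" for z t
    using that by (cases es2) (auto simp: wk_Cons_iff inc_joins)
  have last1: "\<exists>f \<in> set es1. inc H f z" if "wk H {} s es1 z" "es1 \<noteq> []" for z s
    using wk_rev[OF that(1)] that(2) by (cases "rev es1") (auto simp: wk_Cons_iff inc_joins dest: arg_cong[of _ _ set])
  have "P = x \<and> Q = y \<or> P = y \<and> Q = x" using joins_ends[OF w(2) assms(4)] by auto
  then show ?thesis
  proof
    assume P: "P = x \<and> Q = y"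
    show ?thesis
    proof (cases "es1 = []")
      case False
      then show ?thesis using last1[OF w(1)] P ne es by fastforce
    next
      case True
      then have "u = x" using w(1) by (simp add: wk_Nil_iff)
      moreover have "es2 \<noteq> []" using w(2,3) \<open>u = x\<close> assms(5) by (auto simp: wk_Nil_iff)
      then have "rev es2 \<noteq> []" by simp
      then obtain f fs where f: "rev es2 = f # fs" by (cases "rev es2") auto
      then have "inc H f u" using wk_rev[OF w(3)] by (auto simp: wk_Cons_iff inc_joins)
      moreover have "f \<in> set es2" using arg_cong[OF f, of set] by auto
      ultimately show ?thesis using P ne es by auto
    qed
  next
    assume P: "P = y \<and> Q = x"
    show ?thesis
    proof (cases "es2 = []")
      case False
      then show ?thesis using hd2[OF w(3)] P ne es by fastforce
    next
      case True
      then have "u = y" using w(3) by (simp add: wk_Nil_iff)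
      moreover have "es1 \<noteq> []" using w(1,2) \<open>u = y\<close> assms(5) by (auto simp: wk_Nil_iff)
      then obtain f fs where f: "es1 = f # fs" by (cases es1) auto
      then have "inc H f u" using w(1) by (auto simp: wk_Cons_iff inc_joins)
      ultimately show ?thesis using P ne es f by auto
    qed
  qed
qed

lemma undirected_cycleD:
  assumes "wf_digraph H" "undirected_cycle H p"
  obtains u where "pre_digraph.awalk (bidirect H) u p u" "wk H {} u (map fst p) u" "distinct (map fst p)" "p \<noteq> []"
  using assms(2) wk_of_awalk[OF assms(1), of _ p _ "{}"] unfolding undirected_cycle_def pre_digraph.cycle_def by blast

lemma no_loops_subdivide:
  assumes "is_lgraph G"
  shows "\<not> joins (subdivide G) f x x"
proof (cases f)
  case (Pair e k)
  then show ?thesis using is_lgraphD(5)[OF assms, of e] by (auto simp: joins_subdivide epos_def split: if_splits)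
qed

text \<open>Take the piece of an edge \<open>e\<close> on the cycle that is farthest from the tail.
  The cycle continues at its far end by a different piece, and not by one of \<open>e\<close>; so
  the far end is the head of \<open>e\<close>, and another edge starts there.\<close>

lemma cycle_branches:
  assumes "is_lgraph G" "undirected_cycle (subdivide G) p"
  shows "2 \<le> length p" "\<exists>x e f. x \<in> verts G \<and> e \<noteq> f \<and> inc G e x \<and> inc G f x"
proof -
  let ?S = "subdivide G"
  obtain u where u: "wk ?S {} u (map fst p) u" "distinct (map fst p)" "p \<noteq> []"
    by (rule undirected_cycleD[OF wf_subdivide[OF assms(1)] assms(2)])
  note other = closed_walk_other_edge[OF u(1,2) _ _ no_loops_subdivide[OF assms(1)]]
  obtain e k0 where k0: "(e, k0) \<in> set (map fst p)" using u(3) by (cases p) force+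
  define K where "K = {k. (e, k) \<in> set (map fst p)}"
  have "K \<subseteq> snd ` set (map fst p)" unfolding K_def by force
  from finite_subset[OF this] have K: "finite K" "K \<noteq> {}" using k0 unfolding K_def by auto
  define k where "k = Max K"
  have kK: "(e, k) \<in> set (map fst p)" using Max_in[OF K] unfolding k_def[symmetric] by (simp add: K_def)
  have kmax: "l \<le> k" if "(e, l) \<in> set (map fst p)" for l
    unfolding k_def by (rule Max_ge[OF K(1)]) (use that in \<open>simp add: K_def\<close>)
  have e: "e \<in> arcs G" "k < len G e" using wk_arcs[OF u(1)] kK by (auto simp: subdivide_simps)
  have "joins ?S (e, k) (epos G e (Suc k)) (epos G e k)" using e by (simp add: joins_subdivide)
  from other[OF kK this] obtain f l where f: "(f, l) \<in> set (map fst p)" "(f, l) \<noteq> (e, k)"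
    "inc ?S (f, l) (epos G e (Suc k))" by (metis surj_pair)
  have "1 < card (set (map fst p))"
    using f(1,2) kK by (metis card_le_Suc0_iff_eq finite_set not_le One_nat_def)
  then show "2 \<le> length p" using distinct_card[OF u(2)] by simp
  have fl: "f \<in> arcs G" "l < len G f" "epos G f l = epos G e (Suc k) \<or> epos G f (Suc l) = epos G e (Suc k)"
    using f(3) by (auto simp: inc_joins joins_subdivide)
  show "\<exists>x e f. x \<in> verts G \<and> e \<noteq> f \<and> inc G e x \<and> inc G f x"
  proof (cases "Suc k = len G e")
    case True
    then have N: "epos G e (Suc k) = Node (head G e)" by (simp add: epos_def)
    have "f \<noteq> e"
    proof
      assume "f = e"
      then show False
        using fl(1,2) fl(3)[unfolded N] f(2) True is_lgraphD(5)[OF assms(1) e(1)] by (auto simp: epos_Node)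
    qed
    moreover have "inc G f (head G e)" using fl N by (auto simp: epos_Node inc_def)
    moreover have "inc G e (head G e)" using e by (simp add: inc_def)
    ultimately show ?thesis using is_lgraphD(4)[OF assms(1) e(1)] by blast
  next
    case False
    then have "epos G e (Suc k) = Inner e (Suc k)" using e by (simp add: epos_def)
    with fl(3) have "epos G f l = Inner e (Suc k) \<or> epos G f (Suc l) = Inner e (Suc k)" by simp
    then have "f = e" "l = k \<or> l = Suc k" by (auto simp: epos_Inner)
    then show ?thesis using f kmax[of l] by auto
  qed
qed

lemma apath_distinct_edges:
  assumes "wf_digraph H" "\<And>f x. \<not> joins H f x x" "pre_digraph.apath (bidirect H) x p y"
  shows "distinct (map fst p)"
proof -
  interpret B: wf_digraph "bidirect H" by (rule wf_bidirect[OF assms(1)])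
  show ?thesis using assms(3)
  proof (induction p arbitrary: x)
    case (Cons d p)
    then have d: "d \<in> arcs (bidirect H)" "dtail H d = x" "B.apath (dhead H d) p y"
      "x \<notin> set (dverts H (dhead H d) p)" by (auto simp: B.apath_Cons_iff)
    have "fst d \<notin> set (map fst p)"
    proof
      assume "fst d \<in> set (map fst p)"
      then obtain d' where d': "d' \<in> set p" "fst d' = fst d" by auto
      have aw: "B.awalk (dhead H d) p y" using d(3) by (simp add: B.apath_def)
      then have "d' \<in> arcs (bidirect H)" using d'(1) by (auto simp: B.awalk_def)
      then have "x = dtail H d' \<or> x = dhead H d'"
        using joins_ends[OF joins_dart[OF d(1)], of "dtail H d'" "dhead H d'"] joins_dart d' d(2) by metis
      moreover have "dtail H d' \<in> set (dverts H (dhead H d) p)" "dhead H d' \<in> set (dverts H (dhead H d) p)"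
        using d'(1) B.set_awalk_verts[OF aw] by auto
      ultimately show False using d(4) by auto
    qed
    then show ?case using Cons.IH[OF d(3)] by simp
  qed simp
qed

text \<open>Shortening the walk to a path keeps it off \<open>v\<close>, and closing it at
  \<open>v\<close> repeats no edge because \<open>e\<close> and \<open>f\<close> differ and the path
  contains no edge at \<open>v\<close>.\<close>

lemma ex_undirected_cycle:
  assumes "wf_digraph H" "\<And>f x. \<not> joins H f x x"
    and "wk H {v} x es y" "joins H e v x" "joins H f y v" "e \<noteq> f" "v \<in> verts H"
  shows "\<exists>p. undirected_cycle H p \<and> length p \<le> length es + 2"
proof -
  interpret B: wf_digraph "bidirect H" by (rule wf_bidirect[OF assms(1)])
  obtain p where p: "map fst p = es" "B.awalk x p y" "set (dverts H x p) \<inter> {v} = {}"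
    by (rule awalk_of_wk[OF assms(1,3)])
  define q where "q = B.awalk_to_apath p"
  have q: "B.apath x q y" unfolding q_def by (rule B.apath_awalk_to_apath[OF p(2)])
  have qp: "set q \<subseteq> set p" unfolding q_def by (rule B.awalk_to_apath_subset[OF p(2)])
  have qa: "B.awalk x q y" "distinct (dverts H x q)" using q by (auto simp: B.apath_def)
  have "distinct q" using B.distinct_verts_imp_distinct[OF qa] .
  then have len: "length q \<le> length es"
    using card_mono[OF _ qp] distinct_card[of q] card_length[of p] arg_cong[OF p(1), of length] by simp
  have vq: "v \<notin> set (dverts H x q)"
    using B.set_awalk_verts[OF qa(1)] B.set_awalk_verts[OF p(2)] p(3) qp by auto
  obtain d where d: "fst d = e" "dtail H d = v" "dhead H d = x" "d \<in> arcs (bidirect H)"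
    by (rule dart_of_joins[OF assms(4)])
  obtain d' where d': "fst d' = f" "dtail H d' = y" "dhead H d' = v" "d' \<in> arcs (bidirect H)"
    by (rule dart_of_joins[OF assms(5)])
  have "B.awalk y [d'] v" using d' assms(7) by (simp add: B.awalk_Cons_iff B.awalk_Nil_iff)
  from B.awalk_appendI[OF qa(1) this] have aw2: "B.awalk x (q @ [d']) v" .
  then have aw: "B.awalk v (d # q @ [d']) v"
    using d by (simp add: B.awalk_Cons_iff del: B.awalk_append_iff)
  have "dverts H x (q @ [d']) = dverts H x q @ [v]"
    using B.awalk_verts_append[OF aw2] qa(1) d' by (auto simp: B.awalk_verts_append2)
  then have "distinct (tl (dverts H v (d # q @ [d'])))" using qa(2) vq d by simp
  moreover have "distinct (map fst (d # q @ [d']))"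
  proof -
    have "g \<noteq> e \<and> g \<noteq> f" if "g \<in> set (map fst q)" for g
    proof -
      from that obtain c where c: "c \<in> set q" "fst c = g" by auto
      then have ca: "c \<in> arcs (bidirect H)" using qa(1) by (auto simp: B.awalk_def)
      have "dtail H c \<noteq> v" "dhead H c \<noteq> v" using c(1) vq B.set_awalk_verts[OF qa(1)] by auto
      then show ?thesis using joins_dart[OF ca] c(2) joins_ends[OF assms(4)] joins_ends[OF assms(5)] by metis
    qed
    then show ?thesis using apath_distinct_edges[OF assms(1,2) q] d d' assms(6) by auto
  qed
  ultimately have "undirected_cycle H (d # q @ [d'])"
    unfolding undirected_cycle_def B.cycle_def using aw by blast
  then show ?thesis using len by (intro exI[of _ "d # q @ [d']"]) auto
qed

section \<open>Locally 2-connected graphs\<close>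

lemma joins_underlying [simp]: "joins (underlying G) = joins G"
  and verts_underlying [simp]: "verts (underlying G) = verts G"
  and arcs_underlying [simp]: "arcs (underlying G) = arcs G"
  and tail_underlying [simp]: "tail (underlying G) = tail G"
  and head_underlying [simp]: "head (underlying G) = head G"
  by (auto simp: joins_def pre_digraph.truncate_def fun_eq_iff)

lemma wk_underlying [simp]: "wk (underlying G) X x es y \<longleftrightarrow> wk G X x es y"
  by (auto elim: wk_cong_mono)

lemma connected_underlying: "is_lgraph G \<Longrightarrow> connected (underlying G) \<longleftrightarrow> conn G"
  by (subst connected_iff_conn) (auto simp: is_lgraph_def fin_digraph_def conn_def)

text \<open>Otherwise \<open>{g}\<close> would be invariant, and linkedness would make both
  \<open>e\<close> and \<open>f\<close> equal to \<open>g\<close>.\<close>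

lemma linked_other:
  assumes "linked_at r G v" "inc G e v" "inc G f v" "e \<noteq> f" "inc G g v"
  shows "\<exists>h. h \<noteq> g \<and> short r G v g h"
proof (rule ccontr)
  assume "\<not> ?thesis"
  then have no: "h = g" if "short r G v g h" for h using that by blast
  have inv: "a \<in> {g} \<longleftrightarrow> b \<in> {g}" if "short r G v a b" for a b
    using no[of b] no[of a] that short_sym[OF that] by auto
  show False
    using linked_atD[OF assms(1) inv assms(2,5)] linked_atD[OF assms(1) inv assms(3,5)] assms(4) by simp
qed

lemma short_undirected_cycle:
  assumes "is_lgraph G" "v \<in> verts G" "short r G v e f" "e \<noteq> f"
  shows "\<exists>p. undirected_cycle (subdivide G) p \<and> enat (length p) \<le> r"
proof -
  obtain x y es where *: "joins G e v x" "wk G {v} x es y" "joins G f y v"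
    "enat (len G e + wt G es + len G f) \<le> r" using assms(3) unfolding short_def by blast
  obtain ps where ps: "wk (subdivide G) {Node v} (pt G e v) ps (pt G f v)" "length ps + 2 = wt G (e # es @ [f])"
    using expand_seg[OF assms(1) *(1-3), of "{Node v}"] by auto
  have inc: "inc G e v" "inc G f v" using *(1) joins_symD[OF *(3)] by (auto simp: inc_joins)
  have "piece G e v \<noteq> piece G f v" using assms(4) by (simp add: piece_def)
  moreover have "Node v \<in> verts (subdivide G)" using assms(2) by (simp add: verts_subdivide)
  ultimately obtain p where p: "undirected_cycle (subdivide G) p" "length p \<le> length ps + 2"
    using ex_undirected_cycle[OF wf_subdivide[OF assms(1)] no_loops_subdivide[OF assms(1)] ps(1)
        joins_piece[OF assms(1) inc(1)] joins_symD[OF joins_piece[OF assms(1) inc(2)]]] by blast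
  have "length p \<le> len G e + wt G es + len G f" using p(2) ps(2) by simp
  then have "enat (length p) \<le> r" using *(4) by (meson enat_ord_simps(1) order_trans)
  then show ?thesis using p(1) by blast
qed

lemma loc2_short_cycle:
  assumes "loc2 r G" "verts G \<noteq> {}"
  shows "\<exists>p. undirected_cycle (subdivide G) p \<and> enat (length p) \<le> r"
proof -
  obtain v e f where v: "v \<in> verts G" "inc G e v" "inc G f v" "e \<noteq> f"
    using assms unfolding loc2_def by blast
  then obtain h where "h \<noteq> e" "short r G v e h"
    using linked_other[of r G v e f e] assms(1) unfolding loc2_def by blast
  then show ?thesis using short_undirected_cycle[OF _ v(1), of r e h] assms(1) unfolding loc2_def by blast
qed

text \<open>From a cycle one obtains a single vertex with two edges, and this property spreads along
  edges: a short closed walk that leaves \<open>x\<close> by \<open>g\<close> and returns by another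
  edge must leave the next vertex \<open>z\<close> by an edge other than \<open>g\<close>.\<close>

lemma connected_locally_2_connected_iff:
  "connected_locally_2_connected r G \<longleftrightarrow> loc2 r G \<and> conn G"
proof
  assume "loc2 r G \<and> conn G"
  then have G: "is_lgraph G" "loc2 r G" "conn G" by (auto simp: loc2_def)
  then show "connected_locally_2_connected r G"
    unfolding connected_locally_2_connected_def
    using connected_underlying[OF G(1)] linked_not_cut[OF G(1)] loc2_short_cycle[OF G(2)]
    unfolding loc2_def conn_def by blast
next
  assume *: "connected_locally_2_connected r G"
  then have G: "is_lgraph G" "conn G" using connected_underlying
    by (auto simp: connected_locally_2_connected_def)
  obtain p where p: "undirected_cycle (subdivide G) p" "enat (length p) \<le> r"
    using * unfolding connected_locally_2_connected_def by blast
  note c = cycle_branches[OF G(1) p(1)]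
  have r: "enat 2 \<le> r" using c(1) p(2) by (meson enat_ord_simps(1) order_trans)
  have linked: "linked_at r G v" if "v \<in> verts G" for v
    using not_cut_linked[OF G(1) that _ r] * that unfolding connected_locally_2_connected_def by blast
  obtain x0 e0 f0 where x0: "x0 \<in> verts G" "e0 \<noteq> f0" "inc G e0 x0" "inc G f0 x0" using c(2) by blast
  have "\<exists>e f. e \<noteq> f \<and> inc G e y \<and> inc G f y" if y: "y \<in> verts G" for y
  proof -
    obtain es where "wk G {} x0 es y" using G(2) x0(1) y unfolding conn_def by blast
    then show ?thesis using x0(2-)
    proof (induction arbitrary: e0 f0 rule: wk.induct)
      case (Cons g x z es y)
      have gx: "inc G g x" "inc G g z" using Cons(1) joins_symD[OF Cons(1)] by (auto simp: inc_joins)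
      obtain h where h: "h \<noteq> g" "short r G x g h"
        using linked_other[OF linked[OF Cons(2)] Cons.prems(2,3,1) gx(1)] by blast
      then obtain z' y' fs where *: "joins G g x z'" "wk G {x} z' fs y'" "joins G h y' x"
        unfolding short_def by blast
      have zz: "z' = z" using joins_ends[OF Cons(1) *(1)] joins_verts[OF G(1) Cons(1)] by auto
      have "\<exists>g'. g' \<noteq> g \<and> inc G g' z"
      proof (cases fs)
        case Nil
        then have "joins G h z x" using * zz by (simp add: wk_Nil_iff)
        then show ?thesis using h by (auto simp: inc_joins)
      next
        case (Cons g' gs)
        then obtain z2 where z2: "joins G g' z z2" "wk G {x} z2 gs y'" using *(2) zz by (auto simp: wk_Cons_iff)
        have "z \<noteq> x" "z2 \<noteq> x" using wk_ends[OF *(2)] wk_ends[OF z2(2)] zz by auto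
        then have "g' \<noteq> g" using joins_ends[OF *(1)] z2(1) by metis
        then show ?thesis using z2(1) by (auto simp: inc_joins)
      qed
      then obtain g' where "g' \<noteq> g" "inc G g' z" by blast
      then show ?case using Cons.IH[of g' g] gx(2) by blast
    qed blast
  qed
  then show "loc2 r G \<and> conn G" using linked G unfolding loc2_def by blast
qed

text \<open>At each of its points a cycle already uses all the edges that the degree allows, so it
  cannot be left. By connectedness it is the whole graph.\<close>

lemma cycle_graph_if_degree_2:
  assumes "loc2 r G" "conn G"
    and deg: "\<And>x e f g. inc G e x \<Longrightarrow> inc G f x \<Longrightarrow> inc G g x \<Longrightarrow> e = f \<or> f = g \<or> e = g"
  shows "cycle_graph_upto r G"
proof -
  let ?S = "subdivide G"
  have G: "is_lgraph G" using assms(1) by (simp add: loc2_def)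
  note wf = wf_subdivide[OF G]
  interpret B: wf_digraph "bidirect ?S" by (rule wf_bidirect[OF wf])
  obtain p where p: "undirected_cycle ?S p" "enat (length p) \<le> r"
    using loc2_short_cycle[OF assms(1)] assms(2) unfolding conn_def by blast
  obtain u where u: "B.awalk u p u" "wk ?S {} u (map fst p) u" "distinct (map fst p)" "p \<noteq> []"
    by (rule undirected_cycleD[OF wf p(1)])
  let ?E = "set (map fst p)"
  have deg2: "q1 = q2 \<or> q2 = q3 \<or> q1 = q3" if "inc ?S q1 P" "inc ?S q2 P" "inc ?S q3 P" for q1 q2 q3 P
  proof (cases P)
    case (Node x)
    have "\<exists>e. inc G e x \<and> q = piece G e x" if "inc ?S q P" for q
      using that piece_of_joins[OF G, of q x] unfolding Node inc_joins[of ?S] by blast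
    with that obtain e1 e2 e3 where "inc G e1 x" "inc G e2 x" "inc G e3 x"
      "q1 = piece G e1 x" "q2 = piece G e2 x" "q3 = piece G e3 x" by metis
    then show ?thesis using deg by blast
  next
    case (Inner e k)
    have "q = (e, k) \<or> Suc (snd q) = k \<and> fst q = e" if "inc ?S q P" for q
      using that Inner by (cases q) (auto simp: inc_joins joins_subdivide epos_Inner)
    then show ?thesis using that by (metis nat.inject prod.collapse)
  qed
  \<comment> \<open>The points on the cycle; by \<open>M\<close> below they are closed under
    adjacency.\<close>
  define M where "M = {P. \<exists>q \<in> ?E. inc ?S q P}"
  have M: "q \<in> ?E" if PM: "P \<in> M" and qP: "inc ?S q P" for q P
  proof -
    obtain q1 where q1: "q1 \<in> ?E" "inc ?S q1 P" using PM unfolding M_def by blast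
    then obtain Q where Q: "joins ?S q1 P Q" by (auto simp: inc_joins)
    obtain q2 where "q2 \<in> ?E" "q2 \<noteq> q1" "inc ?S q2 P"
      using closed_walk_other_edge[OF u(2,3) q1(1) Q no_loops_subdivide[OF G]] by blast
    then show ?thesis using deg2[OF q1(2) \<open>inc ?S q2 P\<close> qP] q1(1) by auto
  qed
  have reach: "Q \<in> M" if "wk ?S {} P ps Q" "P \<in> M" for P ps Q
    using that
  proof (induction rule: wk.induct)
    case (Cons q P R ps Q)
    have "inc ?S q P" using Cons(1) by (auto simp: inc_joins)
    from M[OF Cons.prems this] have "q \<in> ?E" .
    moreover have "inc ?S q R" using joins_symD[OF Cons(1)] by (auto simp: inc_joins)
    ultimately show ?case using Cons.IH by (auto simp: M_def)
  qed
  have node_of: "\<exists>z ps. z \<in> verts G \<and> wk ?S {} (Node z) ps P" if P: "P \<in> verts ?S" for P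
  proof (cases P)
    case (Node x)
    then show ?thesis using P by (intro exI[of _ x] exI[of _ "[]"]) (auto simp: wk_Nil_iff verts_subdivide)
  next
    case (Inner e k)
    then have e: "e \<in> arcs G" "0 < k" "k < len G e" using P by (auto simp: verts_subdivide)
    have "\<exists>ps. wk ?S {} (epos G e 0) ps (epos G e k) \<and> length ps = k - 0"
      by (rule piece_walk[OF G e(1)]) (use e in auto)
    moreover have "epos G e 0 = Node (tail G e)" "epos G e k = P" using Inner e by (auto simp: epos_def)
    ultimately show ?thesis using is_lgraphD(3)[OF G e(1)] by metis
  qed
  have conS: "\<exists>ps. wk ?S {} P ps Q" if PQ: "P \<in> verts ?S" "Q \<in> verts ?S" for P Q
  proof -
    obtain z ps z' ps' where z: "z \<in> verts G" "wk ?S {} (Node z) ps P" "z' \<in> verts G" "wk ?S {} (Node z') ps' Q"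
      using node_of PQ by metis
    obtain es where "wk G {} z es z'" using assms(2) z unfolding conn_def by blast
    then obtain qs where "wk ?S {} (Node z) qs (Node z')" using expand[OF G, of "{}" z es z' "{}"] by auto
    then have "wk ?S {} P (rev ps @ qs @ ps') Q" using z by (intro wk_append wk_rev)
    then show ?thesis by blast
  qed
  have "hd (map fst p) \<in> ?E" using u(4) by (intro hd_in_set) simp
  then obtain q0 where q0: "q0 \<in> ?E" by blast
  have q0S: "q0 \<in> arcs ?S" using wk_arcs[OF u(2)] q0 by auto
  have tailM: "tail ?S q0 \<in> M" using q0 q0S by (auto simp: M_def inc_def)
  have allM: "P \<in> M" if "P \<in> verts ?S" for P
    using conS[OF _ that, of "tail ?S q0"] reach tailM q0S wf_digraph.tail_in_verts[OF wf] by blast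
  have arcs: "arcs ?S = fst ` set p"
  proof
    show "fst ` set p \<subseteq> arcs ?S" using wk_arcs[OF u(2)] by simp
    show "arcs ?S \<subseteq> fst ` set p"
    proof
      fix q assume "q \<in> arcs ?S"
      then have "tail ?S q \<in> M" "inc ?S q (tail ?S q)"
        using allM wf_digraph.tail_in_verts[OF wf] by (auto simp: inc_def)
      then show "q \<in> fst ` set p" using M by auto
    qed
  qed
  have next_dart: "dhead ?S d \<in> dtail ?S ` set p" if d: "d \<in> set p" for d
  proof -
    obtain p1 p2 where p12: "p = p1 @ d # p2" using d by (meson split_list)
    have w: "B.awalk (dhead ?S d) p2 u"
      using u(1) unfolding p12 B.awalk_append_iff by (auto simp: B.awalk_Cons_iff)
    show ?thesis
    proof (cases p2)
      case Nil
      then have "dhead ?S d = u" using w by (simp add: B.awalk_Nil_iff)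
      moreover have "u = dtail ?S (hd p)" using u(1,4) by (cases p) (auto simp: B.awalk_Cons_iff)
      ultimately show ?thesis using u(4) by auto
    next
      case (Cons d' p3)
      then show ?thesis using w p12 by (auto simp: B.awalk_Cons_iff)
    qed
  qed
  have "verts ?S = dtail ?S ` set p"
  proof
    show "dtail ?S ` set p \<subseteq> verts ?S"
      using u(1) B.tail_in_verts by (auto simp: B.awalk_def)
    show "verts ?S \<subseteq> dtail ?S ` set p"
    proof
      fix P assume "P \<in> verts ?S"
      then have "P \<in> M" by (rule allM)
      then have "\<exists>d \<in> set p. inc ?S (fst d) P" by (simp add: M_def)
      then obtain d where d: "d \<in> set p" "inc ?S (fst d) P" by blast
      then have da: "d \<in> arcs (bidirect ?S)" using u(1) by (auto simp: B.awalk_def)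
      then have "P = dtail ?S d \<or> P = dhead ?S d"
        using d(2) joins_dart[OF da] joins_ends unfolding inc_joins by metis
      then show "P \<in> dtail ?S ` set p" using next_dart[OF d(1)] d(1) by auto
    qed
  qed
  then show ?thesis unfolding cycle_graph_upto_def using G p arcs by blast
qed

section \<open>Local 2-separators\<close>

lemma apath_of_wk:
  assumes "wf_digraph H" "wk H {} x es y"
  obtains p where "pre_digraph.apath (bidirect H) x p y" "length p \<le> length es"
proof -
  interpret B: wf_digraph "bidirect H" by (rule wf_bidirect[OF assms(1)])
  obtain p where p: "map fst p = es" "B.awalk x p y" by (rule awalk_of_wk[OF assms]) blast
  have q: "B.apath x (B.awalk_to_apath p) y" by (rule B.apath_awalk_to_apath[OF p(2)])
  then have "distinct (B.awalk_to_apath p)" using B.distinct_verts_imp_distinct by (auto simp: B.apath_def)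
  then have "length (B.awalk_to_apath p) \<le> length es"
    using card_mono[OF _ B.awalk_to_apath_subset[OF p(2)]] distinct_card[of "B.awalk_to_apath p"]
      card_length[of p] arg_cong[OF p(1), of length] by simp
  then show ?thesis using that q by blast
qed

lemma wk_of_apath:
  assumes "wf_digraph H" "pre_digraph.apath (bidirect H) x p y"
  shows "wk H {} x (map fst p) y"
  using wk_of_awalk[OF assms(1), of x p y "{}"] assms(2) by (auto simp: pre_digraph.apath_def)

lemma wk_split_at:
  assumes "wf_digraph H" "pre_digraph.awalk (bidirect H) u p v" "c \<in> set (dverts H u p)"
  obtains es fs where "wk H {} u es c" "wk H {} c fs v" "length es + length fs = length p"
proof -
  interpret B: wf_digraph "bidirect H" by (rule wf_bidirect[OF assms(1)])
  have "\<exists>es fs. wk H {} u es c \<and> wk H {} c fs v \<and> length es + length fs = length p"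
    using assms(2,3)
  proof (induction p arbitrary: u)
    case Nil
    then show ?case by (intro exI[of _ "[]"]) (auto simp: B.awalk_Nil_iff wk_Nil_iff)
  next
    case (Cons d p)
    have w: "wk H {} u (map fst (d # p)) v" using wk_of_awalk[OF assms(1) Cons(2), of "{}"] by simp
    have d: "d \<in> arcs (bidirect H)" "u = dtail H d" "B.awalk (dhead H d) p v"
      using Cons(2) by (auto simp: B.awalk_Cons_iff)
    show ?case
    proof (cases "c = u")
      case True
      then show ?thesis using w wk_ends[OF w]
        by (intro exI[of _ "[]"] exI[of _ "map fst (d # p)"]) (auto simp: wk_Nil_iff)
    next
      case False
      then have "c \<in> set (dverts H (dhead H d) p)" using Cons(3) d by auto
      with Cons.IH[OF d(3)] obtain es fs where
        *: "wk H {} (dhead H d) es c" "wk H {} c fs v" "length es + length fs = length p" by blast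
      have "wk H {} u (fst d # es) c"
        using joins_dart[OF d(1)] d(2) *(1) wk_ends[OF w] by (auto intro: wk.Cons)
      then show ?thesis using * by (intro exI[of _ "fst d # es"] exI[of _ fs]) auto
    qed
  qed
  then show ?thesis using that by blast
qed

lemma bidirect_ball [simp]: "tail (bidirect (ball_graph \<rho> H v)) = tail (bidirect H)"
  "head (bidirect (ball_graph \<rho> H v)) = head (bidirect H)"
  by (simp_all add: bidirect_def cong: if_cong)

lemma awalk_verts_ball: "dverts (ball_graph \<rho> H v) u p = dverts H u p"
  by (simp add: pre_digraph.awalk_verts_conv)

lemma cas_ball: "pre_digraph.cas (bidirect (ball_graph \<rho> H v)) u p w \<longleftrightarrow> pre_digraph.cas (bidirect H) u p w"
  by (induction p arbitrary: u) (simp_all add: pre_digraph.cas.simps)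

lemma ball_subset: "verts (ball_graph \<rho> H v) \<subseteq> verts H" "arcs (ball_graph \<rho> H v) \<subseteq> arcs H"
  by (auto simp: ball_graph_def Let_def)

lemma darts_subset: "set p \<subseteq> arcs (bidirect H) \<longleftrightarrow> fst ` set p \<subseteq> arcs H"
  by (induction p) auto

lemma apath_ball: "pre_digraph.apath (bidirect (ball_graph \<rho> H v)) u p w \<longleftrightarrow>
    pre_digraph.apath (bidirect H) u p w \<and> u \<in> verts (ball_graph \<rho> H v) \<and> fst ` set p \<subseteq> arcs (ball_graph \<rho> H v)"
  using ball_subset[of \<rho> H v]
  by (auto simp: pre_digraph.apath_def pre_digraph.awalk_def awalk_verts_ball cas_ball darts_subset)

lemma ball_vertI:
  assumes "wf_digraph H" "wk H {} v p y" "wk H {} y q v" "enat (length p + length q) \<le> r"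
  shows "y \<in> verts (ball_graph (half r) H v)"
proof -
  have "enat (2 * length p) \<le> r \<or> enat (2 * length (rev q)) \<le> r"
    using assms(4) by (cases r) auto
  then show ?thesis unfolding verts_ball[OF assms(1)] using assms(2) wk_rev[OF assms(3)] by blast
qed

text \<open>Shortest paths from the core to \<open>u\<close> that lie on short closed walks at
  \<open>v\<close> are contained in the ball. Paths in the ball are paths in \<open>H\<close>, so
  the minimum is the same in both graphs and is attained by the same paths.\<close>

lemma core_label_ball:
  assumes "wf_digraph H" "core_label H C u \<noteq> {}"
    and "\<And>c p. (c, p) \<in> core_label H C u \<Longrightarrow>
      \<exists>ps qs. wk H {} v ps c \<and> wk H {} u qs v \<and> enat (length ps + length p + length qs) \<le> r"
  shows "core_label (ball_graph (half r) H v) C u = core_label H C u"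
proof -
  let ?B = "ball_graph (half r) H v"
  have inB: "pre_digraph.apath (bidirect ?B) c p u" if cp: "(c, p) \<in> core_label H C u" for c p
  proof -
    obtain ps qs where *: "wk H {} v ps c" "wk H {} u qs v" "enat (length ps + length p + length qs) \<le> r"
      using assms(3)[OF cp] by blast
    have ap: "pre_digraph.apath (bidirect H) c p u" using cp by (simp add: core_label_def)
    have w: "wk H {} c (map fst p) u" by (rule wk_of_apath[OF assms(1) ap])
    have "c \<in> verts ?B"
      using ball_vertI[OF assms(1) *(1) wk_append[OF w *(2)]] *(3) by (simp add: add.assoc)
    moreover have "e \<in> arcs ?B" if e: "e \<in> set (map fst p)" for e
    proof -
      obtain es fs where p: "map fst p = es @ e # fs" using e by (meson split_list)
      obtain s t where st: "wk H {} c es s" "joins H e s t" "wk H {} t fs u"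
        using w unfolding p wk_append_iff wk_Cons_iff by blast
      have "joins ?B e s t"
        by (rule ball_joinsI[OF assms(1) wk_append[OF *(1) st(1)] st(2) wk_append[OF st(3) *(2)]])
          (use *(3) arg_cong[OF p, of length] in \<open>simp add: ac_simps\<close>)
      then show ?thesis by (rule joins_arc)
    qed
    ultimately show ?thesis unfolding apath_ball using ap by auto
  qed
  obtain c0 p0 where c0: "(c0, p0) \<in> core_label H C u" using assms(2) by auto
  show ?thesis
  proof (intro set_eqI iffI)
    fix x assume x: "x \<in> core_label ?B C u"
    obtain c p where cp: "x = (c, p)" by (cases x)
    have 1: "c \<in> C" "pre_digraph.apath (bidirect ?B) c p u" using x cp by (auto simp: core_label_def)
    have "c0 \<in> C" using c0 by (simp add: core_label_def)
    then have "length p \<le> length p0" using x cp inB[OF c0] by (auto simp: core_label_def)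
    moreover have "length p0 \<le> length p'" if "c' \<in> C" "pre_digraph.apath (bidirect H) c' p' u" for c' p'
      using c0 that by (auto simp: core_label_def)
    ultimately have "length p \<le> length p'" if "c' \<in> C" "pre_digraph.apath (bidirect H) c' p' u" for c' p'
      using that order_trans by blast
    then show "x \<in> core_label H C u" using 1 cp unfolding core_label_def apath_ball by auto
  next
    fix x assume x: "x \<in> core_label H C u"
    obtain c p where cp: "x = (c, p)" by (cases x)
    have "pre_digraph.apath (bidirect ?B) c p u" using inB x cp by simp
    then show "x \<in> core_label ?B C u" using x cp by (auto simp: core_label_def apath_ball)
  qed
qed

lemma core_label_nonempty:
  assumes "wf_digraph H" "c \<in> C" "wk H {} c es u"
  shows "core_label H C u \<noteq> {}" and "(c', p) \<in> core_label H C u \<Longrightarrow> length p \<le> length es"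
proof -
  obtain p where p: "pre_digraph.apath (bidirect H) c p u" "length p \<le> length es"
    by (rule apath_of_wk[OF assms(1,3)])
  show "length p \<le> length es" if "(c', p) \<in> core_label H C u" for c' p
    using that p assms(2) unfolding core_label_def by fastforce
  define Q where "Q n \<longleftrightarrow> (\<exists>c p. c \<in> C \<and> pre_digraph.apath (bidirect H) c p u \<and> length p = n)" for n
  have "Q (Least Q)" by (rule LeastI[of Q "length p"]) (use p assms(2) in \<open>auto simp: Q_def\<close>)
  moreover have "Least Q \<le> length p'" if "c' \<in> C" "pre_digraph.apath (bidirect H) c' p' u" for c' p'
    by (rule Least_le) (use that in \<open>auto simp: Q_def\<close>)
  ultimately obtain c1 p1 where "c1 \<in> C" "pre_digraph.apath (bidirect H) c1 p1 u"
    "\<And>c' p'. c' \<in> C \<Longrightarrow> pre_digraph.apath (bidirect H) c' p' u \<Longrightarrow> length p1 \<le> length p'"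
    unfolding Q_def by metis
  then have "(c1, p1) \<in> core_label H C u" by (auto simp: core_label_def)
  then show "core_label H C u \<noteq> {}" by blast
qed

lemma coreD:
  assumes "wf_digraph H" "gdist H v w = ereal (real k)" "c \<in> core H v w"
  obtains es fs where "wk H {} v es c" "wk H {} c fs w" "length es + length fs = k"
proof -
  obtain p where p: "pre_digraph.apath (bidirect H) v p w" "length p = k" "c \<in> set (dverts H v p)"
    using assms(2,3) unfolding core_def by auto
  then have "pre_digraph.awalk (bidirect H) v p w" by (simp add: pre_digraph.apath_def)
  from wk_split_at[OF assms(1) this p(3)] show ?thesis using that p(2) by metis
qed

lemma core_ends:
  assumes "wf_digraph H" "gdist H v w = ereal (real k)"
  shows "v \<in> core H v w" "w \<in> core H v w"
proof -
  interpret B: wf_digraph "bidirect H" by (rule wf_bidirect[OF assms(1)])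
  obtain es where es: "geod H v es w" "length es = k"
    using gdist_cases[OF assms(1), of v w] assms(2) by auto
  then have "wk H {} v es w" by (simp add: geod_def)
  then obtain p where p: "B.apath v p w" "length p \<le> length es" by (rule apath_of_wk[OF assms(1)])
  have "length es \<le> length p" using es(1) wk_of_apath[OF assms(1) p(1)] unfolding geod_def by fastforce
  then have "length p = k" using p(2) es(2) by simp
  moreover have "v \<in> set (dverts H v p)" "w \<in> set (dverts H v p)"
    using B.hd_in_awalk_verts(2)[OF p(1)] p(1) B.awalk_conv[of v p w] last_in_set[OF B.awalk_verts_non_Nil]
    unfolding B.apath_def by metis+
  ultimately show "v \<in> core H v w" "w \<in> core H v w"
    unfolding core_def using p(1) assms(2) by auto
qed

text \<open>
  A shortest path from the core to \<open>u\<close> is no longer than \<open>ps\<close> and \<open>qs\<close>, so it lies on closed walks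
  of length at most \<open>r\<close> through \<open>v\<close> and through \<open>w\<close>, and hence in both balls.
\<close>

lemma labels_agree:
  assumes "wf_digraph H" "gdist H v w = ereal (real k)"
    and "wk H {} v ps u" "wk H {} u qs w" "enat (length ps + length qs + k) \<le> r"
  shows "core_label (ball_graph (half r) H v) (core H v w) u = core_label (ball_graph (half r) H w) (core H v w) u"
proof -
  let ?C = "core H v w"
  note C = core_ends[OF assms(1,2)]
  note ne = core_label_nonempty[OF assms(1) C(1) assms(3)] core_label_nonempty[OF assms(1) C(2) wk_rev[OF assms(4)]]
  have *: "\<exists>es fs. wk H {} v es c \<and> wk H {} c fs w \<and> length es \<le> k \<and> length fs \<le> k \<and>
      length p \<le> length ps \<and> length p \<le> length qs"
    if cp: "(c, p) \<in> core_label H ?C u" for c p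
  proof -
    have "c \<in> ?C" using cp by (simp add: core_label_def)
    then obtain es fs where "wk H {} v es c" "wk H {} c fs w" "length es + length fs = k"
      by (rule coreD[OF assms(1,2)])
    then show ?thesis using ne(2)[OF cp] ne(4)[OF cp] by (intro exI[of _ es] exI[of _ fs]) auto
  qed
  have leI: "enat n \<le> r" if "n \<le> length ps + length qs + k" for n
    using assms(5) that by (meson enat_ord_simps(1) order_trans)
  have "core_label (ball_graph (half r) H v) ?C u = core_label H ?C u"
  proof (rule core_label_ball[OF assms(1) ne(1)])
    fix c p assume "(c, p) \<in> core_label H ?C u"
    from *[OF this] obtain es fs where 1: "wk H {} v es c" "length es \<le> k" "length p \<le> length qs" by blast
    then show "\<exists>ps qs. wk H {} v ps c \<and> wk H {} u qs v \<and> enat (length ps + length p + length qs) \<le> r"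
      using wk_rev[OF assms(3)] by (intro exI[of _ es] exI[of _ "rev ps"]) (auto intro!: leI)
  qed
  moreover have "core_label (ball_graph (half r) H w) ?C u = core_label H ?C u"
  proof (rule core_label_ball[OF assms(1) ne(1)])
    fix c p assume "(c, p) \<in> core_label H ?C u"
    from *[OF this] obtain es fs where 1: "wk H {} c fs w" "length fs \<le> k" "length p \<le> length ps" by blast
    then show "\<exists>ps qs. wk H {} w ps c \<and> wk H {} u qs w \<and> enat (length ps + length p + length qs) \<le> r"
      using wk_rev[OF 1(1)] assms(4) by (intro exI[of _ "rev fs"] exI[of _ qs]) (auto intro!: leI)
  qed
  ultimately show ?thesis by simp
qed

section \<open>From a disconnected explorer neighbourhood to a separation\<close>

lemma geod_min: "geod H u es v \<Longrightarrow> wk H {} u fs v \<Longrightarrow> length es \<le> length fs"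
  by (simp add: geod_def)

text \<open>A two-colouring of the punctured explorer neighbourhood, seen on the two balls. There
  are two functions because a point of both balls may occur with two labels; \<open>agree\<close>
  records the points for which equal labels are ensured.\<close>

locale coloring =
  fixes r :: enat and G :: "('a, 'b) lgraph" and v w :: 'a and k :: nat
    and fv fw :: "('a, 'b) point \<Rightarrow> bool"
  assumes lg: "is_lgraph G" and v: "v \<in> verts G" and w: "w \<in> verts G" and vw: "v \<noteq> w"
    and geo: "\<exists>R. geod (subdivide G) (Node v) R (Node w) \<and> length R = k"
    and k2: "enat (2 * k) \<le> r"
    and fv: "\<And>e y z. joins (ball_graph (half r) (subdivide G) (Node v)) e y z \<Longrightarrow>
      y \<notin> {Node v, Node w} \<union> edge_points G v w \<Longrightarrow> z \<notin> {Node v, Node w} \<union> edge_points G v w \<Longrightarrow> fv y = fv z"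
    and fw: "\<And>e y z. joins (ball_graph (half r) (subdivide G) (Node w)) e y z \<Longrightarrow>
      y \<notin> {Node v, Node w} \<union> edge_points G v w \<Longrightarrow> z \<notin> {Node v, Node w} \<union> edge_points G v w \<Longrightarrow> fw y = fw z"
    and agree: "\<And>ps u qs. wk (subdivide G) {} (Node v) ps u \<Longrightarrow> wk (subdivide G) {} u qs (Node w) \<Longrightarrow>
      enat (length ps + length qs + k) \<le> r \<Longrightarrow> fv u = fw u"
begin

abbreviation "S \<equiv> subdivide G"
abbreviation "Y \<equiv> {Node v, Node w} \<union> edge_points G v w"

lemma coloring_swap: "coloring r G w v k fw fv"
proof unfold_locales
  have Y: "{Node w, Node v} \<union> edge_points G w v = Y" by (auto simp: edge_points_def insert_commute)
  show "\<exists>R. geod S (Node w) R (Node v) \<and> length R = k"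
  proof -
    obtain R where R: "geod S (Node v) R (Node w)" "length R = k" using geo by blast
    have "geod S (Node w) (rev R) (Node v)"
      unfolding geod_def
    proof (intro conjI allI impI)
      have "wk S {} (Node v) R (Node w)" using R(1) by (simp add: geod_def)
      then show "wk S {} (Node w) (rev R) (Node v)" by (rule wk_rev)
      fix fs assume "wk S {} (Node w) fs (Node v)"
      from wk_rev[OF this] have "length R \<le> length (rev fs)" by (rule geod_min[OF R(1)])
      then show "length (rev R) \<le> length fs" by simp
    qed
    then show ?thesis using R(2) by (intro exI[of _ "rev R"]) simp
  qed
  show "fw u = fv u" if "wk S {} (Node w) ps u" "wk S {} u qs (Node v)" "enat (length ps + length qs + k) \<le> r" for ps u qs
    using agree[OF wk_rev[OF that(2)] wk_rev[OF that(1)]] that(3) by (simp add: ac_simps)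
  show "fw y = fw z" if "joins (ball_graph (half r) S (Node w)) e y z"
    "y \<notin> {Node w, Node v} \<union> edge_points G w v" "z \<notin> {Node w, Node v} \<union> edge_points G w v" for e y z
    using fw[OF that(1)] that(2,3) unfolding Y by blast
  show "fv y = fv z" if "joins (ball_graph (half r) S (Node v)) e y z"
    "y \<notin> {Node w, Node v} \<union> edge_points G w v" "z \<notin> {Node w, Node v} \<union> edge_points G w v" for e y z
    using fv[OF that(1)] that(2,3) unfolding Y by blast
qed (use lg v w vw k2 in auto)

lemma wf: "wf_digraph S"
  by (rule wf_subdivide[OF lg])

lemma const_v:
  assumes "wk S Y P ps Q" "wk S {} (Node v) us P" "wk S {} Q qs (Node v)"
    "enat (length us + length ps + length qs) \<le> r"
  shows "fv P = fv Q"
  by (rule ball_const[OF wf fv assms])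

text \<open>An inner point of an edge between \<open>v\<close> and \<open>w\<close> is adjacent only
  to points of that edge.\<close>

lemma joins_out_of_Y:
  assumes "joins S e P Q" "Q \<notin> Y" "P \<notin> {Node v, Node w}"
  shows "P \<notin> Y"
proof
  assume "P \<in> Y"
  then obtain g i where g: "P = Inner g i" "g \<in> arcs G" "{tail G g, head G g} = {v, w}"
    using assms(3) by (auto simp: edge_points_def)
  obtain h j where e: "e = (h, j)" by (cases e)
  have h: "h \<in> arcs G" "j < len G h" "P = epos G h j \<and> Q = epos G h (Suc j) \<or> P = epos G h (Suc j) \<and> Q = epos G h j"
    using assms(1) unfolding e joins_subdivide by auto
  then have "h = g" using g(1) by (auto simp: epos_Inner)
  then have "Q \<in> Y"
    using g(2,3) h by (cases Q) (auto simp: edge_points_def epos_Inner epos_Node)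
  then show False using assms(2) by blast
qed

lemma wk_out_of_Y:
  assumes "wk S {Node v, Node w} P ps Q" "Q \<notin> Y"
  shows "wk S Y P ps Q"
  using assms
proof (induction rule: wk.induct)
  case (Cons e P R ps Q)
  then have w: "wk S Y R ps Q" by blast
  then have "R \<notin> Y" using wk_ends by fast
  then have "P \<notin> Y" using joins_out_of_Y[OF Cons(1)] Cons(3) by blast
  then show ?case using Cons w by (auto intro: wk.Cons)
qed (auto intro: wk.Nil)

lemma pt_in_Y: "inc G e v \<Longrightarrow> inc G e w \<Longrightarrow> pt G e v \<in> Y"
  using vw is_lgraphD(6)[OF lg, of e] by (auto simp: inc_def pt_def epos_def edge_points_def)

lemma k_geod:
  obtains R where "wk S {} (Node v) R (Node w)" "length R = k"
    "\<And>es. wk S {} (Node v) es (Node w) \<Longrightarrow> k \<le> length es"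
  using geo unfolding geod_def by blast

text \<open>On a shortest path from \<open>v\<close>, the colour is constant after the last visit of
  \<open>v\<close> or \<open>w\<close>. If that visit is at \<open>w\<close>, the path to it has
  length at least \<open>k\<close>, so the next point lies on a closed walk short enough for
  \<open>agree\<close>, and the colour can be read at \<open>w\<close>.\<close>

lemma color_reach:
  assumes "y \<in> verts (ball_graph (half r) S (Node v))" "y \<notin> Y"
  shows "\<exists>e. inc G e v \<and> \<not> inc G e w \<and> fv y = fv (pt G e v) \<or> inc G e w \<and> \<not> inc G e v \<and> fv y = fw (pt G e w)"
proof -
  obtain es0 where es0: "wk S {} (Node v) es0 y" "enat (2 * length es0) \<le> r"
    using assms(1) verts_ball[OF wf] by blast
  obtain es where es: "geod S (Node v) es y" "length es \<le> length es0" using ex_geod[OF es0(1)] .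
  have le: "enat (2 * length es) \<le> r" using es(2) es0(2) by (meson enat_ord_simps(1) mult_le_mono2 order_trans)
  have wk: "wk S {} (Node v) es y" using es(1) by (simp add: geod_def)
  have ny: "y \<notin> {Node v, Node w}" using assms(2) by blast
  have "\<not> wk S ({} \<union> {Node v, Node w}) (Node v) es y" using wk_ends by fast
  with wk_last_hit[OF wk ny] obtain es1 f es2 q z where
    1: "es = es1 @ f # es2" "wk S {} (Node v) es1 z" "z \<in> {Node v, Node w}" "joins S f z q"
      "wk S ({} \<union> {Node v, Node w}) q es2 y" by blast
  have w2: "wk S Y q es2 y" using wk_out_of_Y[OF _ assms(2)] 1(5) by simp
  have q: "q \<notin> Y" "q \<in> verts S" using wk_ends[OF w2] by auto
  have w1: "wk S {} (Node v) (es1 @ [f]) q" using wk_snoc[OF 1(2,4)] q by simp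
  have fq: "fv q = fv y"
    by (rule const_v[OF w2 w1 wk_rev[OF wk]]) (use le 1(1) in \<open>auto elim: order_trans[rotated]\<close>)
  from 1(3) consider "z = Node v" | "z = Node w" by blast
  then show ?thesis
  proof cases
    case 1
    with piece_of_joins[OF lg, of f v q] \<open>joins S f z q\<close> obtain e where e: "inc G e v" "q = pt G e v" by blast
    then have "\<not> inc G e w" using pt_in_Y q by blast
    then show ?thesis using e fq by blast
  next
    case 2
    with piece_of_joins[OF lg, of f w q] \<open>joins S f z q\<close> obtain e where e: "inc G e w" "q = pt G e w" by blast
    have "\<not> inc G e v"
    proof
      assume "inc G e v"
      then have "pt G e w \<in> {Node w, Node v} \<union> edge_points G w v"
        using coloring.pt_in_Y[OF coloring_swap e(1)] by blast
      then show False using q e(2) by (auto simp: edge_points_def insert_commute)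
    qed
    moreover have "fv q = fw q"
    proof (rule agree[OF w1])
      show "wk S {} q [f] (Node w)"
        using 1(4) 2 q w by (auto intro!: wk_single joins_symD[OF 1(4)[unfolded 2]] simp: verts_subdivide)
      have "k \<le> length es1" using k_geod 1(2) 2 by metis
      then have "length (es1 @ [f]) + length [f] + k \<le> 2 * length es" using 1(1) by simp
      then show "enat (length (es1 @ [f]) + length [f] + k) \<le> r" using le by (meson enat_ord_simps(1) order_trans)
    qed
    ultimately show ?thesis using e fq by metis
  qed
qed

text \<open>Edges between \<open>v\<close> and \<open>w\<close> have all their points deleted and
  carry no colour. They are put into this side by convention.\<close>

definition side_set :: "'b set" where
  "side_set = {e. inc G e v \<and> inc G e w \<or> inc G e v \<and> \<not> inc G e w \<and> fv (pt G e v) \<or>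
     inc G e w \<and> \<not> inc G e v \<and> fw (pt G e w)}"

text \<open>A segment with at least two edges contains no edge between \<open>v\<close> and
  \<open>w\<close>, so its expansion also avoids the deleted inner points.\<close>

lemma seg_walk:
  assumes "sg G {v, w} s es t" "\<nexists>e. es = [e]"
  obtains e f ps where "e = hd es" "f = last es" "inc G e s" "inc G f t" "\<not> (inc G e v \<and> inc G e w)"
    "\<not> (inc G f v \<and> inc G f w)" "wk S Y (pt G e s) ps (pt G f t)" "length ps + 2 = wt G es"
proof -
  obtain e x ms y f where *: "es = e # ms @ [f]" "joins G e s x" "wk G {v, w} x ms y" "joins G f y t"
    using assms unfolding sg_def by blast
  have xy: "x \<notin> {v, w}" "y \<notin> {v, w}" using wk_ends[OF *(3)] by auto
  have noD: "\<not> (inc G g v \<and> inc G g w)" if "joins G g p q" "p \<notin> {v, w}" for g p q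
    using that vw by (auto simp: inc_def joins_def)
  have ms: "\<not> (inc G g v \<and> inc G g w)" if "g \<in> set ms" for g
  proof -
    have "\<exists>p q. joins G g p q \<and> p \<notin> {v, w}" using *(3) that
      by (induction rule: wk.induct) auto
    then show ?thesis using noD by blast
  qed
  have ef: "\<not> (inc G e v \<and> inc G e w)" "\<not> (inc G f v \<and> inc G f w)"
    using noD[OF joins_symD[OF *(2)] xy(1)] noD[OF *(4) xy(2)] .
  have D: "\<not> (inc G g v \<and> inc G g w)" if "g \<in> set (e # ms @ [f])" for g using that ms ef by auto
  have "\<exists>ps. wk S Y (pt G e s) ps (pt G f t) \<and> length ps + 2 = wt G (e # ms @ [f])"
  proof (rule expand_seg[OF lg *(2-4)])
    show "z \<in> {v, w}" if "Node z \<in> Y" for z using that by (auto simp: edge_points_def)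
    show "Inner g i \<notin> Y" if "g \<in> set (e # ms @ [f])" for g i
      using D[OF that] by (auto simp: edge_points_def inc_def doubleton_eq_iff)
  qed
  then obtain ps where ps: "wk S Y (pt G e s) ps (pt G f t)" "length ps + 2 = wt G es"
    unfolding *(1) by blast
  have inc: "inc G e s" "inc G f t" using *(2) joins_symD[OF *(4)] unfolding inc_joins by blast+
  show ?thesis by (rule that[OF _ _ inc ef ps]) (simp_all add: *(1))
qed

lemma side_vv:
  assumes "sg G {v, w} v es v" "enat (wt G es) \<le> r"
  shows "hd es \<in> side_set \<longleftrightarrow> last es \<in> side_set"
proof (cases "\<exists>e. es = [e]")
  case False
  obtain e f ps where *: "e = hd es" "f = last es" "inc G e v" "inc G f v" "\<not> (inc G e v \<and> inc G e w)"
    "\<not> (inc G f v \<and> inc G f w)" "wk S Y (pt G e v) ps (pt G f v)" "length ps + 2 = wt G es"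
    by (rule seg_walk[OF assms(1) False])
  note j = joins_piece[OF lg *(3)] joins_piece[OF lg *(4)]
  have V: "Node v \<in> verts S" using v by (simp add: verts_subdivide)
  have "fv (pt G e v) = fv (pt G f v)"
  proof (rule const_v[OF *(7)])
    show "wk S {} (Node v) [piece G e v] (pt G e v)" using j V wk_ends[OF *(7)] by (auto intro: wk_single)
    show "wk S {} (pt G f v) [piece G f v] (Node v)"
      using wk_single[OF joins_symD[OF j(2)], of "{}"] V wk_ends[OF *(7)] by auto
    show "enat (length [piece G e v] + length ps + length [piece G f v]) \<le> r" using assms(2) *(8) by simp
  qed
  then show ?thesis using *(1-6) by (auto simp: side_set_def)
qed auto

text \<open>The slack \<open>k\<close> is spent twice: a shortest path \<open>R\<close> closes the
  segment up inside the ball at \<open>v\<close>, and the same bound permits \<open>agree\<close> at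
  the neighbour of \<open>w\<close>, where the colour passes from \<open>fv\<close> to
  \<open>fw\<close>.\<close>

lemma side_vw:
  assumes "sg G {v, w} v es w" "enat (wt G es + k) \<le> r"
  shows "hd es \<in> side_set \<longleftrightarrow> last es \<in> side_set"
proof (cases "\<exists>e. es = [e]")
  case False
  obtain e f ps where *: "e = hd es" "f = last es" "inc G e v" "inc G f w" "\<not> (inc G e v \<and> inc G e w)"
    "\<not> (inc G f v \<and> inc G f w)" "wk S Y (pt G e v) ps (pt G f w)" "length ps + 2 = wt G es"
    by (rule seg_walk[OF assms(1) False])
  note j = joins_piece[OF lg *(3)] joins_piece[OF lg *(4)]
  obtain R where R: "wk S {} (Node v) R (Node w)" "length R = k" by (rule k_geod)
  have VW: "Node v \<in> verts S" "Node w \<in> verts S" using v w by (simp_all add: verts_subdivide)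
  have 1: "wk S {} (Node v) [piece G e v] (pt G e v)" using j VW wk_ends[OF *(7)] by (auto intro: wk_single)
  have 2: "wk S {} (pt G f w) [piece G f w] (Node w)"
    using wk_single[OF joins_symD[OF j(2)], of "{}"] VW wk_ends[OF *(7)] by auto
  have ps: "wk S {} (pt G e v) ps (pt G f w)" using wk_mono[OF *(7)] by blast
  have "fv (pt G e v) = fv (pt G f w)"
  proof (rule const_v[OF *(7) 1 wk_append[OF 2 wk_rev[OF R(1)]]])
    have "length [piece G e v] + length ps + length ([piece G f w] @ rev R) = wt G es + k"
      using *(8) R(2) by simp
    then show "enat (length [piece G e v] + length ps + length ([piece G f w] @ rev R)) \<le> r"
      using assms(2) by (simp only:)
  qed
  also have "\<dots> = fw (pt G f w)"
  proof (rule agree[OF wk_append[OF 1 ps] 2])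
    have "length ([piece G e v] @ ps) + length [piece G f w] + k = wt G es + k"
      using *(8) by simp
    then show "enat (length ([piece G e v] @ ps) + length [piece G f w] + k) \<le> r"
      using assms(2) by (simp only:)
  qed
  finally show ?thesis using *(1-6) by (auto simp: side_set_def)
qed auto

end

lemma labelled_copy_simps:
  "verts (labelled_copy B l) = (\<lambda>u. (u, l u)) ` verts B"
  "arcs (labelled_copy B l) = (\<lambda>e. (e, l (tail B e), l (head B e))) ` arcs B"
  "tail (labelled_copy B l) (e, l1, l2) = (tail B e, l1)"
  "head (labelled_copy B l) (e, l1, l2) = (head B e, l2)"
  by (simp_all add: labelled_copy_def)

text \<open>Both colours occur on edges with only one end in \<open>{v, w}\<close>, since each point
  of the explorer neighbourhood has the colour of such an edge. This makes both sides nonempty and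
  provides a second edge on each.\<close>

lemma sep_of_local_2_separator:
  assumes "loc2 r G" "conn G" "local_2_separator r G v w"
  obtains k A where "sep r G v w k A"
    "\<exists>e \<in> A. \<exists>f \<in> A. e \<noteq> f \<and> (inc G e v \<or> inc G e w) \<and> (inc G f v \<or> inc G f w)"
    "\<exists>e \<in> - A. \<exists>f \<in> - A. e \<noteq> f \<and> (inc G e v \<or> inc G e w) \<and> (inc G f v \<or> inc G f w)"
proof -
  let ?S = "subdivide G"
  let ?V = "Node v" and ?W = "Node w"
  let ?Bv = "ball_graph (half r) ?S ?V" and ?Bw = "ball_graph (half r) ?S ?W"
  let ?C = "core ?S ?V ?W"
  let ?Lv = "core_label ?Bv ?C" and ?Lw = "core_label ?Bw ?C"
  let ?E = "expl r ?S ?V ?W"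
  let ?Y = "{?V, ?W} \<union> edge_points G v w"
  define D where "D = ?E \<restriction> {x \<in> verts ?E. fst x \<notin> ?Y}"
  have lg: "is_lgraph G" using assms(1) by (simp add: loc2_def)
  note wf = wf_subdivide[OF lg]
  have *: "v \<in> verts G" "w \<in> verts G" "v \<noteq> w" "ldist G v w \<le> half r" "disconnected D"
    using assms(3) by (simp_all add: local_2_separator_def Let_def D_def)
  have "\<exists>es. wk G {} v es w" using assms(2) *(1,2) by (simp add: conn_def)
  then obtain es where es: "wk G {} v es w" "ldist G v w = ereal (wt G es)"
    "\<And>fs. wk G {} v fs w \<Longrightarrow> wt G es \<le> wt G fs"
    using ldist_cases[OF lg, of v w] by blast
  define k where "k = wt G es"
  have g: "gdist ?S ?V ?W = ereal (real k)" using es(2) by (simp add: ldist_def k_def)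
  obtain R where R: "geod ?S ?V R ?W" "length R = k" using gdist_cases[OF wf, of ?V ?W] g by auto
  have k2: "enat (2 * k) \<le> r" using *(4) le_half[of k r] unfolding es(2) k_def by blast
  have E: "verts ?E = (\<lambda>u. (u, ?Lv u)) ` verts ?Bv \<union> (\<lambda>u. (u, ?Lw u)) ` verts ?Bw"
    "arcs ?E = (\<lambda>e. (e, ?Lv (tail ?S e), ?Lv (head ?S e))) ` arcs ?Bv \<union>
      (\<lambda>e. (e, ?Lw (tail ?S e), ?Lw (head ?S e))) ` arcs ?Bw"
    "tail ?E (e, l1, l2) = (tail ?S e, l1)" "head ?E (e, l1, l2) = (head ?S e, l2)" for e l1 l2
    by (simp_all add: expl_def Let_def Digraph_Component.union_def labelled_copy_simps)
  have D: "joins D q x y \<longleftrightarrow> joins ?E q x y \<and> x \<in> verts D \<and> y \<in> verts D"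
    "verts D = {x \<in> verts ?E. fst x \<notin> ?Y}" for q x y
    by (auto simp: D_def joins_def)
  have "wf_digraph D" by (auto simp: D_def wf_digraph_def)
  then have "\<not> conn D" "verts D \<noteq> {}" using *(5) disconnected_iff by blast+
  then obtain f x0 y0 where f: "\<And>e x y. x \<in> verts D \<Longrightarrow> y \<in> verts D \<Longrightarrow> joins D e x y \<Longrightarrow> f x = f y"
    and x0: "x0 \<in> verts D" "f x0" and y0: "y0 \<in> verts D" "\<not> f y0" by (rule not_conn_coloring) blast
  define fv where "fv u = f (u, ?Lv u)" for u
  define fw where "fw u = f (u, ?Lw u)" for u
  interpret c: coloring r G v w k fv fw
  proof unfold_locales
    fix e y z
    assume j: "joins ?Bv e y z" and Y: "y \<notin> ?Y" "z \<notin> ?Y"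
    have "y \<in> verts ?Bv" "z \<in> verts ?Bv" using arcs_ball_verts(1)[OF j] by auto
    then have V: "(y, ?Lv y) \<in> verts D" "(z, ?Lv z) \<in> verts D" unfolding D E using Y by auto
    have "joins ?E (e, ?Lv (tail ?S e), ?Lv (head ?S e)) (y, ?Lv y) (z, ?Lv z)"
      using j unfolding joins_def E by auto
    then show "fv y = fv z" unfolding fv_def using f[OF V] D(1) V by blast
  next
    fix e y z
    assume j: "joins ?Bw e y z" and Y: "y \<notin> ?Y" "z \<notin> ?Y"
    have "y \<in> verts ?Bw" "z \<in> verts ?Bw" using arcs_ball_verts(1)[OF j] by auto
    then have V: "(y, ?Lw y) \<in> verts D" "(z, ?Lw z) \<in> verts D" unfolding D E using Y by auto
    have "joins ?E (e, ?Lw (tail ?S e), ?Lw (head ?S e)) (y, ?Lw y) (z, ?Lw z)"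
      using j unfolding joins_def E by auto
    then show "fw y = fw z" unfolding fw_def using f[OF V] D(1) V by blast
  next
    fix ps u qs
    assume "wk ?S {} ?V ps u" "wk ?S {} u qs ?W" "enat (length ps + length qs + k) \<le> r"
    from labels_agree[OF wf g this] show "fv u = fw u" by (simp add: fv_def fw_def)
  qed (use lg * R k2 in blast)+
  interpret d: coloring r G w v k fw fv by (rule c.coloring_swap)
  have dside: "d.side_set = c.side_set" by (auto simp: d.side_set_def c.side_set_def)
  have reach: "\<exists>e. (inc G e v \<and> \<not> inc G e w \<or> inc G e w \<and> \<not> inc G e v) \<and> (e \<in> c.side_set \<longleftrightarrow> f x)"
    if x: "x \<in> verts D" for x
  proof -
    have "x \<in> verts ?E" "fst x \<notin> ?Y" using x D(2) by auto
    then consider y where "x = (y, ?Lv y)" "y \<in> verts ?Bv" "y \<notin> ?Y" |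
      y where "x = (y, ?Lw y)" "y \<in> verts ?Bw" "y \<notin> ?Y" unfolding E(1) by auto
    then show ?thesis
    proof cases
      case 1
      then have "f x = fv y" by (simp add: fv_def)
      then show ?thesis using c.color_reach[OF 1(2,3)] unfolding c.side_set_def by blast
    next
      case 2
      then have "f x = fw y" by (simp add: fw_def)
      moreover have "y \<notin> {?W, ?V} \<union> edge_points G w v"
        using 2(3) by (simp add: edge_points_def insert_commute)
      ultimately show ?thesis using d.color_reach[OF 2(2)] unfolding c.side_set_def by blast
    qed
  qed
  obtain e1 where e1: "e1 \<in> c.side_set" "inc G e1 v \<and> \<not> inc G e1 w \<or> inc G e1 w \<and> \<not> inc G e1 v"
    using reach[OF x0(1)] x0(2) by blast
  obtain e2 where e2: "e2 \<notin> c.side_set" "inc G e2 v \<and> \<not> inc G e2 w \<or> inc G e2 w \<and> \<not> inc G e2 v"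
    using reach[OF y0(1)] y0(2) by blast
  have sep: "sep r G v w k c.side_set"
  proof
    fix s t es
    assume st: "s \<in> {v, w}" "t \<in> {v, w}" "sg G {v, w} s es t" "enat (wt G es + (if s = t then 0 else k)) \<le> r"
    have sg': "sg G {w, v} s es t" using st(3) by (simp add: insert_commute)
    consider "s = v" "t = v" | "s = w" "t = w" | "s = v" "t = w" | "s = w" "t = v" using st(1,2) by blast
    then show "hd es \<in> c.side_set \<longleftrightarrow> last es \<in> c.side_set"
    proof cases
      case 1
      then show ?thesis using c.side_vv st by simp
    next
      case 2
      then show ?thesis using d.side_vv[unfolded dside, of es] sg' st(4) by simp
    next
      case 3
      then show ?thesis using c.side_vw st *(3) by simp
    next
      case 4
      then show ?thesis using d.side_vw[unfolded dside, of es] sg' st(4) *(3) by simp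
    qed
  next
    show "\<exists>R. wk G {} v R w \<and> wt G R = k" using es(1) k_def by blast
    show "k \<le> wt G fs" if "wk G {} v fs w" for fs using es(3)[OF that] by (simp add: k_def)
  qed (use assms(1) * k2 e1 e2 in blast)+
  interpret s: sep r G v w k c.side_set by (rule sep)
  show ?thesis
  proof (rule that[OF sep])
    obtain a b where ab: "a \<in> c.side_set" "inc G a v" "b \<in> c.side_set" "inc G b w"
      using s.A_v s.A_w by blast
    \<comment> \<open>Each side has edges at both \<open>v\<close> and \<open>w\<close>, and
      \<open>e1\<close> cannot serve for both.\<close>
    then have "a \<noteq> e1 \<or> b \<noteq> e1" using e1 by blast
    then show "\<exists>e \<in> c.side_set. \<exists>f \<in> c.side_set. e \<noteq> f \<and> (inc G e v \<or> inc G e w) \<and> (inc G f v \<or> inc G f w)"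
      using ab e1 by blast
    obtain a b where ab: "a \<notin> c.side_set" "inc G a v" "b \<notin> c.side_set" "inc G b w"
      using s.B_v s.B_w by blast
    then have "a \<noteq> e2 \<or> b \<noteq> e2" using e2 by blast
    then show "\<exists>e \<in> - c.side_set. \<exists>f \<in> - c.side_set. e \<noteq> f \<and> (inc G e v \<or> inc G e w) \<and> (inc G f v \<or> inc G f w)"
      using ab e2 by blast
  qed
qed

section \<open>The graph as a local 2-sum\<close>

lemma comp_of_eq:
  assumes "is_lgraph G" "y \<in> verts (comp_of G x)"
  shows "comp_of G y = comp_of G x"
proof -
  obtain es where es: "wk G {} x es y" using assms(2) by auto
  have "(\<exists>fs. wk G {} y fs z) \<longleftrightarrow> (\<exists>fs. wk G {} x fs z)" for z
    using wk_append[OF es] wk_append[OF wk_rev[OF es]] by blast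
  then show ?thesis by (simp add: comp_of_def)
qed

lemma comp_of_self: "x \<in> verts G \<Longrightarrow> x \<in> verts (comp_of G x)"
  using wk.Nil[of x G "{}"] by auto

lemma wk_remove_edge: "wk (remove_edge K e) X x es y \<longleftrightarrow> wk K X x es y \<and> e \<notin> set es"
proof
  assume *: "wk (remove_edge K e) X x es y"
  have "wk K X x es y" by (rule wk_cong_mono[OF *]) (auto simp: joins_def remove_edge_def)
  moreover have "e \<notin> set es" using wk_arcs[OF *] by (auto simp: remove_edge_def)
  ultimately show "wk K X x es y \<and> e \<notin> set es" by blast
next
  assume *: "wk K X x es y \<and> e \<notin> set es"
  show "wk (remove_edge K e) X x es y"
    by (rule wk_cong_mono[OF conjunct1[OF *]]) (use * in \<open>auto simp: joins_def remove_edge_def\<close>)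
qed

lemma len_remove_edge [simp]: "len (remove_edge K e) = len K"
  by (simp add: remove_edge_def)

lemma is_lgraph_remove_edge: "is_lgraph K \<Longrightarrow> is_lgraph (remove_edge K e)"
  by (rule is_lgraphI) (auto simp: remove_edge_def dest: is_lgraphD)

lemma less_two: "(i::nat) < 2 \<longleftrightarrow> i = 0 \<or> i = 1"
  by auto

lemma local_dist:
  assumes "is_lgraph K" "\<And>es. wk K {} x es y \<Longrightarrow> \<not> enat (wt K es) \<le> r"
  shows "ereal_of_enat r + 1 \<le> ldist K x y"
  using ldist_cases[OF assms(1), of x y]
proof (elim disjE exE conjE)
  fix es assume *: "wk K {} x es y" "ldist K x y = ereal (wt K es)"
  have r: "\<not> enat (wt K es) \<le> r" using assms(2) *(1) by blast
  then obtain m where m: "r = enat m" by (cases r) auto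
  then have "real m + 1 \<le> real (wt K es)" using r by simp
  then have "ereal (real m + 1) \<le> ereal (real (wt K es))" by simp
  then show ?thesis using *(2) m by (simp add: one_ereal_def)
qed simp

lemma em_same [simp]: "em v w v w x = x"
  by (simp add: em_def)

text \<open>The side \<open>A\<close> keeps the old names \<open>v\<close> and \<open>w\<close>; the
  other side receives new copies. Infinite types supply the fresh vertices and virtual
  edges.\<close>

lemma (in sep) ex_cut:
  assumes "infinite (UNIV :: 'a set)" "infinite (UNIV :: 'b set)"
  shows "\<exists>G' a b v' w'. cut r G v w k A G' a b v w v' w'"
proof -
  obtain v' where v': "v' \<notin> verts G" using ex_new_if_finite[OF assms(1) is_lgraphD(1)[OF lg]] by blast
  obtain w' where w': "w' \<notin> insert v' (verts G)"
    using ex_new_if_finite[OF assms(1), of "insert v' (verts G)"] is_lgraphD(1)[OF lg] by blast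
  obtain a where a: "a \<notin> arcs G" using ex_new_if_finite[OF assms(2) is_lgraphD(2)[OF lg]] by blast
  obtain b where b: "b \<notin> insert a (arcs G)"
    using ex_new_if_finite[OF assms(2), of "insert a (arcs G)"] is_lgraphD(2)[OF lg] by blast
  define ren where "ren e = (if e \<in> A then (\<lambda>x. x) else em v w v' w')" for e
  define G' where "G' = \<lparr> verts = verts G \<union> {v', w'}, arcs = insert a (insert b (arcs G)),
    tail = (\<lambda>e. if e = a then v else if e = b then v' else ren e (tail G e)),
    head = (\<lambda>e. if e = a then w else if e = b then w' else ren e (head G e)),
    len = (\<lambda>e. if e = a then gB else if e = b then gA else len G e) \<rparr>"
  have dist: "v \<noteq> v'" "v \<noteq> w'" "w \<noteq> v'" "w \<noteq> w'" "v' \<noteq> w'" "a \<noteq> b" using v w v' w' b by auto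
  have "cut r G v w k A G' a b v w v' w'"
  proof unfold_locales
    note A = is_lgraphD[OF lg]
    have ren: "ren e x \<in> verts G \<union> {v', w'}" if "x \<in> verts G" for e x using that by (auto simp: ren_def em_def)
    have ren_inj: "ren e x \<noteq> ren e y" if "x \<in> verts G" "y \<in> verts G" "x \<noteq> y" for e x y
      using that v' w' dist by (auto simp: ren_def em_def)
    show "is_lgraph G'"
    proof (rule is_lgraphI)
      fix e assume e: "e \<in> arcs G'"
      show "tail G' e \<in> verts G'" "head G' e \<in> verts G'"
        using e ren[OF A(3)] ren[OF A(4)] v w by (auto simp: G'_def)
      show "tail G' e \<noteq> head G' e"
        using e ren_inj[OF A(3,4,5)] vw dist by (auto simp: G'_def)
      show "0 < len G' e" using e gA_pos gB_pos A(6) by (auto simp: G'_def)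
    qed (use A in \<open>auto simp: G'_def\<close>)
    show "joins G' e x y \<longleftrightarrow> (\<exists>x0 y0. joins G e x0 y0 \<and> x = em v w v w x0 \<and> y = em v w v w y0)"
      if "e \<in> arcs G" "e \<in> A" for e x y
      using that a b by (auto simp: joins_def G'_def ren_def)
    show "joins G' e x y \<longleftrightarrow> (\<exists>x0 y0. joins G e x0 y0 \<and> x = em v w v' w' x0 \<and> y = em v w v' w' y0)"
      if "e \<in> arcs G" "e \<notin> A" for e x y
      using that a b by (auto simp: joins_def G'_def ren_def)
  qed (use v w vw v' w' a b dist in \<open>auto simp: G'_def joins_def\<close>)
  then show ?thesis by blast
qed

context cut
begin

abbreviation "Ka \<equiv> comp_of G' vA"
abbreviation "Kb \<equiv> comp_of G' vB"

text \<open>If the cut graph is connected, both members are the same graph and contribute only one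
  copy to the sum.\<close>

definition parts :: "nat \<Rightarrow> ('a, 'b) lgraph" where
  "parts i = (if i = 0 then Ka else Kb)"

text \<open>The cut graph leaves the orientation of the virtual edges open, so the flag is computed;
  both darts must lead from the copy of \<open>v\<close> to the copy of \<open>w\<close>.\<close>

definition darts :: "nat \<Rightarrow> 'b \<times> bool" where
  "darts i = (if i = 0 then (a, tail G' a = vA) else (b, tail G' b = vB))"

lemma start_terminal:
  "start_of parts darts 0 = vA" "start_of parts darts (Suc 0) = vB"
  "terminal_of parts darts 0 = wA" "terminal_of parts darts (Suc 0) = wB"
proof -
  have "tail G' a = vA \<and> head G' a = wA \<or> tail G' a = wA \<and> head G' a = vA"
    "tail G' b = vB \<and> head G' b = wB \<or> tail G' b = wB \<and> head G' b = vB"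
    using joinsa[of "tail G' a" "head G' a"] joinsb[of "tail G' b" "head G' b"] arcs' by (auto simp: joins_def)
  then show "start_of parts darts 0 = vA" "start_of parts darts (Suc 0) = vB"
    "terminal_of parts darts 0 = wA" "terminal_of parts darts (Suc 0) = wB"
    using dist4 by (auto simp: start_of_def terminal_of_def parts_def darts_def bidirect_def)
qed

lemma TG': "vA \<in> verts G'" "wA \<in> verts G'" "vB \<in> verts G'" "wB \<in> verts G'"
  using Tverts by auto

lemma a_in_Ka: "a \<in> arcs Ka"
proof -
  have "joins Ka a vA wA" using joins_comp[OF lg'] joinsa comp_of_self[OF TG'(1)] by blast
  then show ?thesis by (rule joins_arc)
qed

lemma gap_a: "ldist (remove_edge Ka a) vA wA = ereal gA"
proof -
  obtain es where es: "wk G' {} vA es wA" "set es \<subseteq> arcs G" "wt G' es = gA" using gap_walk by blast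
  have "a \<notin> set es" using es(2) ab by auto
  then have wk: "wk (remove_edge Ka a) {} vA es wA"
    using es wk_comp[OF lg'] comp_of_self[OF TG'(1)] by (auto simp: wk_remove_edge)
  have "gA \<le> wt G' fs" if "wk (remove_edge Ka a) {} vA fs wA" for fs
    using that gap_le wk_comp[OF lg'] unfolding wk_remove_edge by blast
  then have "ldist (remove_edge Ka a) vA wA = ereal (wt (remove_edge Ka a) es)"
    by (intro ldist_eqI[OF is_lgraph_remove_edge[OF is_lgraph_comp[OF lg']] wk]) (simp add: es(3))
  then show ?thesis using es(3) by simp
qed

text \<open>With two members each minimum is the gap of the other edge. The gap of \<open>a\<close>
  is \<open>gA\<close>, which is the length of \<open>b\<close>, and conversely.\<close>

lemma summable_parts: "summable_family 2 parts darts"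
proof -
  interpret c: cut r G v w k "- A" G' b a vB wB vA wA by (rule cut_compl)
  have gap: "edge_gap parts darts 0 = ereal gA" "edge_gap parts darts (Suc 0) = ereal gB"
    unfolding edge_gap_def start_terminal using gap_a c.gap_a by (simp_all add: parts_def darts_def)
  have I: "{..<2} - {0} = {Suc 0}" "{..<2} - {Suc 0} = {0::nat}" by auto
  have L: "len (parts 0) (fst (darts 0)) = gB" "len (parts (Suc 0)) (fst (darts (Suc 0))) = gA"
    using lena lenb by (simp_all add: parts_def darts_def)
  have lgp: "is_lgraph (parts i)" for i using is_lgraph_comp[OF lg'] by (simp add: parts_def)
  have arc: "darts i \<in> arcs (bidirect (parts i))" for i
    using a_in_Ka c.a_in_Ka by (simp add: parts_def darts_def bidirect_def)
  have "ereal (len (parts i) (fst (darts i))) = (INF j \<in> {..<2} - {i}. edge_gap parts darts j)" if "i < 2" for i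
  proof -
    from that consider "i = 0" | "i = Suc 0" by (auto simp: less_two)
    then show ?thesis
    proof cases
      case 1
      show ?thesis unfolding 1 I L by (simp add: gap)
    next
      case 2
      show ?thesis unfolding 2 I L by (simp add: gap)
    qed
  qed
  moreover have "start_of parts darts i \<noteq> terminal_of parts darts j" if "i < 2" "j < 2" for i j
    using that start_terminal dist4 by (auto simp: less_two)
  moreover have "inj_on (\<lambda>i. (parts i, fst (darts i))) {..<2}"
    using ab by (auto simp: inj_on_def less_two darts_def)
  ultimately show ?thesis unfolding summable_family_def using lgp arc by auto
qed

text \<open>The condition has content only if both members are the same component; then it is the
  distance of more than \<open>r\<close> between two copies of a vertex.\<close>

lemma local_parts: "local_family r 2 parts darts"
proof -
  have far1: "\<not> enat (wt (parts l) es) \<le> r" if "wk (parts l) {} vA es vB" for l es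
    using that far_v wk_comp[OF lg'] by (auto simp: parts_def split: if_splits)
  have far2: "\<not> enat (wt (parts l) es) \<le> r" if "wk (parts l) {} wA es wB" for l es
    using that far_w wk_comp[OF lg'] by (auto simp: parts_def split: if_splits)
  have far3: "\<not> enat (wt (parts l) es) \<le> r" if "wk (parts l) {} vB es vA" for l es
    using far1[OF wk_rev[OF that]] by (simp add: rev_map[symmetric])
  have far4: "\<not> enat (wt (parts l) es) \<le> r" if "wk (parts l) {} wB es wA" for l es
    using far2[OF wk_rev[OF that]] by (simp add: rev_map[symmetric])
  have lgp: "is_lgraph (parts l)" for l using is_lgraph_comp[OF lg'] by (simp add: parts_def)
  note d = local_dist[OF lgp far1] local_dist[OF lgp far2] local_dist[OF lgp far3] local_dist[OF lgp far4]
  show ?thesis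
    unfolding local_family_def
  proof (intro allI impI)
    fix i j :: nat assume ij: "i < 2" "j < 2" "i \<noteq> j \<and> parts i = parts j"
    then consider "i = 0" "j = Suc 0" | "i = Suc 0" "j = 0" by (auto simp: less_two)
    then show "ereal_of_enat r + 1 \<le> ldist (parts i) (start_of parts darts i) (start_of parts darts j) \<and>
      ereal_of_enat r + 1 \<le> ldist (parts i) (terminal_of parts darts i) (terminal_of parts darts j)"
      by cases (simp_all only: start_terminal d)
  qed
qed

text \<open>As \<open>G\<close> is connected, each vertex has a walk to \<open>v\<close>; up to its
  first visit of \<open>v\<close> or \<open>w\<close> it survives in the cut graph and leads to a
  copy. The virtual edges join the copies on each side.\<close>

lemma comp_parts:
  assumes "conn G" "x \<in> verts G'"
  shows "comp_of G' x \<in> {Ka, Kb}"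
proof -
  have a: "wk G' {} wA [a] vA" and b: "wk G' {} wB [b] vB"
    using joinsa joinsb TG' by (auto intro: wk_single)
  have hit: "comp_of G' x \<in> {Ka, Kb}" if xy: "wk G' {} x es y" "y \<in> T" for x es y
  proof -
    have "\<exists>fs. wk G' {} y fs vA \<or> wk G' {} y fs vB"
      using xy(2) a b wk.Nil[of vA G' "{}"] wk.Nil[of vB G' "{}"] TG' by auto
    then obtain fs where "wk G' {} y fs vA \<or> wk G' {} y fs vB" by blast
    then have "wk G' {} x (es @ fs) vA \<or> wk G' {} x (es @ fs) vB" using wk_append[OF xy(1)] by blast
    then have "vA \<in> verts (comp_of G' x) \<or> vB \<in> verts (comp_of G' x)" by auto
    then show ?thesis
    proof
      assume "vA \<in> verts (comp_of G' x)"
      from comp_of_eq[OF lg' this] show ?thesis by simp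
    next
      assume "vB \<in> verts (comp_of G' x)"
      from comp_of_eq[OF lg' this] show ?thesis by simp
    qed
  qed
  show ?thesis
  proof (cases "x \<in> T")
    case True
    then show ?thesis using hit[OF wk.Nil[of x G' "{}"]] assms(2) by auto
  next
    case False
    then have x: "x \<in> verts G" "x \<notin> {v, w}" using verts' assms(2) by auto
    then obtain es where es: "wk G {} x es v" using assms(1) v unfolding conn_def by blast
    have "\<not> wk G ({} \<union> {v, w}) x es v" using wk_ends[of G "{} \<union> {v, w}" x es v] by auto
    with wk_first_hit[OF es x(2)] obtain es1 f u z where
      *: "wk G ({} \<union> {v, w}) x es1 u" "joins G f u z" "z \<in> {v, w}" by blast
    have u: "u \<notin> {v, w}" using wk_ends[OF *(1)] by auto
    have w1: "wk G' {} x es1 u" by (rule lift_wk[OF *(1)]) auto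
    have em_u: "em v w p q u = u" for p q using u by (auto simp: em_def)
    have "joins G' f u (em v w vA wA z) \<or> joins G' f u (em v w vB wB z)"
      using joinsA[OF joins_arc[OF *(2)]] joinsB[OF joins_arc[OF *(2)]] *(2) em_u by metis
    then obtain t where t: "joins G' f u t" "t \<in> T" using *(3) by auto
    then have "wk G' {} x (es1 @ [f]) t" using wk_snoc[OF w1 t(1)] TG' by auto
    then show ?thesis using hit t(2) by blast
  qed
qed

text \<open>Forming the sum deletes the virtual edges and identifies the copies again, so it undoes
  the cut. Tagging a vertex by its component does no harm, because the component is determined by
  the vertex.\<close>

lemma sum_parts_iso:
  assumes "conn G"
  shows "lgraph_iso (two_sum 2 parts darts) G"
proof -
  let ?U = "two_sum 2 parts darts"
  let ?c = "comp_of G'"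
  define P where "P x = (if x \<in> {vA, vB} then Start else if x \<in> {wA, wB} then Terminal else Rest (?c x, x))" for x
  define f :: "(('a, 'b) lgraph \<times> 'a) sum_vertex \<Rightarrow> 'a" where
    "f s = (case s of Start \<Rightarrow> v | Terminal \<Rightarrow> w | Rest p \<Rightarrow> snd p)" for s
  have fP: "f (P x) = pr x" for x by (auto simp: f_def P_def pr_def)
  have K: "K = ?c x" if "K \<in> {Ka, Kb}" "x \<in> verts K" for K x
  proof -
    from that(1) have "K = Ka \<or> K = Kb" by simp
    then show ?thesis
    proof
      assume "K = Ka"
      then show ?thesis using comp_of_eq[OF lg', of x vA] that(2) by simp
    next
      assume "K = Kb"
      then show ?thesis using comp_of_eq[OF lg', of x vB] that(2) by simp
    qed
  qed
  have proj: "sum_proj 2 parts darts (?c x) x = P x" if "x \<in> verts G'" for x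
  proof -
    have "(\<exists>i<2. parts i = ?c x \<and> start_of parts darts i = x) \<longleftrightarrow> x \<in> {vA, vB}"
      using start_terminal by (auto simp: less_two parts_def)
    moreover have "wA \<in> verts Ka" "wB \<in> verts Kb"
      using wk_single[of G' a vA wA "{}"] wk_single[of G' b vB wB "{}"] joinsa joinsb TG' by auto
    then have c: "?c wA = Ka" "?c wB = Kb" using comp_of_eq[OF lg'] by blast+
    have ex2: "(\<exists>i<2. Q i) \<longleftrightarrow> Q 0 \<or> Q (Suc 0)" for Q :: "nat \<Rightarrow> bool" by (auto simp: less_two)
    have "(\<exists>i<2. parts i = ?c x \<and> terminal_of parts darts i = x) \<longleftrightarrow> x \<in> {wA, wB}"
      unfolding ex2 start_terminal by (cases "x = wA"; cases "x = wB") (simp_all add: parts_def c)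
    ultimately show ?thesis unfolding sum_proj_def P_def by (simp only:)
  qed
  have parts: "parts ` {..<2} = {Ka, Kb}" by (auto simp: parts_def less_two)
  have removed: "(\<lambda>i. (parts i, fst (darts i))) ` {..<2} = {(Ka, a), (Kb, b)}"
    by (auto simp: parts_def darts_def less_two image_iff)
  have vU: "verts ?U = P ` verts G'"
  proof
    show "verts ?U \<subseteq> P ` verts G'"
    proof
      fix s assume "s \<in> verts ?U"
      then obtain K x where *: "s = sum_proj 2 parts darts K x" "K \<in> {Ka, Kb}" "x \<in> verts K"
        unfolding two_sum_def parts by auto
      have Kc: "K = ?c x" by (rule K[OF *(2,3)])
      have x: "x \<in> verts G'" using *(3) verts_comp_subset[of G' x] unfolding Kc by (rule rev_subsetD)
      have "s = P x" using *(1) proj[OF x] unfolding Kc by (rule trans)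
      then show "s \<in> P ` verts G'" using x by (rule image_eqI)
    qed
    show "P ` verts G' \<subseteq> verts ?U"
    proof
      fix s assume "s \<in> P ` verts G'"
      then obtain x where x: "x \<in> verts G'" "s = P x" by auto
      then show "s \<in> verts ?U"
        using comp_parts[OF assms x(1)] comp_of_self[OF x(1)] proj[OF x(1)]
        unfolding two_sum_def parts by (simp del: comp_simps) metis
    qed
  qed
  have aU: "(K, e) \<in> arcs ?U \<longleftrightarrow> e \<in> arcs G \<and> K = ?c (tail G' e)" for K e
  proof
    assume *: "(K, e) \<in> arcs ?U"
    then have K1: "K \<in> {Ka, Kb}" "e \<in> arcs K" "(K, e) \<noteq> (Ka, a)" "(K, e) \<noteq> (Kb, b)"
      unfolding two_sum_def parts removed by auto
    have "joins K e (tail G' e) (head G' e)" using K1 by (auto simp: joins_def)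
    then have t: "tail G' e \<in> verts K" using K1(1) joins_comp[OF lg'] by blast
    have Kc: "K = ?c (tail G' e)" by (rule K[OF K1(1) t])
    have "arcs K \<subseteq> arcs G'" using arcs_comp_subset[of G' "tail G' e"] by (simp only: Kc[symmetric])
    then have "e \<in> arcs G'" using K1(2) by (rule subsetD)
    moreover have "e \<noteq> a"
    proof
      assume e: "e = a"
      have "joins Ka e (tail G' e) (head G' e)" using a_in_Ka e by (simp add: joins_def)
      then have "tail G' e \<in> verts Ka" using joins_comp[OF lg'] by blast
      from K[OF _ this] have "Ka = ?c (tail G' e)" by simp
      then have "K = Ka" by (rule trans[OF Kc sym])
      then show False using K1(3) e by simp
    qed
    moreover have "e \<noteq> b"
    proof
      assume e: "e = b"
      have "joins Kb e (tail G' e) (head G' e)" using cut.a_in_Ka[OF cut_compl] e by (simp add: joins_def)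
      then have "tail G' e \<in> verts Kb" using joins_comp[OF lg'] by blast
      from K[OF _ this] have "Kb = ?c (tail G' e)" by simp
      then have "K = Kb" by (rule trans[OF Kc sym])
      then show False using K1(4) e by simp
    qed
    ultimately show "e \<in> arcs G \<and> K = ?c (tail G' e)" using Kc arcs' by auto
  next
    assume *: "e \<in> arcs G \<and> K = ?c (tail G' e)"
    then have e: "e \<in> arcs G'" "e \<noteq> a" "e \<noteq> b" using arcs' ab by auto
    then have t: "tail G' e \<in> verts G'" using is_lgraphD(3)[OF lg'] by blast
    have "joins K e (tail G' e) (head G' e)"
      unfolding conjunct2[OF *] joins_comp[OF lg'] using e comp_of_self[OF t] by (simp add: joins_def del: comp_simps)
    then have "e \<in> arcs K" by (rule joins_arc)
    then show "(K, e) \<in> arcs ?U"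
      unfolding two_sum_def parts removed using comp_parts[OF assms t] * e by auto
  qed
  have "bij_betw f (verts ?U) (verts G)"
    unfolding bij_betw_def
  proof
    show "inj_on f (verts ?U)"
      unfolding vU
    proof (rule inj_onI, elim imageE)
      fix s s' x y assume *: "f s = f s'" "s = P x" "s' = P y" "x \<in> verts G'" "y \<in> verts G'"
      then have eq: "pr x = pr y" using fP by simp
      have px: "pr x \<in> {v, w} \<longleftrightarrow> x \<in> T" "pr y \<in> {v, w} \<longleftrightarrow> y \<in> T"
        using pr_old *(4,5) by (auto simp: pr_def)
      show "s = s'"
      proof (cases "x \<in> T")
        case True
        then have "y \<in> T" using px eq by simp
        then show ?thesis using True eq * vw dist4 by (auto simp: P_def)
      next
        case False
        then have "y \<notin> T" using px eq by simp
        with pr_old[OF *(4) False] pr_old[OF *(5)] eq have "x = y" by simp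
        then show ?thesis using *(2,3) by simp
      qed
    qed
    have "pr ` verts G' = verts G"
    proof
      show "pr ` verts G' \<subseteq> verts G" using pr_verts by blast
      show "verts G \<subseteq> pr ` verts G'"
      proof
        fix x assume x: "x \<in> verts G"
        consider "x = v" | "x = w" | "x \<notin> {v, w}" by blast
        then show "x \<in> pr ` verts G'"
        proof cases
          case 1
          then show ?thesis using TG'(1) pr_simps(1) by (metis imageI)
        next
          case 2
          then show ?thesis using TG'(2) pr_simps(3) by (metis imageI)
        next
          case 3
          then have "x \<in> verts G'" "x \<notin> T" using x verts' fresh4 by auto
          then show ?thesis using pr_old by (metis imageI)
        qed
      qed
    qed
    then show "f ` verts ?U = verts G" unfolding vU image_image fP .
  qed
  moreover have "bij_betw snd (arcs ?U) (arcs G)"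
    unfolding bij_betw_def
  proof
    show "inj_on snd (arcs ?U)" using aU by (auto simp: inj_on_def)
    have "e \<in> snd ` arcs ?U" if "e \<in> arcs G" for e
      using aU[of "?c (tail G' e)" e] that by (metis image_eqI snd_conv)
    then show "snd ` arcs ?U = arcs G" using aU by auto
  qed
  moreover have "{f (tail ?U p), f (head ?U p)} = {tail G (snd p), head G (snd p)} \<and> len ?U p = len G (snd p)"
    if p: "p \<in> arcs ?U" for p
  proof -
    obtain K e where Ke: "p = (K, e)" by (cases p)
    then have e: "e \<in> arcs G" "K = ?c (tail G' e)" using p aU by auto
    have e': "e \<in> arcs G'" using e arcs' by auto
    have th: "tail G' e \<in> verts G'" "head G' e \<in> verts G'" using is_lgraphD(3,4)[OF lg' e'] .
    have j: "joins G' e (tail G' e) (head G' e)" using e' by (simp add: joins_def)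
    have "head G' e \<in> verts (?c (tail G' e))"
      using wk_single[OF j, of "{}"] th by auto
    then have "?c (head G' e) = K" using comp_of_eq[OF lg'] e(2) by blast
    moreover have "tail K = tail G'" "head K = head G'" "len K = len G'" using e(2) by auto
    ultimately have "f (tail ?U p) = pr (tail G' e)" "f (head ?U p) = pr (head G' e)" "len ?U p = len G e"
      using proj[OF th(1)] proj[OF th(2)] fP e(2) len'[OF e(1)]
      unfolding Ke two_sum_def by auto
    then show ?thesis using joins_pr[OF e(1) j] Ke by (auto simp: joins_def)
  qed
  ultimately show ?thesis unfolding lgraph_iso_def by blast
qed

text \<open>If the copies on the other side are not in the component, it gains only \<open>a\<close>
  and loses at least the two edges outside \<open>A\<close> at \<open>v\<close> or
  \<open>w\<close>.\<close>

lemma card_arcs_less: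
  assumes "\<exists>e \<in> - A. \<exists>f \<in> - A. e \<noteq> f \<and> (inc G e v \<or> inc G e w) \<and> (inc G f v \<or> inc G f w)"
    and "vB \<notin> verts Ka"
  shows "card (arcs Ka) < card (arcs G)"
proof -
  obtain e f where ef: "e \<notin> A" "f \<notin> A" "e \<noteq> f" "inc G e v \<or> inc G e w" "inc G f v \<or> inc G f w"
    using assms(1) by blast
  have arc: "e \<in> arcs G" "f \<in> arcs G" using ef by (auto simp: inc_def)
  have wB: "wB \<notin> verts Ka"
  proof
    assume "wB \<in> verts Ka"
    then have "joins Ka b wB vB" using joins_comp[OF lg'] joinsb by blast
    from joins_symD[OF this] have "vB \<in> verts Ka" using joins_comp[OF lg'] by blast
    then show False using assms(2) by blast
  qed
  have out: "g \<notin> arcs Ka" if g: "g \<notin> A" "inc G g v \<or> inc G g w" for g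
  proof
    assume gK: "g \<in> arcs Ka"
    have "g \<in> arcs G" using g by (auto simp: inc_def)
    have "\<exists>y. joins G' g vB y \<or> joins G' g wB y"
      using g joinsB[OF \<open>g \<in> arcs G\<close> g(1)] em_v em_w unfolding inc_joins by metis
    then obtain x y where j: "joins G' g x y" "x \<in> {vB, wB}" by blast
    then have "joins Ka g x y" using gK by (auto simp: joins_def)
    then have "x \<in> verts Ka" using joins_comp[OF lg'] by blast
    then show False using j(2) assms(2) wB by blast
  qed
  have "b \<notin> arcs Ka"
  proof
    assume "b \<in> arcs Ka"
    moreover have "joins G' b vB wB" using joinsb by blast
    ultimately have "joins Ka b vB wB" by (auto simp: joins_def)
    then show False using assms(2) joins_comp[OF lg'] by blast
  qed
  then have "arcs Ka \<subseteq> insert a (arcs G - {e, f})"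
    using out[OF ef(1,4)] out[OF ef(2,5)] arcs_comp_subset[of G' vA] arcs' by blast
  then have "card (arcs Ka) \<le> card (insert a (arcs G - {e, f}))"
    using is_lgraphD(2)[OF lg] by (intro card_mono) auto
  also have "\<dots> \<le> Suc (card (arcs G - {e, f}))" by (rule card_insert_le_m1) simp_all
  also have "card (arcs G - {e, f}) = card (arcs G) - 2"
    using arc ef(3) is_lgraphD(2)[OF lg] by (subst card_Diff_subset) auto
  also have "Suc (card (arcs G) - 2) < card (arcs G)"
    using card_mono[of "arcs G" "{e, f}"] arc ef(3) is_lgraphD(2)[OF lg] by auto
  finally show ?thesis .
qed

end

section \<open>Irreducible graphs with few vertices\<close>

text \<open>A short closed walk that starts with \<open>e\<close> consists of two walks between
  \<open>v\<close> and \<open>w\<close>, and one of them has at most half its length.\<close>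

lemma conn_path_len:
  assumes "loc2 r G" "joins G e v w"
  shows "\<exists>es. wk G {} v es w \<and> enat (2 * wt G es) \<le> r"
proof -
  have G: "is_lgraph G" using assms(1) by (simp add: loc2_def)
  note vw = joins_verts[OF G assms(2)]
  have inc: "inc G e v" using assms(2) by (auto simp: inc_joins)
  obtain e' f' where "e' \<noteq> f'" "inc G e' v" "inc G f' v" using assms(1) vw unfolding loc2_def by blast
  then obtain h where h: "short r G v e h"
    using linked_other[of r G v e' f' e] assms(1) vw inc unfolding loc2_def by blast
  then obtain x y es where *: "joins G e v x" "wk G {v} x es y" "joins G h y v"
    "enat (len G e + wt G es + len G h) \<le> r" unfolding short_def by blast
  have x: "x = w" using joins_ends[OF assms(2) *(1)] vw by auto
  have y: "y \<in> verts G" using wk_ends[OF *(2)] by blast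
  have 1: "wk G {} v [e] w" using assms(2) vw by (auto intro: wk_single)
  have "wk G {} w (es @ [h]) v"
    by (rule wk_snoc[OF wk_mono[OF *(2)[unfolded x]] *(3)]) (use vw in auto)
  then have 2: "wk G {} v (rev (es @ [h])) w" by (rule wk_rev)
  have "enat (2 * wt G [e]) \<le> r \<or> enat (2 * wt G (rev (es @ [h]))) \<le> r"
    using *(4) by (cases r) (auto simp: rev_map[symmetric])
  then show ?thesis using 1 2 by blast
qed

text \<open>The end edges of a segment with an inner vertex do not join \<open>v\<close> and
  \<open>w\<close>, so no segment of any length changes sides.\<close>

lemma sep_of_parallel:
  assumes "loc2 r G" "A \<noteq> {}" "\<And>e. e \<in> A \<Longrightarrow> joins G e v w" "g \<notin> A" "inc G g v \<or> inc G g w"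
  shows "\<exists>k. sep r G v w k A"
proof -
  have G: "is_lgraph G" using assms(1) by (simp add: loc2_def)
  obtain e where e: "e \<in> A" using assms(2) by blast
  then have j: "joins G e v w" using assms(3) by blast
  note vw = joins_verts[OF G j]
  obtain es0 where es0: "wk G {} v es0 w" "enat (2 * wt G es0) \<le> r"
    using conn_path_len[OF assms(1) j] by blast
  define k where "k = (LEAST n. \<exists>es. wk G {} v es w \<and> wt G es = n)"
  have k: "\<exists>es. wk G {} v es w \<and> wt G es = k"
    unfolding k_def by (rule LeastI_ex) (use es0 in blast)
  have kmin: "k \<le> wt G es" if "wk G {} v es w" for es
    unfolding k_def by (rule Least_le) (use that in blast)
  have k2: "enat (2 * k) \<le> r"
    using kmin[OF es0(1)] es0(2) by (meson enat_ord_simps(1) mult_le_mono2 order_trans)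
  have "sep r G v w k A"
  proof
    fix s t es assume st: "s \<in> {v, w}" "t \<in> {v, w}" "sg G {v, w} s es t"
    show "hd es \<in> A \<longleftrightarrow> last es \<in> A"
      using st(3)[unfolded sg_def]
    proof (elim disjE exE conjE)
      fix e x ms y f
      assume *: "es = e # ms @ [f]" "joins G e s x" "wk G {v, w} x ms y" "joins G f y t"
      have xy: "x \<notin> {v, w}" "y \<notin> {v, w}" using wk_ends[OF *(3)] by auto
      have "e \<notin> A" using joins_ends[OF assms(3)[of e] *(2)] xy by auto
      moreover have "f \<notin> A" using joins_ends[OF assms(3)[of f] *(4)] xy by auto
      ultimately show ?thesis using *(1) by simp
    qed simp
  qed (use assms(1) vw k kmin k2 e j assms(4,5) in \<open>auto simp: inc_joins\<close>)
  then show ?thesis ..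
qed

text \<open>A side always has edges at both vertices, so a side with only one edge at them is a
  single edge between \<open>v\<close> and \<open>w\<close>; cutting it off would leave a graph
  isomorphic to \<open>G\<close>. Two edges on each side ensure progress.\<close>

definition reducible :: "enat \<Rightarrow> ('a, 'b) lgraph \<Rightarrow> bool" where
  "reducible r G \<longleftrightarrow> (\<exists>v w k A. sep r G v w k A \<and>
    (\<exists>e \<in> A. \<exists>f \<in> A. e \<noteq> f \<and> (inc G e v \<or> inc G e w) \<and> (inc G f v \<or> inc G f w)) \<and>
    (\<exists>e \<in> - A. \<exists>f \<in> - A. e \<noteq> f \<and> (inc G e v \<or> inc G e w) \<and> (inc G f v \<or> inc G f w)))"

text \<open>With two further edges at \<open>v\<close> or \<open>w\<close>, the two parallel edges
  would be one side of a cut.\<close>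

lemma irreducible_parallel:
  assumes "loc2 r G" "\<not> reducible r G" "joins G e1 v w" "joins G e2 v w" "e1 \<noteq> e2"
    and "inc G g v \<or> inc G g w" "inc G h v \<or> inc G h w" "g \<notin> {e1, e2}" "h \<notin> {e1, e2}"
  shows "g = h"
proof (rule ccontr)
  assume "g \<noteq> h"
  obtain k where "sep r G v w k {e1, e2}"
    using sep_of_parallel[OF assms(1), of "{e1, e2}" v w g] assms(3-8) by auto
  moreover have "inc G e1 v" "inc G e2 v" using assms(3,4) by (auto simp: inc_joins)
  ultimately have "reducible r G"
    unfolding reducible_def using assms(5-9) \<open>g \<noteq> h\<close> by blast
  then show False using assms(2) by blast
qed

text \<open>Three parallel edges form a 2-sum of three cycles of length two, but not one of only two smaller graphs.\<close>

locale dipole =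
  fixes r :: enat and G :: "(nat, nat) lgraph" and x y :: nat and e :: "nat \<Rightarrow> nat"
  assumes loc2: "loc2 r G" and verts: "verts G = {x, y}" and arcs: "arcs G = {e 0, e 1, e 2}"
    and dist: "e 0 \<noteq> e 1" "e 0 \<noteq> e 2" "e 1 \<noteq> e 2"
    and joins: "\<And>i. i < 3 \<Longrightarrow> joins G (e i) x y"
begin

lemma lg: "is_lgraph G"
  using loc2 by (simp add: loc2_def)

lemma xy: "x \<noteq> y" "x \<in> verts G" "y \<in> verts G"
  using joins_verts[OF lg joins[of 0]] by auto

definition l :: "nat \<Rightarrow> nat" where "l i = len G (e i)"

text \<open>The length of the virtual edge in the cycle for \<open>e i\<close>: the minimum of the
  gaps of the other two cycles.\<close>

definition m :: "nat \<Rightarrow> nat" where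
  "m i = (if i = 0 then min (l 1) (l 2) else if i = 1 then min (l 0) (l 2) else min (l 0) (l 1))"

lemma less_three: "(i::nat) < 3 \<longleftrightarrow> i = 0 \<or> i = 1 \<or> i = 2"
  by auto

lemma e_inj: "i < 3 \<Longrightarrow> j < 3 \<Longrightarrow> e i = e j \<Longrightarrow> i = j"
  using dist by (auto simp: less_three)

lemma m_le: "i < 3 \<Longrightarrow> j < 3 \<Longrightarrow> j \<noteq> i \<Longrightarrow> m i \<le> l j"
  by (auto simp: less_three m_def)

lemma l_pos: "i < 3 \<Longrightarrow> 0 < l i"
  using is_lgraphD(6)[OF lg] joins_arc[OF joins] by (simp add: l_def)

text \<open>By linkedness some short closed walk at \<open>x\<close> leaves by \<open>e i\<close>
  and returns by another edge, which is at least as long as \<open>m i\<close>.\<close>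

lemma l_m: "i < 3 \<Longrightarrow> enat (l i + m i) \<le> r"
proof -
  assume i: "i < 3"
  have inc: "inc G (e j) x" if "j < 3" for j using joins[OF that] by (auto simp: inc_joins)
  have "linked_at r G x" using loc2 xy by (simp add: loc2_def)
  from linked_other[OF this inc[of 0] inc[of 1] dist(1) inc[OF i]] obtain h where
    h: "h \<noteq> e i" "short r G x (e i) h" by auto
  then obtain p q es where *: "joins G h q x" "enat (len G (e i) + wt G es + len G h) \<le> r"
    unfolding short_def by blast
  have "h \<in> arcs G" using *(1) joins_arc by fast
  then obtain j where j: "j < 3" "h = e j" using arcs by (auto simp: less_three)
  then have "m i \<le> len G h" using m_le[OF i j(1)] h(1) by (auto simp: l_def)
  then have "l i + m i \<le> len G (e i) + wt G es + len G h" by (simp add: l_def)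
  then show ?thesis using *(2) by (meson enat_ord_simps(1) order_trans)
qed

text \<open>Edge 0 is a copy of \<open>e i\<close> and edge 1 is virtual. The vertices depend on
  \<open>i\<close>, so the three cycles are different graphs even when their lengths agree, and
  locality of the family is vacuous.\<close>

definition C :: "nat \<Rightarrow> (nat, nat) lgraph" where
  "C i = \<lparr> verts = {2 * i, 2 * i + 1}, arcs = {0, 1}, tail = (\<lambda>_. 2 * i), head = (\<lambda>_. 2 * i + 1),
     len = (\<lambda>e. if e = 0 then l i else m i) \<rparr>"

lemma C_simps: "verts (C i) = {2 * i, 2 * i + 1}" "arcs (C i) = {0, 1}" "tail (C i) = (\<lambda>_. 2 * i)"
  "head (C i) = (\<lambda>_. 2 * i + 1)" "len (C i) = (\<lambda>e. if e = 0 then l i else m i)"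
  by (simp_all add: C_def)

lemma C_inj: "C i = C j \<longleftrightarrow> i = j"
proof
  assume "C i = C j"
  then have "tail (C i) 0 = tail (C j) 0" by simp
  then show "i = j" by (simp add: C_simps)
qed simp

lemma C_lg: "i < 3 \<Longrightarrow> is_lgraph (C i)"
  using l_pos[of 0] l_pos[of 1] l_pos[of 2] by (intro is_lgraphI) (auto simp: C_simps m_def less_three)

lemma C_joins: "joins (C i) a p q \<longleftrightarrow> a \<in> {0, 1} \<and> (p = 2 * i \<and> q = 2 * i + 1 \<or> p = 2 * i + 1 \<and> q = 2 * i)"
  by (auto simp: joins_def C_simps)

lemma C_cycle: assumes i: "i < 3" shows "cycle_graph_upto r (C i)"
proof (rule cycle_graph_if_degree_2)
  have inc: "inc (C i) a p \<longleftrightarrow> a \<in> {0, 1} \<and> p \<in> verts (C i)" for a p by (auto simp: inc_def C_simps)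
  have sh: "short r (C i) p 0 1" if p: "p \<in> verts (C i)" for p
  proof -
    define q where "q = (if p = 2 * i then 2 * i + 1 else 2 * i)"
    have q: "q \<in> verts (C i)" "q \<noteq> p" "joins (C i) 0 p q" "joins (C i) 1 q p"
      using p unfolding q_def C_joins C_simps by auto
    have "wk (C i) {p} q [] q" using q by (simp add: wk_Nil_iff)
    then show ?thesis unfolding short_def using q(3,4) l_m[OF i]
      by (intro exI[of _ q] exI[of _ "[]"]) (simp add: C_simps)
  qed
  show "loc2 r (C i)"
    unfolding loc2_def
  proof (intro conjI ballI)
    show "is_lgraph (C i)" by (rule C_lg[OF i])
    fix p assume p: "p \<in> verts (C i)"
    show "\<exists>e f. e \<noteq> f \<and> inc (C i) e p \<and> inc (C i) f p"
      using inc p by (intro exI[of _ 0] exI[of _ 1]) simp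
    show "linked_at r (C i) p"
      unfolding linked_at_def
    proof (intro allI impI)
      fix A a b
      assume A: "\<forall>e f. short r (C i) p e f \<longrightarrow> (e \<in> A) = (f \<in> A)" and ab: "inc (C i) a p" "inc (C i) b p"
      have "(0 \<in> A) = (1 \<in> A)" using A sh[OF p] by blast
      moreover have "a = 0 \<or> a = 1" "b = 0 \<or> b = 1" using ab inc by auto
      ultimately show "(a \<in> A) = (b \<in> A)" by blast
    qed
  qed
  show "conn (C i)"
    unfolding conn_def
  proof (intro conjI ballI)
    fix p q assume pq: "p \<in> verts (C i)" "q \<in> verts (C i)"
    show "\<exists>es. wk (C i) {} p es q"
    proof (cases "p = q")
      case True
      then show ?thesis using pq by (intro exI[of _ "[]"]) (simp add: wk_Nil_iff)
    next
      case False
      then have "joins (C i) 0 p q" using pq unfolding C_joins by (auto simp: C_simps)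
      then show ?thesis using pq by (intro exI[of _ "[0]"]) (auto intro: wk_single)
    qed
  qed (simp add: C_simps)
  show "a = b \<or> b = c \<or> a = c" if "inc (C i) a p" "inc (C i) b p" "inc (C i) c p" for p a b c
    using that inc by auto
qed

definition d :: "nat \<Rightarrow> nat \<times> bool" where "d i = (1, True)"

lemma ends: "start_of C d i = 2 * i" "terminal_of C d i = 2 * i + 1"
  by (simp_all add: start_of_def terminal_of_def d_def bidirect_def C_simps)

lemma gap: "i < 3 \<Longrightarrow> edge_gap C d i = ereal (l i)"
proof -
  assume i: "i < 3"
  let ?K = "remove_edge (C i) 1"
  have K: "is_lgraph ?K" by (rule is_lgraph_remove_edge[OF C_lg[OF i]])
  have "wk (C i) {} (2 * i) [0] (2 * i + 1)" by (rule wk_single) (auto simp: C_joins C_simps)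
  then have 1: "wk ?K {} (2 * i) [0] (2 * i + 1)" by (simp add: wk_remove_edge)
  have "l i \<le> wt (C i) es" if es: "wk ?K {} (2 * i) es (2 * i + 1)" for es
  proof (cases es)
    case Nil
    then show ?thesis using es by (simp add: wk_Nil_iff)
  next
    case (Cons a as)
    have "a = 0" using wk_arcs[OF es] Cons by (auto simp: remove_edge_def C_simps)
    then show ?thesis using Cons by (simp add: C_simps)
  qed
  then have "ldist ?K (2 * i) (2 * i + 1) = ereal (wt ?K [0])"
    by (intro ldist_eqI[OF K 1]) (simp add: C_simps)
  then show ?thesis by (simp add: edge_gap_def ends d_def C_simps)
qed

lemma summable: "summable_family 3 C d"
proof -
  have I: "{..<3} - {0} = {1, 2::nat}" "{..<3} - {1} = {0, 2::nat}" "{..<3} - {2} = {0, 1::nat}" by auto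
  have "ereal (m i) = (INF j \<in> {..<3} - {i}. edge_gap C d j)" if "i < 3" for i
  proof -
    have mm: "ereal (real (min a b)) = inf (ereal (real a)) (ereal (real b))" for a b
      by (simp add: inf_min min_def)
    from that consider "i = 0" | "i = 1" | "i = 2" by (auto simp: less_three)
    then show ?thesis
    proof cases
      case 1
      then show ?thesis using gap[of 1] gap[of 2] unfolding 1 I by (simp add: mm m_def)
    next
      case 2
      then show ?thesis using gap[of 0] gap[of 2] unfolding 2 I by (simp add: mm m_def)
    next
      case 3
      then show ?thesis using gap[of 0] gap[of 1] unfolding 3 I by (simp add: mm m_def)
    qed
  qed
  then have "\<forall>i<3. ereal (len (C i) (fst (d i))) = (INF j \<in> {..<3} - {i}. edge_gap C d j)"
    by (simp add: C_simps d_def)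
  then show ?thesis
    unfolding summable_family_def using C_lg
    by (auto simp: inj_on_def C_inj ends d_def bidirect_def C_simps)
qed

lemma iso: "lgraph_iso (two_sum 3 C d) G"
proof -
  let ?U = "two_sum 3 C d"
  define f :: "((nat, nat) lgraph \<times> nat) sum_vertex \<Rightarrow> nat" where
    "f s = (case s of Start \<Rightarrow> x | _ \<Rightarrow> y)" for s
  define g :: "(nat, nat) lgraph \<times> nat \<Rightarrow> nat" where
    "g p = e (tail (fst p) 0 div 2)" for p
  have g: "g (C i, a) = e i" for i a by (simp add: g_def C_simps)
  have P: "sum_proj 3 C d (C i) (2 * i) = Start" "sum_proj 3 C d (C i) (2 * i + 1) = Terminal" if "i < 3" for i
    using that by (auto simp: sum_proj_def ends C_inj)
  have "verts ?U = {Start, Terminal}"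
  proof
    show "verts ?U \<subseteq> {Start, Terminal}" using P by (auto simp: two_sum_def C_simps)
    have "C 0 \<in> C ` {..<3}" by simp
    then have "sum_proj 3 C d (C 0) p \<in> verts ?U" if "p \<in> verts (C 0)" for p
      using that unfolding two_sum_def by (simp only: pre_digraph.simps mem_Collect_eq) blast
    from this[of "2 * 0"] this[of "2 * 0 + 1"] P[of 0] have "Start \<in> verts ?U \<and> Terminal \<in> verts ?U"
      by (simp add: C_simps)
    then show "{Start, Terminal} \<subseteq> verts ?U" by blast
  qed
  then have "bij_betw f (verts ?U) (verts G)"
    using xy verts by (auto simp: bij_betw_def f_def)
  moreover have aU: "arcs ?U = (\<lambda>i. (C i, 0)) ` {..<3}"
    by (auto simp: two_sum_def C_simps d_def)
  have "bij_betw g (arcs ?U) (arcs G)"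
    unfolding bij_betw_def
  proof
    show "inj_on g (arcs ?U)" unfolding aU using e_inj by (auto simp: inj_on_def g)
    have "g ` arcs ?U = e ` {..<3}" unfolding aU image_image g ..
    also have "{..<3} = {0, 1, 2::nat}" by auto
    also have "e ` {0, 1, 2} = arcs G" using arcs by simp
    finally show "g ` arcs ?U = arcs G" .
  qed
  moreover have "{f (tail ?U p), f (head ?U p)} = {tail G (g p), head G (g p)} \<and> len ?U p = len G (g p)"
    if p: "p \<in> arcs ?U" for p
  proof -
    obtain i where i: "i < 3" "p = (C i, 0)" using p unfolding aU by blast
    have "tail ?U p = Start" "head ?U p = Terminal" "len ?U p = l i"
      using P[OF i(1)] i(2) by (simp_all add: two_sum_def C_simps)
    then show ?thesis using joins[OF i(1)] i(2) by (auto simp: f_def g joins_def l_def)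
  qed
  ultimately show ?thesis unfolding lgraph_iso_def by blast
qed

lemma obtainable: "obtainable r G"
proof (rule obtainable.local_2_sum[OF _ summable _ lg iso])
  show "\<forall>i<3. obtainable r (C i)" using C_cycle obtainable.short_cycle by blast
  show "local_family r 3 C d" by (auto simp: local_family_def C_inj)
qed

end

text \<open>If some vertex \<open>x\<close> has three edges, two of them end in the same vertex
  \<open>y\<close>, as there are at most three vertices. Irreducibility leaves only one further edge
  at \<open>x\<close> and \<open>y\<close>, and this must be a third parallel edge.\<close>

lemma obtainable_few_vertices:
  fixes G :: "(nat, nat) lgraph"
  assumes "loc2 r G" "conn G" "\<not> reducible r G" "card (verts G) < 4"
  shows "obtainable r G"
proof (cases "\<forall>x e f g. inc G e x \<longrightarrow> inc G f x \<longrightarrow> inc G g x \<longrightarrow> e = f \<or> f = g \<or> e = g")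
  case True
  then show ?thesis
    using cycle_graph_if_degree_2[OF assms(1,2)] obtainable.short_cycle by blast
next
  case False
  have G: "is_lgraph G" using assms(1) by (simp add: loc2_def)
  obtain x e f g where inc: "inc G e x" "inc G f x" "inc G g x" and ne: "e \<noteq> f" "f \<noteq> g" "e \<noteq> g"
    using False by blast
  obtain ye yf yg where j: "joins G e x ye" "joins G f x yf" "joins G g x yg"
    using inc unfolding inc_joins by blast
  note jv = joins_verts[OF G j(1)] joins_verts[OF G j(2)] joins_verts[OF G j(3)]
  have card: "card S \<le> 3" if "S \<subseteq> verts G" for S
    using card_mono[OF is_lgraphD(1)[OF G] that] assms(4) by simp
  have "\<not> (ye \<noteq> yf \<and> yf \<noteq> yg \<and> ye \<noteq> yg)"
  proof
    assume "ye \<noteq> yf \<and> yf \<noteq> yg \<and> ye \<noteq> yg"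
    then have "card {x, ye, yf, yg} = 4" using jv by simp
    then show False using card[of "{x, ye, yf, yg}"] jv by simp
  qed
  then obtain e1 e2 e3 y z where E: "joins G e1 x y" "joins G e2 x y" "joins G e3 x z"
    "e1 \<noteq> e2" "e2 \<noteq> e3" "e1 \<noteq> e3"
    using j ne by metis
  have xyz: "x \<in> verts G" "y \<in> verts G" "z \<in> verts G" "x \<noteq> y" "x \<noteq> z"
    using joins_verts[OF G E(1)] joins_verts[OF G E(3)] by auto
  have only: "h = e3" if "inc G h x \<or> inc G h y" "h \<noteq> e1" "h \<noteq> e2" for h
    using irreducible_parallel[OF assms(1,3) E(1,2,4) that(1), of e3] that E by (auto simp: inc_joins)
  \<comment> \<open>A second edge at \<open>z\<close> would end in \<open>x\<close> or
    \<open>y\<close> and contradict \<open>only\<close>, since there is no fourth vertex.\<close>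
  have zy: "z = y"
  proof (rule ccontr)
    assume zy: "z \<noteq> y"
    obtain h1 h2 where "h1 \<noteq> h2" "inc G h1 z" "inc G h2 z" using assms(1) xyz unfolding loc2_def by blast
    then obtain h where h: "h \<noteq> e3" "inc G h z" by metis
    obtain u where u: "joins G h z u" using h(2) by (auto simp: inc_joins)
    note uv = joins_verts[OF G u]
    have "u = x \<or> u = y"
    proof (rule ccontr)
      assume "\<not> (u = x \<or> u = y)"
      then have "card {x, y, z, u} = 4" using xyz uv zy by simp
      then show False using card[of "{x, y, z, u}"] xyz uv by simp
    qed
    then have "inc G h x \<or> inc G h y" using joins_symD[OF u] by (auto simp: inc_joins)
    moreover have "h \<noteq> e1" "h \<noteq> e2" using u joins_ends[OF E(1)] joins_ends[OF E(2)] zy xyz by metis+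
    ultimately show False using only h(1) by blast
  qed
  have vx: "u \<in> {x, y}" if "wk G {} p es u" "p \<in> {x, y}" for p es u
    using that
  proof (induction rule: wk.induct)
    case (Cons h p q es u)
    have "inc G h x \<or> inc G h y" using Cons(1) Cons.prems by (auto simp: inc_joins)
    then have "h = e1 \<or> h = e2 \<or> h = e3" using only by blast
    then have "joins G h x y" using E zy by auto
    then have "q \<in> {x, y}" using joins_ends[OF _ Cons(1)] by auto
    then show ?case using Cons.IH by blast
  qed simp
  have verts: "verts G = {x, y}"
  proof
    show "verts G \<subseteq> {x, y}" using assms(2) vx xyz unfolding conn_def by blast
  qed (use xyz in auto)
  have arcs: "arcs G = {e1, e2, e3}"
  proof
    show "arcs G \<subseteq> {e1, e2, e3}"
    proof
      fix h assume h: "h \<in> arcs G"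
      then have "tail G h \<in> {x, y}" using is_lgraphD(3)[OF G] verts by blast
      then have "inc G h x \<or> inc G h y" using h by (auto simp: inc_def)
      then show "h \<in> {e1, e2, e3}" using only by blast
    qed
    show "{e1, e2, e3} \<subseteq> arcs G" using E joins_arc by fast
  qed
  define en where "en i = (if i = 0 then e1 else if i = Suc 0 then e2 else e3)" for i :: nat
  have "dipole r G x y en"
    by unfold_locales (use assms(1) verts arcs E zy in \<open>auto simp: en_def\<close>)
  then show ?thesis by (rule dipole.obtainable)
qed

section \<open>Decomposition of connected graphs\<close>

lemma comp_of_conn:
  assumes "is_lgraph G" "conn G" "x \<in> verts G"
  shows "comp_of G x = G"
proof -
  have v: "{y. \<exists>es. wk G {} x es y} = verts G"
    using assms(2,3) wk_ends unfolding conn_def by fast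
  have "{e \<in> arcs G. \<exists>es. wk G {} x es (tail G e)} = arcs G"
    using v is_lgraphD(3)[OF assms(1)] by blast
  then show ?thesis using v by (simp add: comp_of_def)
qed

lemma subgraph_comp_of:
  assumes "is_lgraph G"
  shows "subgraph (underlying (comp_of G x)) (underlying G)"
  using assms is_lgraph_comp[OF assms, of x] verts_comp_subset[of G x] arcs_comp_subset[of G x]
  by (auto simp: subgraph_def is_lgraph_def fin_digraph_def compatible_def)

lemma subgraph_wk: "subgraph H' H \<Longrightarrow> wk H' X x es y \<Longrightarrow> wk H X x es y"
  by (erule wk_cong_mono) (auto simp: subgraph_def joins_def compatible_def)

text \<open>A connected subgraph containing it reaches only vertices that \<open>x\<close> reaches,
  and the arcs at these vertices are already present.\<close>

lemma component_comp_of: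
  assumes "is_lgraph G" "x \<in> verts G"
  shows "component G (comp_of G x)"
  unfolding component_def pre_digraph.max_subgraph_def
proof (intro conjI allI impI)
  let ?K = "underlying (comp_of G x)"
  show "subgraph ?K (underlying G)" by (rule subgraph_comp_of[OF assms(1)])
  show "connected ?K"
    using connected_underlying[OF is_lgraph_comp[OF assms(1)]] conn_comp[OF assms] by blast
  fix H' assume H': "H' \<noteq> ?K \<and> subgraph ?K H'"
  show "\<not> (subgraph H' (underlying G) \<and> connected H')"
  proof
    assume *: "subgraph H' (underlying G) \<and> connected H'"
    have wf: "wf_digraph H'" using * by (simp add: subgraph_def)
    have c: "conn H'" using * connected_iff_conn[OF wf] by blast
    have "x \<in> verts ?K" using comp_of_self[OF assms(2)] by simp
    then have xH: "x \<in> verts H'" using H' by (auto simp: subgraph_def)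
    have v: "verts H' \<subseteq> verts ?K"
    proof
      fix y assume "y \<in> verts H'"
      then obtain es where "wk H' {} x es y" using c xH unfolding conn_def by blast
      then have "wk (underlying G) {} x es y" by (rule subgraph_wk[OF conjunct1[OF *]])
      then show "y \<in> verts ?K" by auto
    qed
    have th: "tail H' = tail G" "head H' = head G" using * by (auto simp: subgraph_def compatible_def)
    have a: "arcs H' \<subseteq> arcs ?K"
    proof
      fix e assume e: "e \<in> arcs H'"
      then have "tail H' e \<in> verts ?K" using wf v by (auto simp: wf_digraph_def)
      moreover have "e \<in> arcs G" using e * by (auto simp: subgraph_def)
      ultimately show "e \<in> arcs ?K" using th by (simp add: comp_of_def)
    qed
    have "verts H' = verts ?K" "arcs H' = arcs ?K" using v a H' by (auto simp: subgraph_def)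
    then have "H' = ?K" using th by (simp add: pre_digraph.equality)
    then show False using H' by blast
  qed
qed simp

text \<open>The component is contained in the graph reachable from any of its vertices, which is
  connected; maximality gives equality.\<close>

lemma component_eq_comp_of:
  assumes "is_lgraph G" "component G C"
  obtains x where "x \<in> verts G" "C = comp_of G x"
proof -
  have C: "subgraph (underlying C) (underlying G)" "connected (underlying C)" "len C = len G"
    "\<And>H'. H' \<noteq> underlying C \<Longrightarrow> subgraph (underlying C) H' \<Longrightarrow> subgraph H' (underlying G) \<Longrightarrow> \<not> connected H'"
    using assms(2) by (auto simp: component_def pre_digraph.max_subgraph_def)
  have wf: "wf_digraph (underlying C)" using C(1) by (simp add: subgraph_def)
  have c: "conn C" using C(2) connected_iff_conn[OF wf] by (simp add: conn_def)
  then obtain x where x: "x \<in> verts C" unfolding conn_def by blast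
  have sub: "verts C \<subseteq> verts G" "arcs C \<subseteq> arcs G" "tail C = tail G" "head C = head G"
    using C(1) by (auto simp: subgraph_def compatible_def)
  let ?D = "comp_of G x"
  have v: "verts C \<subseteq> verts ?D"
  proof
    fix y assume "y \<in> verts C"
    then obtain es where "wk C {} x es y" using c x unfolding conn_def by blast
    then have "wk (underlying C) {} x es y" by simp
    then have "wk (underlying G) {} x es y" by (rule subgraph_wk[OF C(1)])
    then show "y \<in> verts ?D" by auto
  qed
  have "arcs C \<subseteq> arcs ?D"
  proof
    fix e assume e: "e \<in> arcs C"
    then have "tail C e \<in> verts ?D" using wf v by (auto simp: wf_digraph_def)
    then show "e \<in> arcs ?D" using e sub by (auto simp: comp_of_def)
  qed
  then have "subgraph (underlying C) (underlying ?D)"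
    using v sub wf subgraph_comp_of[OF assms(1), of x] by (auto simp: subgraph_def compatible_def)
  moreover have "x \<in> verts G" using x sub by blast
  then have "connected (underlying ?D)"
    using connected_underlying[OF is_lgraph_comp[OF assms(1)]] conn_comp[OF assms(1)] by blast
  ultimately have "underlying ?D = underlying C"
    using C(4)[of "underlying ?D"] subgraph_comp_of[OF assms(1), of x] by blast
  then have "verts ?D = verts C" "arcs ?D = arcs C"
    by (metis verts_underlying) (metis \<open>underlying ?D = underlying C\<close> arcs_underlying)
  then have "C = ?D" using sub C(3) by (simp add: lgraph.equality)
  then show ?thesis using that \<open>x \<in> verts G\<close> by blast
qed

text \<open>Either the copies are joined in one component and the number of classes drops, or there
  are two components, where it does not grow and the number of edges drops. Symmetry of the sides
  covers the second component.\<close>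

lemma obtainable_reducible:
  fixes G :: "(nat, nat) lgraph"
  assumes "conn G" "reducible r G"
    and IH: "\<And>K :: (nat, nat) lgraph. loc2 r K \<Longrightarrow> conn K \<Longrightarrow>
      card (classes r K) < card (classes r G) \<or>
      card (classes r K) \<le> card (classes r G) \<and> card (arcs K) < card (arcs G) \<Longrightarrow> obtainable r K"
  shows "obtainable r G"
proof -
  obtain v w k A where sep: "sep r G v w k A"
    and two: "\<exists>e \<in> A. \<exists>f \<in> A. e \<noteq> f \<and> (inc G e v \<or> inc G e w) \<and> (inc G f v \<or> inc G f w)"
      "\<exists>e \<in> - A. \<exists>f \<in> - A. e \<noteq> f \<and> (inc G e v \<or> inc G e w) \<and> (inc G f v \<or> inc G f w)"
    using assms(2) unfolding reducible_def by blast
  obtain G' a b v' w' where cut: "cut r G v w k A G' a b v w v' w'"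
    using sep.ex_cut[OF sep] infinite_UNIV_nat by blast
  interpret c: cut r G v w k A G' a b v w v' w' by (rule cut)
  interpret d: cut r G v w k "- A" G' b a v' w' v w by (rule c.cut_compl)
  have "obtainable r c.Ka"
  proof (rule IH[OF loc2_comp[OF c.loc2'] conn_comp[OF c.lg' c.TG'(1)]])
    show "card (classes r c.Ka) < card (classes r G) \<or>
      card (classes r c.Ka) \<le> card (classes r G) \<and> card (arcs c.Ka) < card (arcs G)"
      using c.card_classes_le c.card_classes_less c.card_arcs_less[OF two(2)] by blast
  qed
  moreover have "obtainable r c.Kb"
  proof (rule IH[OF loc2_comp[OF c.loc2'] conn_comp[OF c.lg' c.TG'(3)]])
    show "card (classes r c.Kb) < card (classes r G) \<or>
      card (classes r c.Kb) \<le> card (classes r G) \<and> card (arcs c.Kb) < card (arcs G)"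
      using d.card_classes_le d.card_classes_less d.card_arcs_less two(1) by (metis double_compl)
  qed
  ultimately have "\<forall>i<2. obtainable r (c.parts i)" by (simp add: c.parts_def)
  from obtainable.local_2_sum[OF this c.summable_parts c.local_parts c.lg c.sum_parts_iso[OF assms(1)]]
  show ?thesis .
qed

text \<open>The induction is lexicographic, with the number of classes first, because a cut that
  leaves the graph connected increases the number of edges.\<close>

lemma obtainable_connected:
  fixes G :: "(nat, nat) lgraph"
  assumes "loc2 r G" "conn G"
  shows "obtainable r G"
  using assms
proof (induction G rule: wf_induct_rule[OF wf_measures[of "[\<lambda>G. card (classes r G), \<lambda>G. card (arcs G)]"]])
  case (1 G)
  show ?case
  proof (cases "reducible r G")
    case True
    show ?thesis
    proof (rule obtainable_reducible[OF 1(3) True])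
      fix K :: "(nat, nat) lgraph"
      assume "loc2 r K" "conn K" "card (classes r K) < card (classes r G) \<or>
        card (classes r K) \<le> card (classes r G) \<and> card (arcs K) < card (arcs G)"
      then show "obtainable r K" by (intro 1(1)) (auto simp: le_less)
    qed
  next
    case False
    show ?thesis
    proof (cases "card (verts G) < 4")
      case True
      then show ?thesis using obtainable_few_vertices[OF 1(2,3) False] by blast
    next
      case card: False
      have G: "is_lgraph G" using 1(2) by (simp add: loc2_def)
      have "\<not> local_2_separator r G v w" for v w
      proof
        assume "local_2_separator r G v w"
        then obtain k A where "sep r G v w k A"
          "\<exists>e \<in> A. \<exists>f \<in> A. e \<noteq> f \<and> (inc G e v \<or> inc G e w) \<and> (inc G f v \<or> inc G f w)"
          "\<exists>e \<in> - A. \<exists>f \<in> - A. e \<noteq> f \<and> (inc G e v \<or> inc G e w) \<and> (inc G f v \<or> inc G f w)"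
          by (rule sep_of_local_2_separator[OF 1(2,3)])
        then show False using False unfolding reducible_def by blast
      qed
      then have c3: "connected_locally_3_connected r G"
        using 1(2,3) card connected_locally_2_connected_iff unfolding connected_locally_3_connected_def by auto
      have "C = G" if "component G C" for C
        using component_eq_comp_of[OF G that] comp_of_conn[OF G 1(3)] by metis
      then have "locally_3_connected r G"
        using c3 G unfolding locally_3_connected_def locally_2_connected_def connected_locally_3_connected_def
        by blast
      then show ?thesis by (rule obtainable.three_connected)
    qed
  qed
qed

section \<open>Renaming vertices and edges\<close>

text \<open>The map \<open>g\<close> is injective on the arcs only, so its inverse is taken relative
  to them.\<close>

definition rename :: "('a \<Rightarrow> 'c) \<Rightarrow> ('b \<Rightarrow> 'd) \<Rightarrow> ('a, 'b) lgraph \<Rightarrow> ('c, 'd) lgraph" where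
  "rename f g G = \<lparr> verts = f ` verts G, arcs = g ` arcs G,
     tail = (\<lambda>e. f (tail G (inv_into (arcs G) g e))), head = (\<lambda>e. f (head G (inv_into (arcs G) g e))),
     len = (\<lambda>e. len G (inv_into (arcs G) g e)) \<rparr>"

locale renaming =
  fixes f :: "'a \<Rightarrow> 'c" and g :: "'b \<Rightarrow> 'd" and G :: "('a, 'b) lgraph"
  assumes lg: "is_lgraph G" and f: "inj_on f (verts G)" and g: "inj_on g (arcs G)"
begin

abbreviation "H \<equiv> rename f g G"

lemma H_simps: "verts H = f ` verts G" "arcs H = g ` arcs G"
  "e \<in> arcs G \<Longrightarrow> tail H (g e) = f (tail G e)" "e \<in> arcs G \<Longrightarrow> head H (g e) = f (head G e)"
  "e \<in> arcs G \<Longrightarrow> len H (g e) = len G e"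
  using g by (simp_all add: rename_def)

lemma lgraph_iso_rename: "lgraph_iso G H"
  unfolding lgraph_iso_def
  by (rule exI[of _ f], rule exI[of _ g]) (use f g in \<open>simp add: bij_betw_def H_simps\<close>)

lemma lg_H: "is_lgraph H"
proof -
  have "f (tail G e) \<noteq> f (head G e)" if "e \<in> arcs G" for e
    using is_lgraphD(3-5)[OF lg that] inj_onD[OF f] by blast
  then show ?thesis using is_lgraphD[OF lg] by (intro is_lgraphI) (auto simp: H_simps)
qed

lemma joins_H: "joins G e p q \<Longrightarrow> joins H (g e) (f p) (f q)"
  by (auto simp: joins_def H_simps)

lemma inc_H: "x \<in> verts G \<Longrightarrow> inc H e' (f x) \<longleftrightarrow> (\<exists>e. e' = g e \<and> inc G e x)"
  using f is_lgraphD(3,4)[OF lg] by (fastforce simp: inc_def H_simps inj_on_def)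

lemma short_H:
  assumes "short r G v e e'"
  shows "short r H (f v) (g e) (g e')"
proof -
  obtain x y es where *: "joins G e v x" "wk G {v} x es y" "joins G e' y v"
    "enat (len G e + wt G es + len G e') \<le> r" using assms unfolding short_def by blast
  have v: "v \<in> verts G" using joins_verts[OF lg *(1)] by blast
  have "wk H {f v} (f x) (map g es) (f y)"
    by (rule wk_map[OF *(2)]) (use joins_H f v in \<open>auto simp: H_simps inj_on_def\<close>)
  moreover have "wt H (map g es) = wt G es"
    using wk_arcs[OF *(2)] by (induction es) (auto simp: H_simps)
  moreover have "len H (g e) = len G e" "len H (g e') = len G e'"
    using *(1,3) joins_arc H_simps(5) by fast+
  ultimately show ?thesis
    unfolding short_def using joins_H[OF *(1)] joins_H[OF *(3)] *(4)
    by (intro exI[of _ "f x"] exI[of _ "f y"] exI[of _ "map g es"]) simp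
qed

lemma loc2_H:
  assumes "loc2 r G"
  shows "loc2 r H"
  unfolding loc2_def
proof (intro conjI ballI lg_H)
  fix x' assume "x' \<in> verts H"
  then obtain x where x: "x \<in> verts G" "x' = f x" by (auto simp: H_simps)
  obtain e e' where e: "e \<noteq> e'" "inc G e x" "inc G e' x" using assms x unfolding loc2_def by blast
  have "g e \<noteq> g e'" using e g by (auto simp: inj_on_def inc_def)
  then show "\<exists>e f. e \<noteq> f \<and> inc H e x' \<and> inc H f x'" using e inc_H[OF x(1)] x(2) by blast
  show "linked_at r H x'"
    unfolding linked_at_def
  proof (intro allI impI)
    fix A d d'
    assume A: "\<forall>e f. short r H x' e f \<longrightarrow> (e \<in> A) = (f \<in> A)" and "inc H d x'" "inc H d' x'"
    then obtain e e' where e: "d = g e" "inc G e x" "d' = g e'" "inc G e' x"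
      using inc_H[OF x(1)] x(2) by blast
    have "linked_at r G x" using assms x unfolding loc2_def by blast
    from linked_atD[OF this, of "{e. g e \<in> A}" e e'] show "(d \<in> A) = (d' \<in> A)"
      using A short_H x(2) e by blast
  qed
qed

end

lemma loc2_of_locally_2_connected:
  assumes "locally_2_connected r G"
  shows "loc2 r G"
proof -
  have G: "is_lgraph G" using assms by (simp add: locally_2_connected_def)
  show ?thesis
    unfolding loc2_def
  proof (intro conjI ballI G)
    fix x assume x: "x \<in> verts G"
    have "connected_locally_2_connected r (comp_of G x)"
      using assms component_comp_of[OF G x] unfolding locally_2_connected_def by blast
    then have K: "loc2 r (comp_of G x)" using connected_locally_2_connected_iff by blast
    have self: "x \<in> verts (comp_of G x)" by (rule comp_of_self[OF x])
    show "\<exists>e f. e \<noteq> f \<and> inc G e x \<and> inc G f x"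
      using K self unfolding loc2_def inc_comp[OF G self, symmetric] by blast
    show "linked_at r G x"
      using K self unfolding loc2_def linked_at_comp[OF G self, symmetric] by blast
  qed
qed

text \<open>Every cut needs new names for vertices and edges, and the types of \<open>G\<close> may
  be finite. A finite graph can be renamed to natural numbers, where names never run out; the
  decomposition is then carried out in each component.\<close>

theorem theoremA1:
  fixes r :: enat and G :: "('v, 'e) lgraph"
  assumes "locally_2_connected r G"
  shows "\<exists>H :: (nat, nat) lgraph. lgraph_iso G H \<and> obtainable r H"
proof -
  have G: "loc2 r G" "is_lgraph G"
    using loc2_of_locally_2_connected[OF assms] assms by (auto simp: locally_2_connected_def)
  obtain f :: "'v \<Rightarrow> nat" where f: "inj_on f (verts G)"
    using finite_imp_inj_to_nat_seg[OF is_lgraphD(1)[OF G(2)]] by blast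
  obtain g :: "'e \<Rightarrow> nat" where g: "inj_on g (arcs G)"
    using finite_imp_inj_to_nat_seg[OF is_lgraphD(2)[OF G(2)]] by blast
  interpret renaming f g G by unfold_locales (use G(2) f g in auto)
  have "obtainable r C" if C: "component H C" for C
  proof -
    obtain x where x: "x \<in> verts H" "C = comp_of H x" by (rule component_eq_comp_of[OF lg_H C])
    show ?thesis
      unfolding x(2) by (rule obtainable_connected[OF loc2_comp[OF loc2_H[OF G(1)]] conn_comp[OF lg_H x(1)]])
  qed
  then have "obtainable r H" using obtainable.componentwise[OF lg_H] by blast
  then show ?thesis using lgraph_iso_rename by blast
qed

end
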